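(* Let $\mathbb{K}\in\{\mathbb{R},\mathbb{C}\}$, let $\mathcal{H}$ be a connected and graded Hopf algebra over $\mathbb{K}$, let $\mathcal{J}\subseteq\mathcal{H}$ be a Hopf ideal, and let $B$ be a commutative locally convex algebra over $\mathbb{K}$. (a) $\mathrm{Ann}(\mathcal{J},B)\cap G(\mathcal{H},B)$ is a closed Lie subgroup of $G(\mathcal{H},B)$ whose Lie algebra is $\mathrm{Ann}(\mathcal{J},B)\cap\mathfrak{g}(\mathcal{H},B)$. (b) There is a canonical isomorphism of topological groups $G(\mathcal{H}/\mathcal{J},B)\to\mathrm{Ann}(\mathcal{J},B)\cap G(\mathcal{H},B)$, $\phi\mapsto\phi\circ q$, where $\mathcal{H}/\mathcal{J}$ is the quotient Hopf algebra and $q:\mathcal{H}\to\mathcal{H}/\mathcal{J}$ the quotient map. If $\mathcal{H}/\mathcal{J}$ is a connected and graded Hopf algebra (e.g. if $\mathcal{J}$ is a homogeneous ideal), then this map is an isomorphism of Lie groups.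
   Context: Algebras are unital associative $\mathbb{K}$-algebras. A locally convex space is a Hausdorff locally convex topological $\mathbb{K}$-vector space. A locally convex algebra is an algebra with a locally convex vector space topology for which multiplication $B\times B\to B$ is continuous. Graded connected Hopf algebra: a Hopf algebra $\mathcal{H}$ with a decomposition $\mathcal{H}=\bigoplus_{n\in\mathbb{N}_0}\mathcal{H}_n$ such that $1_{\mathcal{H}}\in\mathcal{H}_0$, $\mathcal{H}_n\mathcal{H}_m\subseteq\mathcal{H}_{n+m}$, $\Delta(\mathcal{H}_n)\subseteq\bigoplus_{i+j=n}\mathcal{H}_i\otimes\mathcal{H}_j$, $\bigoplus_{n\ge1}\mathcal{H}_n\subseteq\ker\epsilon$, and $\dim\mathcal{H}_0=1$. Hopf ideal: a two-sided ideal $\mathcal{J}$ with $\epsilon(\mathcal{J})=0$, $\Delta(\mathcal{J})\subseteq\mathcal{J}\otimes\mathcal{H}+\mathcal{H}\otimes\mathcal{J}$ and $S(\mathcal{J})\subseteq\mathcal{J}$. It is homogeneous if it contains the homogeneous components of each of its elements. For a Hopf algebra $\mathcal{K}$ put $\mathrm{Hom}_{\mathbb{K}}(\mathcal{K},B)$ with the topology of pointwise convergence and convolution $\phi\star\psi=m_B\circ(\phi\otimes\psi)\circ\Delta_{\mathcal{K}}$. $G(\mathcal{K},B)$ is the topological group (under $\star$, pointwise convergence) of unital algebra homomorphisms $\mathcal{K}\to B$. $\mathfrak{g}(\mathcal{K},B)$ is the Lie algebra (commutator bracket of $\star$) of linear $\phi:\mathcal{K}\to B$ with $\phi(ab)=\epsilon(a)\phi(b)+\epsilon(b)\phi(a)$.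 $\mathrm{Ann}(\mathcal{J},B)=\{\phi\in\mathrm{Hom}_{\mathbb{K}}(\mathcal{H},B):\phi(\mathcal{J})=0\}$. If $\mathcal{K}$ is graded and connected, $G(\mathcal{K},B)$ is a $\mathbb{K}$-analytic Lie group with Lie algebra $\mathfrak{g}(\mathcal{K},B)$, with the structure inherited as a $\mathbb{K}$-analytic submanifold of $\mathrm{Hom}_{\mathbb{K}}(\mathcal{K},B)$ (locally, in suitable $\mathbb{K}$-analytic charts of the affine subspace $\{\phi:\phi(1)=1_B\}$, it corresponds to a closed vector subspace). A closed Lie subgroup of a Lie group is a closed subgroup which is a $\mathbb{K}$-analytic submanifold in the same sense (locally a closed vector subspace in suitable charts), hence a Lie group with the induced structure. Calculus (Keller's $C^r_c$-theory): maps between open subsets of locally convex spaces are $C^r$ if iterated directional derivatives up to order $r$ exist and are jointly continuous; $\mathbb{K}$-analytic means $C^\infty_{\mathbb{C}}$ if $\mathbb{K}=\mathbb{C}$, and extendable to a $C^\infty_{\mathbb{C}}$-map on an open neighbourhood in the complexification if $\mathbb{K}=\mathbb{R}$. Lie groups are modelled on locally convex spaces. *)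

theory Defs
  imports
    "HOL-Analysis.Analysis"
    "HOL-Algebra.Algebraic_Closure_Type"
    "HOL-Algebra.QuotRing"
    "HOL-Algebra.Module"
    "HOL-Library.Function_Algebras"
begin

section \<open>The scalar field\<close>

text \<open>A type of this class is, as a normed field, either the reals or the complex numbers:
  multiplicativity of the norm and \<open>norm (of_real r) = \<bar>r\<bar>\<close> leave no other
  possibility once the field itself is known.\<close>

class real_or_complex = real_normed_field +
  assumes real_or_complex:
    "(\<forall>z. \<exists>a. z = a *\<^sub>R 1) \<or> (\<exists>i. i * i = - 1 \<and> (\<forall>z. \<exists>a b. z = a *\<^sub>R 1 + b *\<^sub>R i))"

instance real :: real_or_complex
  by standard auto

instance complex :: real_or_complex
proof
  have "\<i> * \<i> = - 1 \<and> (\<forall>z. \<exists>a b. z = a *\<^sub>R 1 + b *\<^sub>R \<i>)"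
    by (auto simp: complex_eq_iff)
  then show "(\<forall>z::complex. \<exists>a. z = a *\<^sub>R 1) \<or>
      (\<exists>i::complex. i * i = - 1 \<and> (\<forall>z. \<exists>a b. z = a *\<^sub>R 1 + b *\<^sub>R i))"
    by blast
qed


section \<open>Tensor products\<close>

text \<open>Vector spaces, algebras and Hopf algebras that have to be passed to quotients are records
  with an explicit carrier; the field is \<open>ring_of_type_algebra\<close>.

  Over a field, the tensor product \<open>M \<otimes> M\<close> embeds into the dual of the space of bilinear
  forms on \<open>M\<close> by \<open>(x \<otimes> y) \<beta> = \<beta> x y\<close>, and it is realised as the linear span of these
  evaluation functionals; likewise \<open>M \<otimes> M \<otimes> M\<close> with trilinear forms.  A list
  \<open>[(x\<^sub>1, y\<^sub>1), \<dots>]\<close> stands for the tensor \<open>x\<^sub>1 \<otimes> y\<^sub>1 + \<dots>\<close>.\<close>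

type_synonym ('k, 'a) tensor2 = "('a \<Rightarrow> 'a \<Rightarrow> 'k) \<Rightarrow> 'k"
type_synonym ('k, 'a) tensor3 = "('a \<Rightarrow> 'a \<Rightarrow> 'a \<Rightarrow> 'k) \<Rightarrow> 'k"

definition linear_form :: "('k::field, 'a, 'm) module_scheme \<Rightarrow> ('a \<Rightarrow> 'k) \<Rightarrow> bool" where
  "linear_form M l \<longleftrightarrow>
     (\<forall>x\<in>carrier M. \<forall>y\<in>carrier M. l (x \<oplus>\<^bsub>M\<^esub> y) = l x + l y) \<and>
     (\<forall>c. \<forall>x\<in>carrier M. l (c \<odot>\<^bsub>M\<^esub> x) = c * l x)"

definition bilinear_form :: "('k::field, 'a, 'm) module_scheme \<Rightarrow> ('a \<Rightarrow> 'a \<Rightarrow> 'k) \<Rightarrow> bool" where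
  "bilinear_form M \<beta> \<longleftrightarrow>
     (\<forall>y\<in>carrier M. linear_form M (\<lambda>x. \<beta> x y)) \<and> (\<forall>x\<in>carrier M. linear_form M (\<lambda>y. \<beta> x y))"

definition trilinear_form ::
    "('k::field, 'a, 'm) module_scheme \<Rightarrow> ('a \<Rightarrow> 'a \<Rightarrow> 'a \<Rightarrow> 'k) \<Rightarrow> bool" where
  "trilinear_form M \<tau> \<longleftrightarrow>
     (\<forall>z\<in>carrier M. bilinear_form M (\<lambda>x y. \<tau> x y z)) \<and>
     (\<forall>x\<in>carrier M. bilinear_form M (\<lambda>y z. \<tau> x y z))"

definition tensor_of ::
    "('k::field, 'a, 'm) module_scheme \<Rightarrow> ('a \<times> 'a) list \<Rightarrow> ('k, 'a) tensor2" where
  "tensor_of M xs = (\<lambda>\<beta>. if bilinear_form M \<beta> then (\<Sum>(x, y)\<leftarrow>xs. \<beta> x y) else 0)"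

definition pure_tensor3 ::
    "('k::field, 'a, 'm) module_scheme \<Rightarrow> 'a \<Rightarrow> 'a \<Rightarrow> 'a \<Rightarrow> ('k, 'a) tensor3" where
  "pure_tensor3 M x y z = (\<lambda>\<tau>. if trilinear_form M \<tau> then \<tau> x y z else 0)"

text \<open>The sums of pure tensors \<open>x \<otimes> y\<close> with \<open>(x, y) \<in> R\<close>.  For linear subspaces \<open>V\<close>, \<open>W\<close> of
  \<open>M\<close>, the image of \<open>V \<otimes> W\<close> in \<open>M \<otimes> M\<close> is \<open>tensors M (V \<times> W)\<close>, and a sum of such subspaces
  corresponds to the union of the sets \<open>V \<times> W\<close>.\<close>

definition tensors ::
    "('k::field, 'a, 'm) module_scheme \<Rightarrow> ('a \<times> 'a) set \<Rightarrow> ('k, 'a) tensor2 set" where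
  "tensors M R = {tensor_of M xs | xs. set xs \<subseteq> R}"

text \<open>The linear map on \<open>M \<otimes> M\<close> induced by a bilinear map \<open>f\<close>.  The zero \<open>z\<close> and addition \<open>p\<close>
  of the target are parameters, since targets may be types or records.\<close>

definition tensor_lift :: "('k::field, 'a, 'm) module_scheme \<Rightarrow> 'c \<Rightarrow> ('c \<Rightarrow> 'c \<Rightarrow> 'c) \<Rightarrow>
    ('a \<Rightarrow> 'a \<Rightarrow> 'c) \<Rightarrow> ('k, 'a) tensor2 \<Rightarrow> 'c" where
  "tensor_lift M z p f t =
     (THE b. \<exists>xs. set xs \<subseteq> carrier M \<times> carrier M \<and> t = tensor_of M xs \<and>
                  b = foldr (\<lambda>(x, y). p (f x y)) xs z)"


section \<open>Hopf algebras\<close>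

record ('k, 'a) hopf = "('k, 'a) module" +
  comult :: "'a \<Rightarrow> ('a \<Rightarrow> 'a \<Rightarrow> 'k) \<Rightarrow> 'k"
  counit :: "'a \<Rightarrow> 'k"
  antipode :: "'a \<Rightarrow> 'a"

definition tensor_mult ::
    "('k::field, 'a, 'm) module_scheme \<Rightarrow> ('k, 'a) tensor2 \<Rightarrow> ('k, 'a) tensor2 \<Rightarrow> ('k, 'a) tensor2"
  where
  "tensor_mult A t u =
     tensor_lift A 0 (+) (\<lambda>x y. tensor_lift A 0 (+)
       (\<lambda>x' y'. tensor_of A [(x \<otimes>\<^bsub>A\<^esub> x', y \<otimes>\<^bsub>A\<^esub> y')]) u) t"

text \<open>Not necessarily commutative; \<open>algebra\<close> of HOL-Algebra requires a commutative ring.\<close>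

definition unital_algebra :: "('k::field, 'a, 'm) module_scheme \<Rightarrow> bool" where
  "unital_algebra A \<longleftrightarrow> ring A \<and> module (ring_of_type_algebra :: 'k ring) A \<and>
     (\<forall>c. \<forall>x\<in>carrier A. \<forall>y\<in>carrier A.
        (c \<odot>\<^bsub>A\<^esub> x) \<otimes>\<^bsub>A\<^esub> y = c \<odot>\<^bsub>A\<^esub> (x \<otimes>\<^bsub>A\<^esub> y) \<and> x \<otimes>\<^bsub>A\<^esub> (c \<odot>\<^bsub>A\<^esub> y) = c \<odot>\<^bsub>A\<^esub> (x \<otimes>\<^bsub>A\<^esub> y))"

definition coalgebra :: "('k::field, 'a, 'm) hopf_scheme \<Rightarrow> bool" where
  "coalgebra C \<longleftrightarrow> module (ring_of_type_algebra :: 'k ring) C \<and>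
     comult C ` carrier C \<subseteq> tensors C (carrier C \<times> carrier C) \<and>
     (\<forall>x\<in>carrier C. \<forall>y\<in>carrier C. comult C (x \<oplus>\<^bsub>C\<^esub> y) = comult C x + comult C y) \<and>
     (\<forall>c. \<forall>x\<in>carrier C. comult C (c \<odot>\<^bsub>C\<^esub> x) = (\<lambda>\<beta>. c * comult C x \<beta>)) \<and>
     linear_form C (counit C) \<and>
     (\<forall>x\<in>carrier C.
        tensor_lift C 0 (+)
          (\<lambda>a b. tensor_lift C 0 (+) (\<lambda>a' a''. pure_tensor3 C a' a'' b) (comult C a)) (comult C x) =
        tensor_lift C 0 (+)
          (\<lambda>a b. tensor_lift C 0 (+) (\<lambda>b' b''. pure_tensor3 C a b' b'') (comult C b)) (comult C x)) \<and>
     (\<forall>x\<in>carrier C.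
        tensor_lift C \<zero>\<^bsub>C\<^esub> (add C) (\<lambda>a b. counit C a \<odot>\<^bsub>C\<^esub> b) (comult C x) = x \<and>
        tensor_lift C \<zero>\<^bsub>C\<^esub> (add C) (\<lambda>a b. counit C b \<odot>\<^bsub>C\<^esub> a) (comult C x) = x)"

definition hopf_algebra :: "('k::field, 'a, 'm) hopf_scheme \<Rightarrow> bool" where
  "hopf_algebra H \<longleftrightarrow> unital_algebra H \<and> coalgebra H \<and>
     comult H \<one>\<^bsub>H\<^esub> = tensor_of H [(\<one>\<^bsub>H\<^esub>, \<one>\<^bsub>H\<^esub>)] \<and>
     (\<forall>x\<in>carrier H. \<forall>y\<in>carrier H.
        comult H (x \<otimes>\<^bsub>H\<^esub> y) = tensor_mult H (comult H x) (comult H y)) \<and>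
     counit H \<one>\<^bsub>H\<^esub> = 1 \<and>
     (\<forall>x\<in>carrier H. \<forall>y\<in>carrier H. counit H (x \<otimes>\<^bsub>H\<^esub> y) = counit H x * counit H y) \<and>
     antipode H \<in> carrier H \<rightarrow> carrier H \<and>
     (\<forall>x\<in>carrier H. \<forall>y\<in>carrier H. antipode H (x \<oplus>\<^bsub>H\<^esub> y) = antipode H x \<oplus>\<^bsub>H\<^esub> antipode H y) \<and>
     (\<forall>c. \<forall>x\<in>carrier H. antipode H (c \<odot>\<^bsub>H\<^esub> x) = c \<odot>\<^bsub>H\<^esub> antipode H x) \<and>
     (\<forall>x\<in>carrier H.
        tensor_lift H \<zero>\<^bsub>H\<^esub> (add H) (\<lambda>a b. antipode H a \<otimes>\<^bsub>H\<^esub> b) (comult H x)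
          = counit H x \<odot>\<^bsub>H\<^esub> \<one>\<^bsub>H\<^esub> \<and>
        tensor_lift H \<zero>\<^bsub>H\<^esub> (add H) (\<lambda>a b. a \<otimes>\<^bsub>H\<^esub> antipode H b) (comult H x)
          = counit H x \<odot>\<^bsub>H\<^esub> \<one>\<^bsub>H\<^esub>)"

definition homogeneous_decomposition ::
    "('k, 'a, 'm) module_scheme \<Rightarrow> (nat \<Rightarrow> 'a set) \<Rightarrow> 'a \<Rightarrow> (nat \<Rightarrow> 'a) \<Rightarrow> bool" where
  "homogeneous_decomposition M Mn x f \<longleftrightarrow> (\<forall>n. f n \<in> Mn n) \<and> finite {n. f n \<noteq> \<zero>\<^bsub>M\<^esub>} \<and>
     x = finsum M f {n. f n \<noteq> \<zero>\<^bsub>M\<^esub>}"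

definition direct_sum_decomposition ::
    "('k::field, 'a, 'm) module_scheme \<Rightarrow> (nat \<Rightarrow> 'a set) \<Rightarrow> bool" where
  "direct_sum_decomposition M Mn \<longleftrightarrow>
     (\<forall>n. submodule (Mn n) (ring_of_type_algebra :: 'k ring) M) \<and>
     (\<forall>x\<in>carrier M. \<exists>!f. homogeneous_decomposition M Mn x f)"

definition graded_connected_hopf ::
    "('k::field, 'a, 'm) hopf_scheme \<Rightarrow> (nat \<Rightarrow> 'a set) \<Rightarrow> bool" where
  "graded_connected_hopf H Hn \<longleftrightarrow> hopf_algebra H \<and> direct_sum_decomposition H Hn \<and>
     \<one>\<^bsub>H\<^esub> \<in> Hn 0 \<and>
     (\<forall>n m. \<forall>x\<in>Hn n. \<forall>y\<in>Hn m. x \<otimes>\<^bsub>H\<^esub> y \<in> Hn (n + m)) \<and>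
     (\<forall>n. comult H ` Hn n \<subseteq> tensors H (\<Union>i\<in>{..n}. Hn i \<times> Hn (n - i))) \<and>
     (\<forall>n\<ge>1. \<forall>x\<in>Hn n. counit H x = 0) \<and>
     \<comment> \<open>the degree zero part is one-dimensional\<close>
     (\<exists>v\<in>Hn 0. v \<noteq> \<zero>\<^bsub>H\<^esub> \<and> Hn 0 = {c \<odot>\<^bsub>H\<^esub> v | c. True})"

text \<open>A two-sided ideal of a unital algebra is automatically a linear subspace.\<close>

definition hopf_ideal :: "('k::field, 'a, 'm) hopf_scheme \<Rightarrow> 'a set \<Rightarrow> bool" where
  "hopf_ideal H J \<longleftrightarrow> ideal J H \<and> (\<forall>x\<in>J. counit H x = 0) \<and>
     comult H ` J \<subseteq> tensors H (J \<times> carrier H \<union> carrier H \<times> J) \<and>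
     antipode H ` J \<subseteq> J"

definition homogeneous_ideal ::
    "('k, 'a, 'm) module_scheme \<Rightarrow> (nat \<Rightarrow> 'a set) \<Rightarrow> 'a set \<Rightarrow> bool" where
  "homogeneous_ideal H Hn J \<longleftrightarrow>
     (\<forall>x\<in>J. \<forall>f. homogeneous_decomposition H Hn x f \<longrightarrow> (\<forall>n. f n \<in> J))"

text \<open>The Hopf algebra structure on the cosets of a Hopf ideal.  Each structure map is the one
  induced from representatives; for the comultiplication this is
  \<open>(q \<otimes> q) (\<Delta> x)\<close> with \<open>q\<close> the quotient map.\<close>

definition quot_module :: "('k, 'a, 'm) module_scheme \<Rightarrow> 'a set \<Rightarrow> ('k, 'a set) module" where
  "quot_module H J = \<lparr>carrier = carrier (H Quot J), mult = mult (H Quot J), one = one (H Quot J),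
     zero = zero (H Quot J), add = add (H Quot J),
     smult = (\<lambda>c C. \<Union>x\<in>C. J +>\<^bsub>H\<^esub> (c \<odot>\<^bsub>H\<^esub> x))\<rparr>"

definition quot_hopf :: "('k::field, 'a, 'm) hopf_scheme \<Rightarrow> 'a set \<Rightarrow> ('k, 'a set) hopf" where
  "quot_hopf H J = module.extend (quot_module H J) (hopf.fields
     (\<lambda>C. THE t. \<exists>x\<in>C. t = tensor_lift H 0 (+)
        (\<lambda>a b. tensor_of (quot_module H J) [(J +>\<^bsub>H\<^esub> a, J +>\<^bsub>H\<^esub> b)]) (comult H x))
     (\<lambda>C. THE r. \<exists>x\<in>C. r = counit H x)
     (\<lambda>C. \<Union>x\<in>C. J +>\<^bsub>H\<^esub> antipode H x))"


section \<open>Locally convex spaces and algebras\<close>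

definition locally_convex_space ::
    "('k::real_or_complex \<Rightarrow> 'b \<Rightarrow> 'b::{ab_group_add, t2_space}) \<Rightarrow> bool" where
  "locally_convex_space s \<longleftrightarrow> vector_space s \<and>
     continuous_on UNIV (\<lambda>(x, y). x + y :: 'b) \<and>
     continuous_on UNIV (\<lambda>(c, x). s c x) \<and>
     (\<forall>U. open U \<and> 0 \<in> U \<longrightarrow>
        (\<exists>V. open V \<and> 0 \<in> V \<and> V \<subseteq> U \<and>
             (\<forall>x\<in>V. \<forall>y\<in>V. \<forall>u\<in>{0..1::real}. s (of_real (1 - u)) x + s (of_real u) y \<in> V)))"

text \<open>The sort \<open>{comm_ring, comm_monoid_mult}\<close> rather than \<open>comm_ring_1\<close> admits the zero algebra.\<close>

definition locally_convex_algebra ::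
    "('k::real_or_complex \<Rightarrow> 'b \<Rightarrow> 'b::{comm_ring, comm_monoid_mult, t2_space}) \<Rightarrow> bool" where
  "locally_convex_algebra s \<longleftrightarrow> locally_convex_space s \<and>
     (\<forall>c x y. s c (x * y) = s c x * y) \<and>
     continuous_on UNIV (\<lambda>(x, y). x * y :: 'b)"


section \<open>Calculus\<close>

text \<open>Locally convex spaces in this section are linear subspaces of a type, and they (and their
  translates) carry the subspace topology.  An affine subspace \<open>A\<close> has direction
  space \<open>dir A\<close>; a linear subspace is its own direction space.

  \<open>C_map r s t A B U f\<close> says that \<open>U\<close> is relatively open in the affine subspace \<open>A\<close> and that
  \<open>f : U \<rightarrow> B\<close> is \<open>C\<^sup>r\<close>, where \<open>s\<close> and \<open>t\<close> are the scalar multiplications.  Here \<open>D x [v\<^sub>k, \<dots>, v\<^sub>1]\<close>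
  is the iterated directional derivative of \<open>f\<close> at \<open>x\<close>, first along \<open>v\<^sub>1\<close>, and so on.  Its continuity
  in \<open>(x, v\<^sub>1, \<dots>, v\<^sub>k)\<close> is expressed on sequences \<open>v\<close> of directions with the product topology,
  since only the first \<open>k\<close> entries matter.\<close>

definition dir :: "'e::ab_group_add set \<Rightarrow> 'e set" where
  "dir A = {x - y | x y. x \<in> A \<and> y \<in> A}"

definition C_map :: "enat \<Rightarrow> ('k::real_normed_field \<Rightarrow> 'e \<Rightarrow> 'e) \<Rightarrow> ('k \<Rightarrow> 'f \<Rightarrow> 'f) \<Rightarrow>
    'e::{ab_group_add, topological_space} set \<Rightarrow> 'f::{ab_group_add, topological_space} set \<Rightarrow>
    'e set \<Rightarrow> ('e \<Rightarrow> 'f) \<Rightarrow> bool" where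
  "C_map r s t A B U f \<longleftrightarrow> openin (top_of_set A) U \<and> f ` U \<subseteq> B \<and>
     (\<exists>D. (\<forall>x\<in>U. D x [] = f x) \<and>
          (\<forall>x\<in>U. \<forall>vs. \<forall>w\<in>dir A. set vs \<subseteq> dir A \<and> enat (length vs) < r \<longrightarrow>
             D x (w # vs) \<in> dir B \<and>
             ((\<lambda>h. t (inverse h) (D (x + s h w) vs - D x vs)) \<longlongrightarrow> D x (w # vs)) (at 0)) \<and>
          (\<forall>k. enat k \<le> r \<longrightarrow>
             continuous_on (U \<times> {v. range v \<subseteq> dir A}) (\<lambda>(x, v). D x (map v [0..<k]))))"

text \<open>Scalar multiplication of the complexification \<open>E \<times> E\<close> of a real space \<open>E\<close>, with
  \<open>(x, y)\<close> standing for \<open>x + i y\<close>.\<close>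

definition complexify ::
    "('k::real_normed_field \<Rightarrow> 'e \<Rightarrow> 'e) \<Rightarrow> complex \<Rightarrow> 'e \<times> 'e \<Rightarrow> 'e \<times> 'e::ab_group_add" where
  "complexify s z = (\<lambda>(x, y). (s (of_real (Re z)) x - s (of_real (Im z)) y,
                               s (of_real (Re z)) y + s (of_real (Im z)) x))"

text \<open>The first case is that of the complex field, the second that of the real field.  The
  complexification of an affine subspace \<open>A\<close> is \<open>A + i dir A\<close>.\<close>

definition analytic_map :: "('k::real_or_complex \<Rightarrow> 'e \<Rightarrow> 'e) \<Rightarrow> ('k \<Rightarrow> 'f \<Rightarrow> 'f) \<Rightarrow>
    'e::{ab_group_add, topological_space} set \<Rightarrow> 'f::{ab_group_add, topological_space} set \<Rightarrow>
    'e set \<Rightarrow> ('e \<Rightarrow> 'f) \<Rightarrow> bool" where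
  "analytic_map s t A B U f \<longleftrightarrow>
     (if \<exists>i::'k. i * i = - 1 then C_map \<infinity> s t A B U f
      else openin (top_of_set A) U \<and> f ` U \<subseteq> B \<and>
        (\<exists>U' f'. U \<times> {0} \<subseteq> U' \<and> (\<forall>x\<in>U. f' (x, 0) = (f x, 0)) \<and>
           C_map \<infinity> (complexify s) (complexify t) (A \<times> dir A) (B \<times> dir B) U' f'))"


section \<open>Submanifolds of affine subspaces\<close>

text \<open>An analytic chart \<open>\<Phi> : U \<rightarrow> W\<close> of the affine space \<open>A\<close>, with values in its
  direction space, flattening \<open>S\<close> to the closed vector subspace \<open>F\<close>.\<close>

definition submanifold_chart :: "('k::real_or_complex \<Rightarrow> 'e \<Rightarrow> 'e) \<Rightarrow>
    'e::{ab_group_add, topological_space} set \<Rightarrow> 'e set \<Rightarrow> 'e set \<Rightarrow> 'e set \<Rightarrow> ('e \<Rightarrow> 'e) \<Rightarrow> 'e set \<Rightarrow> bool"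
  where
  "submanifold_chart s A S U W \<Phi> F \<longleftrightarrow>
     bij_betw \<Phi> U W \<and>
     analytic_map s s A (dir A) U \<Phi> \<and> analytic_map s s (dir A) A W (inv_into U \<Phi>) \<and>
     F \<subseteq> dir A \<and> module.subspace s F \<and> closedin (top_of_set (dir A)) F \<and>
     \<Phi> ` (U \<inter> S) = W \<inter> F"

text \<open>Analyticity of a map between submanifolds \<open>S\<^sub>1 \<subseteq> A\<^sub>1\<close> and \<open>S\<^sub>2 \<subseteq> A\<^sub>2\<close>: around each point there
  are submanifold charts in which it is represented by an analytic map.\<close>

definition analytic_map_submanifolds :: "('k::real_or_complex \<Rightarrow> 'e \<Rightarrow> 'e) \<Rightarrow>
    'e::{ab_group_add, topological_space} set \<Rightarrow> 'e set \<Rightarrow>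
    ('k \<Rightarrow> 'f \<Rightarrow> 'f) \<Rightarrow> 'f::{ab_group_add, topological_space} set \<Rightarrow> 'f set \<Rightarrow> ('e \<Rightarrow> 'f) \<Rightarrow> bool" where
  "analytic_map_submanifolds s1 A1 S1 s2 A2 S2 f \<longleftrightarrow> f ` S1 \<subseteq> S2 \<and>
     (\<forall>x\<in>S1. \<exists>U1 W1 \<Phi>1 F1 U2 W2 \<Phi>2 F2.
        x \<in> U1 \<and> submanifold_chart s1 A1 S1 U1 W1 \<Phi>1 F1 \<and>
        f x \<in> U2 \<and> submanifold_chart s2 A2 S2 U2 W2 \<Phi>2 F2 \<and>
        f ` (U1 \<inter> S1) \<subseteq> U2 \<and>
        analytic_map s1 s2 F1 F2 (W1 \<inter> F1) (\<Phi>2 \<circ> f \<circ> inv_into U1 \<Phi>1))"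

text \<open>\<open>C\<^sup>1\<close>-curves in \<open>S\<close> through \<open>x\<close> with velocity \<open>v\<close> at time \<open>0\<close>.\<close>

definition has_velocity ::
    "('k::real_or_complex \<Rightarrow> 'e \<Rightarrow> 'e) \<Rightarrow> (real \<Rightarrow> 'e) \<Rightarrow> 'e::{ab_group_add, topological_space} \<Rightarrow> bool"
  where
  "has_velocity s \<gamma> v \<longleftrightarrow> ((\<lambda>h. s (of_real (inverse h)) (\<gamma> h - \<gamma> 0)) \<longlongrightarrow> v) (at 0)"

definition curve_in :: "('k::real_or_complex \<Rightarrow> 'e \<Rightarrow> 'e) \<Rightarrow>
    'e::{ab_group_add, topological_space} set \<Rightarrow> 'e set \<Rightarrow> 'e \<Rightarrow> 'e \<Rightarrow> (real \<Rightarrow> 'e) \<Rightarrow> bool" where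
  "curve_in s A S x v \<gamma> \<longleftrightarrow>
     (\<exists>\<delta>>0. C_map 1 (*) (\<lambda>r. s (of_real r)) UNIV A {-\<delta><..<\<delta>} \<gamma> \<and> \<gamma> ` {-\<delta><..<\<delta>} \<subseteq> S) \<and>
     \<gamma> 0 = x \<and> has_velocity s \<gamma> v"

definition tangent_space :: "('k::real_or_complex \<Rightarrow> 'e \<Rightarrow> 'e) \<Rightarrow>
    'e::{ab_group_add, topological_space} set \<Rightarrow> 'e set \<Rightarrow> 'e \<Rightarrow> 'e set" where
  "tangent_space s A S x = {v. \<exists>\<gamma>. curve_in s A S x v \<gamma>}"


section \<open>Lie groups that are submanifolds of an affine subspace\<close>

definition topological_group :: "('e::topological_space, 'm) monoid_scheme \<Rightarrow> bool" where
  "topological_group G \<longleftrightarrow> group G \<and>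
     continuous_on (carrier G \<times> carrier G) (\<lambda>(x, y). x \<otimes>\<^bsub>G\<^esub> y) \<and>
     continuous_on (carrier G) (\<lambda>x. inv\<^bsub>G\<^esub> x)"

definition topological_group_iso :: "('e::topological_space, 'm) monoid_scheme \<Rightarrow>
    ('f::topological_space, 'n) monoid_scheme \<Rightarrow> ('e \<Rightarrow> 'f) \<Rightarrow> bool" where
  "topological_group_iso G1 G2 f \<longleftrightarrow> topological_group G1 \<and> topological_group G2 \<and> f \<in> iso G1 G2 \<and>
     homeomorphic_map (top_of_set (carrier G1)) (top_of_set (carrier G2)) f"

definition lie_group_iso :: "('k::real_or_complex \<Rightarrow> 'e \<Rightarrow> 'e) \<Rightarrow>
    'e::{ab_group_add, topological_space} set \<Rightarrow> ('e, 'm) monoid_scheme \<Rightarrow>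
    ('k \<Rightarrow> 'f \<Rightarrow> 'f) \<Rightarrow> 'f::{ab_group_add, topological_space} set \<Rightarrow> ('f, 'n) monoid_scheme \<Rightarrow>
    ('e \<Rightarrow> 'f) \<Rightarrow> bool" where
  "lie_group_iso s1 A1 G1 s2 A2 G2 f \<longleftrightarrow> f \<in> iso G1 G2 \<and>
     analytic_map_submanifolds s1 A1 (carrier G1) s2 A2 (carrier G2) f \<and>
     analytic_map_submanifolds s2 A2 (carrier G2) s1 A1 (carrier G1) (inv_into (carrier G1) f)"

text \<open>Around each point of \<open>S\<close> there is a chart of the ambient space that flattens the Lie group \<open>G\<close>
  to \<open>F\<close> and \<open>S\<close> to \<open>F' \<subseteq> F\<close>, so that \<open>S\<close> is a submanifold of \<open>G\<close> as well as of \<open>A\<close>.\<close>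

definition closed_lie_subgroup :: "('k::real_or_complex \<Rightarrow> 'e \<Rightarrow> 'e) \<Rightarrow>
    'e::{ab_group_add, topological_space} set \<Rightarrow> ('e, 'm) monoid_scheme \<Rightarrow> 'e set \<Rightarrow> bool" where
  "closed_lie_subgroup s A G S \<longleftrightarrow> subgroup S G \<and> closedin (top_of_set (carrier G)) S \<and>
     (\<forall>x\<in>S. \<exists>U W \<Phi> F F'. x \<in> U \<and> submanifold_chart s A (carrier G) U W \<Phi> F \<and>
        F' \<subseteq> F \<and> submanifold_chart s A S U W \<Phi> F')"

text \<open>\<open>u\<close> is the Lie bracket \<open>[v, w] = d/dr Ad(\<gamma> r) w\<close> at \<open>r = 0\<close> of two vectors tangent at the unit,
  where \<open>\<gamma>\<close> is a curve with velocity \<open>v\<close> and \<open>Ad(g) w\<close> is the velocity of \<open>g \<eta> g\<inverse>\<close> for a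
  curve \<open>\<eta>\<close> with velocity \<open>w\<close>.\<close>

definition is_lie_bracket :: "('k::real_or_complex \<Rightarrow> 'e \<Rightarrow> 'e) \<Rightarrow>
    'e::{ab_group_add, topological_space} set \<Rightarrow> ('e, 'm) monoid_scheme \<Rightarrow> 'e \<Rightarrow> 'e \<Rightarrow> 'e \<Rightarrow> bool" where
  "is_lie_bracket s A G v w u \<longleftrightarrow>
     (\<forall>\<gamma> \<eta>. curve_in s A (carrier G) \<one>\<^bsub>G\<^esub> v \<gamma> \<and> curve_in s A (carrier G) \<one>\<^bsub>G\<^esub> w \<eta> \<longrightarrow>
        (\<exists>a. (\<forall>\<^sub>F r in nhds 0.
                has_velocity s (\<lambda>h. \<gamma> r \<otimes>\<^bsub>G\<^esub> \<eta> h \<otimes>\<^bsub>G\<^esub> inv\<^bsub>G\<^esub> (\<gamma> r)) (a r)) \<and>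
             has_velocity s a u))"

definition has_lie_algebra :: "('k::real_or_complex \<Rightarrow> 'e \<Rightarrow> 'e) \<Rightarrow>
    'e::{ab_group_add, topological_space} set \<Rightarrow> ('e, 'm) monoid_scheme \<Rightarrow> 'e set \<Rightarrow> ('e \<Rightarrow> 'e \<Rightarrow> 'e) \<Rightarrow> bool"
  where
  "has_lie_algebra s A G L bracket \<longleftrightarrow> tangent_space s A (carrier G) \<one>\<^bsub>G\<^esub> = L \<and>
     module.subspace s L \<and>
     (\<forall>v\<in>L. \<forall>w\<in>L. bracket v w \<in> L \<and> is_lie_bracket s A G v w (bracket v w))"


section \<open>Character groups\<close>

text \<open>Linear maps on a carrier are extended by \<open>0\<close>, so that each is given by exactly one function.
  The product topology on functions induces the topology of pointwise convergence.\<close>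

definition hom_scale :: "('k \<Rightarrow> 'b \<Rightarrow> 'b) \<Rightarrow> 'k \<Rightarrow> ('a \<Rightarrow> 'b) \<Rightarrow> 'a \<Rightarrow> 'b" where
  "hom_scale s c \<phi> = (\<lambda>x. s c (\<phi> x))"

definition lin_hom :: "('k, 'a, 'm) module_scheme \<Rightarrow> ('k \<Rightarrow> 'b \<Rightarrow> 'b) \<Rightarrow> ('a \<Rightarrow> 'b::ab_group_add) set" where
  "lin_hom H s = {\<phi>. (\<forall>x\<in>carrier H. \<forall>y\<in>carrier H. \<phi> (x \<oplus>\<^bsub>H\<^esub> y) = \<phi> x + \<phi> y) \<and>
     (\<forall>c. \<forall>x\<in>carrier H. \<phi> (c \<odot>\<^bsub>H\<^esub> x) = s c (\<phi> x)) \<and> (\<forall>x. x \<notin> carrier H \<longrightarrow> \<phi> x = 0)}"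

definition convolution :: "('k::field, 'a, 'm) hopf_scheme \<Rightarrow>
    ('a \<Rightarrow> 'b) \<Rightarrow> ('a \<Rightarrow> 'b) \<Rightarrow> 'a \<Rightarrow> 'b::comm_ring" where
  "convolution H \<phi> \<psi> =
     (\<lambda>x. if x \<in> carrier H then tensor_lift H 0 (+) (\<lambda>a b. \<phi> a * \<psi> b) (comult H x) else 0)"

definition conv_bracket :: "('k::field, 'a, 'm) hopf_scheme \<Rightarrow>
    ('a \<Rightarrow> 'b) \<Rightarrow> ('a \<Rightarrow> 'b) \<Rightarrow> 'a \<Rightarrow> 'b::comm_ring" where
  "conv_bracket H \<phi> \<psi> = convolution H \<phi> \<psi> - convolution H \<psi> \<phi>"

definition unit_functionals :: "('k, 'a, 'm) module_scheme \<Rightarrow> ('k \<Rightarrow> 'b \<Rightarrow> 'b) \<Rightarrow>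
    ('a \<Rightarrow> 'b::{comm_ring, comm_monoid_mult}) set" where
  "unit_functionals H s = {\<phi> \<in> lin_hom H s. \<phi> \<one>\<^bsub>H\<^esub> = 1}"

definition characters :: "('k, 'a, 'm) module_scheme \<Rightarrow> ('k \<Rightarrow> 'b \<Rightarrow> 'b) \<Rightarrow>
    ('a \<Rightarrow> 'b::{comm_ring, comm_monoid_mult}) set" where
  "characters H s = {\<phi> \<in> lin_hom H s. \<phi> \<one>\<^bsub>H\<^esub> = 1 \<and>
     (\<forall>x\<in>carrier H. \<forall>y\<in>carrier H. \<phi> (x \<otimes>\<^bsub>H\<^esub> y) = \<phi> x * \<phi> y)}"

definition infinitesimal_characters :: "('k, 'a, 'm) hopf_scheme \<Rightarrow> ('k \<Rightarrow> 'b \<Rightarrow> 'b) \<Rightarrow>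
    ('a \<Rightarrow> 'b::comm_ring) set" where
  "infinitesimal_characters H s = {\<phi> \<in> lin_hom H s. \<forall>x\<in>carrier H. \<forall>y\<in>carrier H.
     \<phi> (x \<otimes>\<^bsub>H\<^esub> y) = s (counit H x) (\<phi> y) + s (counit H y) (\<phi> x)}"

definition annihilator :: "('k, 'a, 'm) module_scheme \<Rightarrow> 'a set \<Rightarrow> ('k \<Rightarrow> 'b \<Rightarrow> 'b) \<Rightarrow>
    ('a \<Rightarrow> 'b::ab_group_add) set" where
  "annihilator H J s = {\<phi> \<in> lin_hom H s. \<forall>x\<in>J. \<phi> x = 0}"

definition char_group :: "('k::field, 'a, 'm) hopf_scheme \<Rightarrow> ('k \<Rightarrow> 'b \<Rightarrow> 'b) \<Rightarrow>
    ('a \<Rightarrow> 'b::{comm_ring, comm_monoid_mult}) monoid" where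
  "char_group H s = \<lparr>carrier = characters H s, mult = convolution H,
     one = (\<lambda>x. if x \<in> carrier H then s (counit H x) 1 else 0)\<rparr>"

text \<open>The map \<open>\<phi> \<mapsto> \<phi> \<circ> q\<close> for the quotient map \<open>q\<close>.\<close>

definition quot_pullback ::
    "('k, 'a, 'm) module_scheme \<Rightarrow> 'a set \<Rightarrow> ('a set \<Rightarrow> 'b) \<Rightarrow> 'a \<Rightarrow> 'b::zero" where
  "quot_pullback H J \<phi> = (\<lambda>x. if x \<in> carrier H then \<phi> (J +>\<^bsub>H\<^esub> x) else 0)"

end

theory Submission
  imports Defs
begin

text \<open>
  Every functional vanishing at the unit is locally nilpotent for convolution, so formal power
  series act on such functionals by finite sums.  Thus \<open>Log\<close> and \<open>Exp\<close> are mutually inverse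
  between \<open>{\<phi>. \<phi> 1 = 1}\<close> and \<open>{\<phi>. \<phi> 1 = 0}\<close>, are given by polynomials in finitely many
  values of \<open>\<phi>\<close>, and are therefore analytic.  The single chart \<open>Log\<close> flattens \<open>G(H, B)\<close> to
  \<open>g(H, B)\<close> and, because \<open>Ann(J, B)\<close> is stable under convolution, its subgroup
  \<open>Ann(J, B) \<inter> G(H, B)\<close> to \<open>Ann(J, B) \<inter> g(H, B)\<close>.  In such charts \<open>\<phi> \<mapsto> \<phi> \<circ> q\<close> is the
  restriction of a continuous linear map.

  The grading of \<open>H / J\<close> is not needed for its character group: inverses of characters of
  \<open>H / J\<close> are characters since this holds after composing with \<open>q\<close>.
\<close>

section \<open>Linear forms on modules with an explicit carrier\<close>

text \<open>Three points shape the proof. A tensor is a functional on bilinear forms, so a map out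
  of a tensor product is well defined only because linear forms separate the points of its target.
  Separation comes from Zorn's lemma and is used again to reduce identities in \<open>B\<close> to
  scalar ones. Secondly, the series of \<open>Log \<phi>\<close> does not show that it is a
  derivation; this is extracted from the convolution powers of \<phi>, on which multiplicativity can
  be compared as a polynomial identity in the exponent. The exponential of
  \<open>- Log \<phi>\<close> is then a character, and uniqueness of inverses identifies it with
  \<phi> composed with the antipode. Thirdly, analyticity over the reals asks for a smooth extension
  to the complexification with values in the complexified affine space. Polynomial maps are
  therefore kept as syntax: one expression is differentiated symbolically and evaluated both in
  \<open>B\<close> and in its complexification, and vanishing by degree shows that the real and
  imaginary parts of the extended series are again linear functionals.\<close>

abbreviation vecsp :: "('k::field, 'a, 'm) module_scheme \<Rightarrow> bool" where
  "vecsp M \<equiv> module (ring_of_type_algebra :: 'k ring) M"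

lemma ring_of_type_algebra_simps [simp]:
  "carrier ring_of_type_algebra = UNIV"
  "mult ring_of_type_algebra = (*)"
  "one ring_of_type_algebra = 1"
  "zero ring_of_type_algebra = 0"
  "add ring_of_type_algebra = (+)"
  by (auto simp: ring_of_type_algebra_def)

lemma a_inv_ring_of_type_algebra [simp]:
  "a_inv (ring_of_type_algebra :: 'k::field ring) c = - c"
proof -
  interpret cring "ring_of_type_algebra :: 'k ring" ..
  show ?thesis
    by (rule minus_equality) auto
qed

lemma vec_smult_assoc: "vecsp M \<Longrightarrow> x \<in> carrier M \<Longrightarrow> c \<odot>\<^bsub>M\<^esub> (d \<odot>\<^bsub>M\<^esub> x) = (c * d) \<odot>\<^bsub>M\<^esub> x"
  using module.smult_assoc1[of ring_of_type_algebra M c d x] by simp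

lemma vec_smult_add_left: "vecsp M \<Longrightarrow> x \<in> carrier M \<Longrightarrow> (c + d) \<odot>\<^bsub>M\<^esub> x = c \<odot>\<^bsub>M\<^esub> x \<oplus>\<^bsub>M\<^esub> d \<odot>\<^bsub>M\<^esub> x"
  using module.smult_l_distr[of ring_of_type_algebra M c d x] by simp

lemma vec_smult_add_right:
  "vecsp M \<Longrightarrow> x \<in> carrier M \<Longrightarrow> y \<in> carrier M \<Longrightarrow> c \<odot>\<^bsub>M\<^esub> (x \<oplus>\<^bsub>M\<^esub> y) = c \<odot>\<^bsub>M\<^esub> x \<oplus>\<^bsub>M\<^esub> c \<odot>\<^bsub>M\<^esub> y"
  using module.smult_r_distr[of ring_of_type_algebra M c x y] by simp

lemma vec_smult_one: "vecsp M \<Longrightarrow> x \<in> carrier M \<Longrightarrow> 1 \<odot>\<^bsub>M\<^esub> x = x"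
  using module.smult_one[of ring_of_type_algebra M x] by simp

lemma vec_smult_zero_left: "vecsp M \<Longrightarrow> x \<in> carrier M \<Longrightarrow> 0 \<odot>\<^bsub>M\<^esub> x = \<zero>\<^bsub>M\<^esub>"
  using module.smult_l_null[of ring_of_type_algebra M x] by simp

lemma vec_smult_zero_right: "vecsp M \<Longrightarrow> c \<odot>\<^bsub>M\<^esub> \<zero>\<^bsub>M\<^esub> = \<zero>\<^bsub>M\<^esub>"
  using module.smult_r_null[of ring_of_type_algebra M c] by simp

lemma vec_smult_closed: "vecsp M \<Longrightarrow> x \<in> carrier M \<Longrightarrow> c \<odot>\<^bsub>M\<^esub> x \<in> carrier M"
  using module.smult_closed[of ring_of_type_algebra M c x] by simp

lemma vec_a_inv: "vecsp M \<Longrightarrow> x \<in> carrier M \<Longrightarrow> \<ominus>\<^bsub>M\<^esub> x = (- 1) \<odot>\<^bsub>M\<^esub> x"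
  using module.smult_l_minus[of ring_of_type_algebra M 1 x] by (simp add: vec_smult_one)

lemmas vec_simps = vec_smult_assoc vec_smult_add_left vec_smult_add_right vec_smult_one
  vec_smult_zero_left vec_smult_zero_right vec_smult_closed

definition lin_subspace :: "('k, 'a, 'm) module_scheme \<Rightarrow> 'a set \<Rightarrow> bool" where
  "lin_subspace M N \<longleftrightarrow> N \<subseteq> carrier M \<and> \<zero>\<^bsub>M\<^esub> \<in> N \<and> (\<forall>x\<in>N. \<forall>y\<in>N. x \<oplus>\<^bsub>M\<^esub> y \<in> N) \<and>
     (\<forall>c. \<forall>x\<in>N. c \<odot>\<^bsub>M\<^esub> x \<in> N)"

text \<open>Adjoins one vector: the enlargement against which maximality is tested in the Zorn
  argument below.\<close>

lemma lin_subspace_extend: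
  fixes M :: "('k::field, 'a, 'm) module_scheme" (structure)
  assumes M: "vecsp M" and N: "lin_subspace M N" and x: "x \<in> carrier M"
  shows "lin_subspace M {n \<oplus> c \<odot> x | n c. n \<in> N}" (is "lin_subspace M ?E")
proof -
  interpret module "ring_of_type_algebra :: 'k ring" M by (rule M)
  have sub: "n \<in> carrier M" if "n \<in> N" for n
    using N that by (auto simp: lin_subspace_def)
  have "\<zero> \<in> ?E"
  proof -
    have "\<zero> = \<zero> \<oplus> 0 \<odot> x"
      using x M by (simp add: vec_simps)
    moreover have "\<zero> \<in> N"
      using N by (simp add: lin_subspace_def)
    ultimately show ?thesis by blast
  qed
  moreover have "y \<oplus> z \<in> ?E" if yz: "y \<in> ?E" "z \<in> ?E" for y z
  proof -
    obtain n c m d where eq: "y = n \<oplus> c \<odot> x" "n \<in> N" "z = m \<oplus> d \<odot> x" "m \<in> N"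
      using yz by blast
    then have "y \<oplus> z = (n \<oplus> m) \<oplus> (c + d) \<odot> x"
      using M x sub by (simp add: vec_simps M.a_ac)
    moreover have "n \<oplus> m \<in> N"
      using N eq by (simp add: lin_subspace_def)
    ultimately show ?thesis by blast
  qed
  moreover have "c \<odot> y \<in> ?E" if y: "y \<in> ?E" for c y
  proof -
    obtain n d where eq: "y = n \<oplus> d \<odot> x" "n \<in> N"
      using y by blast
    then have "c \<odot> y = (c \<odot> n) \<oplus> (c * d) \<odot> x"
      using M x sub by (simp add: vec_simps)
    moreover have "c \<odot> n \<in> N"
      using N eq by (simp add: lin_subspace_def)
    ultimately show ?thesis by blast
  qed
  moreover have "?E \<subseteq> carrier M"
    using sub x by auto
  ultimately show ?thesis
    unfolding lin_subspace_def by blast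
qed

text \<open>A subspace that is maximal among those avoiding \<open>m\<close> has codimension one, and the coefficient
  of \<open>m\<close> modulo it is the required form.\<close>

lemma linear_form_separates:
  fixes M :: "('k::field, 'a, 'm) module_scheme" (structure)
  assumes M: "vecsp M" and m: "m \<in> carrier M" "m \<noteq> \<zero>"
  shows "\<exists>l. linear_form M l \<and> l m \<noteq> 0"
proof -
  interpret module "ring_of_type_algebra :: 'k ring" M by (rule M)
  define A where "A = {N. lin_subspace M N \<and> m \<notin> N}"
  have "{\<zero>} \<in> A"
    using m M by (auto simp: A_def lin_subspace_def vec_simps)
  moreover have "\<Union>C \<in> A" if "C \<noteq> {}" and C: "subset.chain A C" for C
  proof -
    have "C \<subseteq> A" and ch: "N \<subseteq> N' \<or> N' \<subseteq> N" if "N \<in> C" "N' \<in> C" for N N'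
      using C that by (auto simp: subset.chain_def)
    then have *: "lin_subspace M N \<and> m \<notin> N" if "N \<in> C" for N
      using that by (auto simp: A_def)
    have "x \<oplus> y \<in> \<Union>C" if xy: "x \<in> \<Union>C" "y \<in> \<Union>C" for x y
    proof -
      obtain N N' where N: "N \<in> C" "x \<in> N" "N' \<in> C" "y \<in> N'"
        using xy by blast
      then obtain P where "P \<in> C" "x \<in> P" "y \<in> P"
        using ch[of N N'] by blast
      then show ?thesis
        using *[of P] by (auto simp: lin_subspace_def)
    qed
    moreover obtain N where "N \<in> C"
      using \<open>C \<noteq> {}\<close> by blast
    then have "\<zero> \<in> \<Union>C"
      using * by (auto simp: lin_subspace_def)
    moreover have "\<Union>C \<subseteq> carrier M" "m \<notin> \<Union>C"
      using * unfolding lin_subspace_def by blast+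
    moreover have "c \<odot> x \<in> \<Union>C" if "x \<in> \<Union>C" for c x
      using * that by (auto simp: lin_subspace_def)
    ultimately show ?thesis
      unfolding A_def lin_subspace_def by simp
  qed
  ultimately obtain N where N: "N \<in> A" and max: "\<And>P. P \<in> A \<Longrightarrow> N \<subseteq> P \<Longrightarrow> P = N"
    using subset_Zorn_nonempty[of A] by blast
  have NM: "lin_subspace M N" and mN: "m \<notin> N"
    using N by (auto simp: A_def)
  have sub: "n \<in> carrier M" if "n \<in> N" for n
    using NM that by (auto simp: lin_subspace_def)
  have Nadd: "x \<oplus> y \<in> N" if "x \<in> N" "y \<in> N" for x y
    using NM that by (auto simp: lin_subspace_def)
  have Nsm: "c \<odot> x \<in> N" if "x \<in> N" for c x
    using NM that by (auto simp: lin_subspace_def)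
  \<comment> \<open>Modulo \<open>N\<close> every \<open>x\<close> is a multiple of
    \<open>m\<close>: for \<open>x\<close> outside \<open>N\<close>, maximality puts
    \<open>m\<close> into the span of \<open>N\<close> and \<open>x\<close>, and the coefficient
    \<open>c\<close> of \<open>x\<close> is nonzero because \<open>m\<close> is not in
    \<open>N\<close>, so the relation can be solved for \<open>x\<close>.\<close>
  have ex: "\<exists>c. x \<oplus> c \<odot> m \<in> N" if x: "x \<in> carrier M" for x
  proof (cases "x \<in> N")
    case True
    then have "x \<oplus> 0 \<odot> m \<in> N"
      using m x M by (simp add: vec_simps)
    then show ?thesis by blast
  next
    case False
    define E where "E = {n \<oplus> c \<odot> x | n c. n \<in> N}"
    have E: "lin_subspace M E"
      unfolding E_def by (rule lin_subspace_extend[OF M NM x])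
    have z: "\<zero> \<in> N"
      using NM by (simp add: lin_subspace_def)
    have "n \<in> E" if "n \<in> N" for n
    proof -
      have "n = n \<oplus> 0 \<odot> x"
        using that x M sub by (simp add: vec_simps)
      then show ?thesis
        using that unfolding E_def by blast
    qed
    then have "N \<subseteq> E" by blast
    moreover have "x \<in> E"
    proof -
      have "x = \<zero> \<oplus> 1 \<odot> x"
        using x M by (simp add: vec_simps)
      then show ?thesis
        using z unfolding E_def by blast
    qed
    ultimately have "E \<notin> A"
      using max[of E] False by blast
    then have "m \<in> E"
      using E by (simp add: A_def)
    then obtain n c where n: "n \<in> N" and mn: "m = n \<oplus> c \<odot> x"
      by (auto simp: E_def)
    have "c \<noteq> 0"
      using mN mn n sub x M by (auto simp: vec_simps)
    have "x \<oplus> (- inverse c) \<odot> m =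
        (- inverse c) \<odot> n \<oplus> (1 \<odot> x \<oplus> (- inverse c * c) \<odot> x)"
      using n sub x M mn by (simp add: vec_simps M.a_ac del: mult_minus_left)
    also have "\<dots> = (- inverse c) \<odot> n"
      using x M n sub \<open>c \<noteq> 0\<close>
      by (simp add: vec_smult_add_left[symmetric] vec_smult_zero_left vec_smult_closed)
    finally show ?thesis
      using Nsm[OF n] by metis
  qed
  have uniq: "c = d" if c: "x \<oplus> c \<odot> m \<in> N" and d: "x \<oplus> d \<odot> m \<in> N"
    and x: "x \<in> carrier M" for c d x
  proof (rule ccontr)
    assume "c \<noteq> d"
    have "(x \<oplus> c \<odot> m) \<oplus> (- 1) \<odot> (x \<oplus> d \<odot> m)
       = (1 \<odot> x \<oplus> (- 1) \<odot> x) \<oplus> (c \<odot> m \<oplus> (- d) \<odot> m)"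
      using x m M by (simp add: vec_simps M.a_ac)
    also have "\<dots> = (c - d) \<odot> m"
      using x m M
      by (simp add: vec_smult_add_left[symmetric] vec_smult_zero_left vec_smult_closed)
    finally have "(c - d) \<odot> m \<in> N"
      using Nadd[OF c Nsm[OF d, of "- 1"]] by simp
    then have "inverse (c - d) \<odot> ((c - d) \<odot> m) \<in> N"
      by (rule Nsm)
    then show False
      using mN m M \<open>c \<noteq> d\<close> by (simp add: vec_smult_assoc vec_smult_one)
  qed
  \<comment> \<open>The sign is that of a correction, not of a coordinate: \<open>x\<close> is
    congruent to \<open>- k x\<close> times \<open>m\<close>, hence the value \<open>- 1\<close> at
    \<open>m\<close>.\<close>
  define k where "k x = (THE c. x \<oplus> c \<odot> m \<in> N)" for x
  have k: "x \<oplus> k x \<odot> m \<in> N" if "x \<in> carrier M" for x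
    unfolding k_def using ex[OF that] uniq[OF _ _ that] by (metis theI)
  have k_eq: "k x = c" if "x \<oplus> c \<odot> m \<in> N" "x \<in> carrier M" for x c
    using uniq[OF k[OF that(2)] that(1) that(2)] .
  have "k (x \<oplus> y) = k x + k y" if xy: "x \<in> carrier M" "y \<in> carrier M" for x y
  proof (rule k_eq)
    have "(x \<oplus> y) \<oplus> (k x + k y) \<odot> m =
        (x \<oplus> k x \<odot> m) \<oplus> (y \<oplus> k y \<odot> m)"
      using xy m M by (simp add: vec_simps M.a_ac)
    then show "(x \<oplus> y) \<oplus> (k x + k y) \<odot> m \<in> N"
      using Nadd[OF k[OF xy(1)] k[OF xy(2)]] by simp
  qed (use xy in auto)
  moreover have "k (c \<odot> x) = c * k x" if x: "x \<in> carrier M" for c x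
  proof (rule k_eq)
    have "c \<odot> x \<oplus> (c * k x) \<odot> m = c \<odot> (x \<oplus> k x \<odot> m)"
      using x m M by (simp add: vec_simps)
    then show "c \<odot> x \<oplus> (c * k x) \<odot> m \<in> N"
      using Nsm[OF k[OF x]] by simp
  qed (use x M in \<open>simp add: vec_smult_closed\<close>)
  moreover have "k m = - 1"
  proof (rule k_eq)
    have "1 \<odot> m \<oplus> (- 1) \<odot> m = \<zero>"
      using m M by (simp add: vec_smult_add_left[symmetric] vec_smult_zero_left)
    then show "m \<oplus> (- 1) \<odot> m \<in> N"
      using m M NM by (simp add: vec_smult_one lin_subspace_def)
  qed (use m in auto)
  ultimately have "linear_form M k \<and> k m \<noteq> 0"
    by (simp add: linear_form_def)
  then show ?thesis by blast
qed

lemma linear_form_a_inv: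
  assumes "vecsp M" "linear_form M l" "x \<in> carrier M"
  shows "l (\<ominus>\<^bsub>M\<^esub> x) = - l x"
  using assms by (simp add: vec_a_inv linear_form_def)

lemma linear_form_zero:
  assumes "vecsp M" "linear_form M l"
  shows "l \<zero>\<^bsub>M\<^esub> = 0"
proof -
  interpret module "ring_of_type_algebra" M by (rule assms)
  have "l (0 \<odot>\<^bsub>M\<^esub> \<zero>\<^bsub>M\<^esub>) = 0 * l \<zero>\<^bsub>M\<^esub>"
    using assms(2) unfolding linear_form_def by blast
  then show ?thesis
    using assms by (simp add: vec_simps)
qed

text \<open>Separation applied to the difference. It makes lifts from tensor products well defined
  and reduces associativity of convolution and the derivation property of \<open>Log\<close> to
  scalars.\<close>

lemma linear_forms_eqI:
  assumes M: "vecsp M" and xy: "x \<in> carrier M" "y \<in> carrier M"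
    and eq: "\<And>l. linear_form M l \<Longrightarrow> l x = l y"
  shows "x = y"
proof (rule ccontr)
  interpret module "ring_of_type_algebra" M by (rule M)
  assume "x \<noteq> y"
  moreover have "(x \<oplus>\<^bsub>M\<^esub> \<ominus>\<^bsub>M\<^esub> y) \<oplus>\<^bsub>M\<^esub> y = x"
    using xy by (simp add: M.a_assoc M.l_neg)
  ultimately have "x \<oplus>\<^bsub>M\<^esub> \<ominus>\<^bsub>M\<^esub> y \<noteq> \<zero>\<^bsub>M\<^esub>"
    using xy by (metis M.l_zero)
  then obtain l where l: "linear_form M l" "l (x \<oplus>\<^bsub>M\<^esub> \<ominus>\<^bsub>M\<^esub> y) \<noteq> 0"
    using linear_form_separates[OF M] xy by (metis M.a_inv_closed M.add.m_closed)
  then have "l x - l y \<noteq> 0"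
    using xy linear_form_a_inv[OF M l(1)] by (simp add: linear_form_def)
  then show False
    using eq[OF l(1)] by simp
qed

text \<open>A vector space on a type, as a module with an explicit carrier; its \<open>mult\<close> and \<open>one\<close> are junk.\<close>

definition typ_module :: "('k \<Rightarrow> 'b \<Rightarrow> 'b::ab_group_add) \<Rightarrow> ('k, 'b) module" where
  "typ_module t = \<lparr>carrier = UNIV, mult = (\<lambda>x y. x), one = 0, zero = 0, add = (+), smult = t\<rparr>"

lemma typ_module_simps [simp]:
  "carrier (typ_module t) = UNIV" "zero (typ_module t) = 0" "add (typ_module t) = (+)"
  "smult (typ_module t) = t"
  by (simp_all add: typ_module_def)

lemma vec_typ_module:
  assumes "vector_space t"
  shows "vecsp (typ_module t)"
proof -
  interpret vector_space t by (rule assms)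
  show ?thesis
    by unfold_locales
      (auto simp: algebra_simps scale_left_distrib scale_right_distrib Units_def
        intro: exI[of "\<lambda>y. x + y = 0" "- x" for x])
qed

lemma linear_form_typ_module:
  "linear_form (typ_module t) l \<longleftrightarrow> (\<forall>x y. l (x + y) = l x + l y) \<and> (\<forall>c x. l (t c x) = c * l x)"
  by (simp add: linear_form_def)

section \<open>Tensor products\<close>

text \<open>Bilinearity is tested through linear forms on the target, because the scalar forms
  \<open>l (f x y)\<close> are exactly what a tensor can be evaluated at. As linear forms separate
  points, this is ordinary bilinearity when \<open>N\<close> is a vector space.\<close>

definition bilin ::
    "('k::field, 'a, 'm) module_scheme \<Rightarrow> ('k, 'c, 'n) module_scheme \<Rightarrow> ('a \<Rightarrow> 'a \<Rightarrow> 'c) \<Rightarrow> bool" where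
  "bilin M N f \<longleftrightarrow> (\<forall>x\<in>carrier M. \<forall>y\<in>carrier M. f x y \<in> carrier N) \<and>
     (\<forall>l. linear_form N l \<longrightarrow> bilinear_form M (\<lambda>x y. l (f x y)))"

lemma foldr_closed:
  assumes "vecsp N" "set xs \<subseteq> carrier M \<times> carrier M"
    "\<And>x y. x \<in> carrier M \<Longrightarrow> y \<in> carrier M \<Longrightarrow> f x y \<in> carrier N"
  shows "foldr (\<lambda>(x, y). add N (f x y)) xs \<zero>\<^bsub>N\<^esub> \<in> carrier N"
proof -
  interpret module "ring_of_type_algebra" N by (rule assms)
  show ?thesis
    using assms(2,3) by (induction xs) auto
qed

lemma linear_form_foldr:
  assumes "vecsp N" "linear_form N l" "set xs \<subseteq> carrier M \<times> carrier M"
    "\<And>x y. x \<in> carrier M \<Longrightarrow> y \<in> carrier M \<Longrightarrow> f x y \<in> carrier N"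
  shows "l (foldr (\<lambda>(x, y). add N (f x y)) xs \<zero>\<^bsub>N\<^esub>) = (\<Sum>(x, y)\<leftarrow>xs. l (f x y))"
  using assms(3)
proof (induction xs)
  case Nil
  then show ?case
    using assms by (simp add: linear_form_zero)
next
  case (Cons p xs)
  have "foldr (\<lambda>(x, y). add N (f x y)) xs \<zero>\<^bsub>N\<^esub> \<in> carrier N"
    using Cons.prems by (intro foldr_closed[OF assms(1) _ assms(4)]) auto
  then show ?case
    using Cons assms by (auto simp: linear_form_def)
qed

lemma foldr_sum_list:
  "foldr (\<lambda>(x, y). (+) (f x y)) xs 0 = (\<Sum>(x, y)\<leftarrow>xs. f x y :: 'b::comm_monoid_add)"
  by (induction xs) auto

text \<open>Equal tensors agree on the bilinear form \<open>l (f x y)\<close> for every linear form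
  \<open>l\<close>; so no \<open>l\<close> distinguishes the two folds.\<close>

lemma tensor_of_foldr_eq:
  assumes N: "vecsp N" and f: "bilin M N f"
    and xs: "set xs \<subseteq> carrier M \<times> carrier M" and ys: "set ys \<subseteq> carrier M \<times> carrier M"
    and eq: "tensor_of M xs = tensor_of M ys"
  shows "foldr (\<lambda>(x, y). add N (f x y)) xs \<zero>\<^bsub>N\<^esub> = foldr (\<lambda>(x, y). add N (f x y)) ys \<zero>\<^bsub>N\<^esub>"
proof (rule linear_forms_eqI[OF N])
  show "foldr (\<lambda>(x, y). add N (f x y)) xs \<zero>\<^bsub>N\<^esub> \<in> carrier N"
    "foldr (\<lambda>(x, y). add N (f x y)) ys \<zero>\<^bsub>N\<^esub> \<in> carrier N"
    using f N xs ys by (auto intro!: foldr_closed simp: bilin_def)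
  fix l assume l: "linear_form N l"
  then have "bilinear_form M (\<lambda>x y. l (f x y))"
    using f by (simp add: bilin_def)
  then have "(\<Sum>(x, y)\<leftarrow>xs. l (f x y)) = (\<Sum>(x, y)\<leftarrow>ys. l (f x y))"
    using fun_cong[OF eq, of "\<lambda>x y. l (f x y)"] by (simp add: tensor_of_def)
  then show "l (foldr (\<lambda>(x, y). add N (f x y)) xs \<zero>\<^bsub>N\<^esub>) =
      l (foldr (\<lambda>(x, y). add N (f x y)) ys \<zero>\<^bsub>N\<^esub>)"
    using f N l xs ys by (simp add: linear_form_foldr bilin_def)
qed

text \<open>The description operator in \<open>tensor_lift\<close> thus has a unique solution, and
  any representing list computes it.\<close>

lemma tensor_lift_tensor_of:
  assumes N: "vecsp N" and f: "bilin M N f" and xs: "set xs \<subseteq> carrier M \<times> carrier M"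
  shows "tensor_lift M \<zero>\<^bsub>N\<^esub> (add N) f (tensor_of M xs) = foldr (\<lambda>(x, y). add N (f x y)) xs \<zero>\<^bsub>N\<^esub>"
  unfolding tensor_lift_def
  using tensor_of_foldr_eq[OF N f] xs by (intro the_equality) metis+

definition bilin_typ ::
    "('k::field, 'a, 'm) module_scheme \<Rightarrow> ('k \<Rightarrow> 'b \<Rightarrow> 'b::ab_group_add) \<Rightarrow> ('a \<Rightarrow> 'a \<Rightarrow> 'b) \<Rightarrow> bool" where
  "bilin_typ M t f \<longleftrightarrow>
     (\<forall>x\<in>carrier M. \<forall>y\<in>carrier M. \<forall>z\<in>carrier M.
        f (x \<oplus>\<^bsub>M\<^esub> y) z = f x z + f y z \<and> f z (x \<oplus>\<^bsub>M\<^esub> y) = f z x + f z y) \<and>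
     (\<forall>c. \<forall>x\<in>carrier M. \<forall>y\<in>carrier M.
        f (c \<odot>\<^bsub>M\<^esub> x) y = t c (f x y) \<and> f x (c \<odot>\<^bsub>M\<^esub> y) = t c (f x y))"

lemma bilin_typ_bilin: "bilin_typ M t f \<Longrightarrow> bilin M (typ_module t) f"
  by (simp add: bilin_def bilin_typ_def linear_form_typ_module bilinear_form_def linear_form_def)

lemma tensor_lift_typ:
  assumes "vector_space t" "bilin_typ M t f" "set xs \<subseteq> carrier M \<times> carrier M"
  shows "tensor_lift M 0 (+) f (tensor_of M xs) = (\<Sum>(x, y)\<leftarrow>xs. f x y)"
  using tensor_lift_tensor_of[OF vec_typ_module[OF assms(1)] bilin_typ_bilin[OF assms(2)] assms(3)]
  by (simp add: foldr_sum_list)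

lemma tensor_of_Nil: "tensor_of M [] = 0"
  by (auto simp: tensor_of_def zero_fun_def)

lemma tensor_of_append: "tensor_of M (xs @ ys) = tensor_of M xs + tensor_of M ys"
  by (auto simp: tensor_of_def)

lemma tensor_of_sum_list: "tensor_of M xs = (\<Sum>(x, y)\<leftarrow>xs. tensor_of M [(x, y)])"
proof (induction xs)
  case Nil
  then show ?case by (simp add: tensor_of_Nil)
next
  case (Cons p xs)
  then show ?case
    using tensor_of_append[of M "[p]" xs] by (cases p) simp
qed

lemma tensor_of_smult:
  assumes "set xs \<subseteq> carrier M \<times> carrier M"
  shows "tensor_of M (map (\<lambda>(x, y). (c \<odot>\<^bsub>M\<^esub> x, y)) xs) = (\<lambda>\<beta>. c * tensor_of M xs \<beta>)"
proof
  fix \<beta>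
  show "tensor_of M (map (\<lambda>(x, y). (c \<odot>\<^bsub>M\<^esub> x, y)) xs) \<beta> = c * tensor_of M xs \<beta>"
    using assms
    by (induction xs) (auto simp: tensor_of_def bilinear_form_def linear_form_def algebra_simps)
qed

text \<open>Tensors are themselves functions into the field; with this scaling they can be targets
  of lifts, as nested lifts require.\<close>

lemma vector_space_pointwise_smult: "vector_space (\<lambda>c (g :: 'x \<Rightarrow> 'k::field) \<beta>. c * g \<beta>)"
  by unfold_locales (auto simp: algebra_simps)

lemma sum_list_fun_apply: "(\<Sum>p\<leftarrow>xs. f p) \<beta> = (\<Sum>p\<leftarrow>xs. f p \<beta> :: 'b::comm_monoid_add)"
  by (induction xs) auto

lemma bilin_typ_pointwise:
  "bilin_typ M (\<lambda>c g \<beta>. c * g \<beta>) f \<longleftrightarrow> (\<forall>\<beta>. bilin_typ M (*) (\<lambda>x y. f x y \<beta>))"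
  unfolding bilin_typ_def by (auto simp: fun_eq_iff)

lemma bilin_typ_bilinear_form: "bilin_typ M (*) f \<longleftrightarrow> bilinear_form M f"
  unfolding bilin_typ_def bilinear_form_def linear_form_def by blast

lemma bilin_typ_sum_list:
  assumes "vector_space t" "\<And>p. p \<in> set xs \<Longrightarrow> bilin_typ M t (\<lambda>x y. f x y p)"
  shows "bilin_typ M t (\<lambda>x y. \<Sum>p\<leftarrow>xs. f x y p)"
proof -
  interpret vector_space t by (rule assms)
  show ?thesis
    using assms(2)
  proof (induction xs)
    case Nil
    then show ?case by (simp add: bilin_typ_def)
  next
    case (Cons p xs)
    then have "bilin_typ M t (\<lambda>x y. f x y p)" "bilin_typ M t (\<lambda>x y. \<Sum>p\<leftarrow>xs. f x y p)"
      by auto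
    then show ?case
      by (simp add: bilin_typ_def scale_right_distrib algebra_simps)
  qed
qed

section \<open>Hopf algebras\<close>

lemma sum_list_cong_set: "(\<And>p. p \<in> set xs \<Longrightarrow> f p = g p) \<Longrightarrow> (\<Sum>p\<leftarrow>xs. f p) = (\<Sum>p\<leftarrow>xs. g p)"
  by (metis map_cong)

lemma sum_sum_list_swap:
  "(\<Sum>i\<in>I. \<Sum>p\<leftarrow>xs. f i p) = (\<Sum>p\<leftarrow>xs. \<Sum>i\<in>I. f i p :: 'b::comm_monoid_add)"
  by (induction xs) (simp_all add: sum.distrib)

lemma sum_list_concat: "sum_list (concat xss) = (\<Sum>xs\<leftarrow>xss. sum_list xs :: 'b::comm_monoid_add)"
  by (induction xss) auto

lemma tensor_mult_tensor_of:
  fixes A :: "('k::field, 'a, 'm) module_scheme"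
  assumes A: "unital_algebra A"
    and xs: "set xs \<subseteq> carrier A \<times> carrier A" and ys: "set ys \<subseteq> carrier A \<times> carrier A"
  shows "tensor_mult A (tensor_of A xs) (tensor_of A ys) =
    (\<Sum>p\<leftarrow>xs. \<Sum>r\<leftarrow>ys. tensor_of A [(fst p \<otimes>\<^bsub>A\<^esub> fst r, snd p \<otimes>\<^bsub>A\<^esub> snd r)])"
proof -
  interpret ring A using A by (simp add: unital_algebra_def)
  have sm: "(c \<odot>\<^bsub>A\<^esub> x) \<otimes>\<^bsub>A\<^esub> y = c \<odot>\<^bsub>A\<^esub> (x \<otimes>\<^bsub>A\<^esub> y)" "x \<otimes>\<^bsub>A\<^esub> (c \<odot>\<^bsub>A\<^esub> y) = c \<odot>\<^bsub>A\<^esub> (x \<otimes>\<^bsub>A\<^esub> y)"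
    and M: "vecsp A" if "x \<in> carrier A" "y \<in> carrier A" for c x y
    using A that by (auto simp: unital_algebra_def)
  have V: "vecsp A" using A by (simp add: unital_algebra_def)
  have inner: "bilin_typ A (\<lambda>c g \<beta>. c * g \<beta>) (\<lambda>x' y'. tensor_of A [(x \<otimes>\<^bsub>A\<^esub> x', y \<otimes>\<^bsub>A\<^esub> y')])"
    if "x \<in> carrier A" "y \<in> carrier A" for x y
    unfolding bilin_typ_pointwise
  proof
    fix \<beta> :: "'a \<Rightarrow> 'a \<Rightarrow> 'k"
    show "bilin_typ A (*) (\<lambda>x' y'. tensor_of A [(x \<otimes>\<^bsub>A\<^esub> x', y \<otimes>\<^bsub>A\<^esub> y')] \<beta>)"
      using that V
      by (auto simp: bilin_typ_def tensor_of_def bilinear_form_def linear_form_def sm r_distr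
          vec_smult_closed)
  qed
  have outer: "bilin_typ A (\<lambda>c g \<beta>. c * g \<beta>) (\<lambda>x y. tensor_of A [(x \<otimes>\<^bsub>A\<^esub> x', y \<otimes>\<^bsub>A\<^esub> y')])"
    if "x' \<in> carrier A" "y' \<in> carrier A" for x' y'
    unfolding bilin_typ_pointwise
  proof
    fix \<beta> :: "'a \<Rightarrow> 'a \<Rightarrow> 'k"
    show "bilin_typ A (*) (\<lambda>x y. tensor_of A [(x \<otimes>\<^bsub>A\<^esub> x', y \<otimes>\<^bsub>A\<^esub> y')] \<beta>)"
      using that V
      by (auto simp: bilin_typ_def tensor_of_def bilinear_form_def linear_form_def sm l_distr
          vec_smult_closed)
  qed
  define g where "g x y = tensor_lift A 0 (+)
      (\<lambda>x' y'. tensor_of A [(x \<otimes>\<^bsub>A\<^esub> x', y \<otimes>\<^bsub>A\<^esub> y')]) (tensor_of A ys)" for x y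
  have g: "g x y = (\<Sum>r\<leftarrow>ys. tensor_of A [(x \<otimes>\<^bsub>A\<^esub> fst r, y \<otimes>\<^bsub>A\<^esub> snd r)])"
    if "x \<in> carrier A" "y \<in> carrier A" for x y
    unfolding g_def using tensor_lift_typ[OF vector_space_pointwise_smult inner[OF that] ys]
    by (simp add: split_def)
  \<comment> \<open>The outer map can be recognised as bilinear once the inner lift has been
    replaced by a sum over \<open>ys\<close>.\<close>
  have "bilin_typ A (\<lambda>c g \<beta>. c * g \<beta>)
      (\<lambda>x y. \<Sum>r\<leftarrow>ys. tensor_of A [(x \<otimes>\<^bsub>A\<^esub> fst r, y \<otimes>\<^bsub>A\<^esub> snd r)])"
    using ys by (intro bilin_typ_sum_list vector_space_pointwise_smult outer) auto
  then have "bilin_typ A (\<lambda>c g \<beta>. c * g \<beta>) g"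
    using V unfolding bilin_typ_def by (simp add: g vec_smult_closed)
  from tensor_lift_typ[OF vector_space_pointwise_smult this xs]
  have "tensor_lift A 0 (+) g (tensor_of A xs) = (\<Sum>p\<leftarrow>xs. g (fst p) (snd p))"
    by (simp add: split_def)
  also have "\<dots> = (\<Sum>p\<leftarrow>xs. \<Sum>r\<leftarrow>ys. tensor_of A [(fst p \<otimes>\<^bsub>A\<^esub> fst r, snd p \<otimes>\<^bsub>A\<^esub> snd r)])"
    using xs by (intro sum_list_cong_set g) auto
  finally show ?thesis
    by (simp add: tensor_mult_def g_def[abs_def])
qed

lemma lin_hom_zero:
  assumes "vecsp M" "vector_space t" "\<phi> \<in> lin_hom M t"
  shows "\<phi> \<zero>\<^bsub>M\<^esub> = 0"
proof -
  interpret vector_space t by (rule assms)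
  interpret M: module "ring_of_type_algebra" M by (rule assms)
  have "\<phi> (0 \<odot>\<^bsub>M\<^esub> \<zero>\<^bsub>M\<^esub>) = t 0 (\<phi> \<zero>\<^bsub>M\<^esub>)"
    using assms(3) unfolding lin_hom_def by blast
  then show ?thesis
    using assms(1) by (simp add: vec_simps)
qed

lemma lin_hom_foldr:
  assumes M: "vecsp M" "vector_space t" "\<phi> \<in> lin_hom M t" and xs: "set xs \<subseteq> carrier M \<times> carrier M"
    and f: "\<And>x y. x \<in> carrier M \<Longrightarrow> y \<in> carrier M \<Longrightarrow> f x y \<in> carrier M"
  shows "\<phi> (foldr (\<lambda>(x, y). add M (f x y)) xs \<zero>\<^bsub>M\<^esub>) = (\<Sum>p\<leftarrow>xs. \<phi> (f (fst p) (snd p)))"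
  using xs
proof (induction xs)
  case Nil
  then show ?case
    using lin_hom_zero[OF M] by simp
next
  case (Cons p xs)
  have "foldr (\<lambda>(x, y). add M (f x y)) xs \<zero>\<^bsub>M\<^esub> \<in> carrier M"
    using Cons.prems by (intro foldr_closed[OF M(1) _ f]) auto
  then show ?case
    using Cons M f by (auto simp: lin_hom_def split_def)
qed

text \<open>The part of a coalgebra that permits choosing lists for coproducts and evaluating
  iterated coproducts. It is isolated because the quotient must be an instance before its
  coassociativity is proved.\<close>

locale precoalg =
  fixes H :: "('k::field, 'a) hopf" (structure)
  assumes vecH: "vecsp H"
    and comult_tensors: "x \<in> carrier H \<Longrightarrow> comult H x \<in> tensors H (carrier H \<times> carrier H)"
    and comult_add: "x \<in> carrier H \<Longrightarrow> y \<in> carrier H \<Longrightarrow> comult H (x \<oplus> y) = comult H x + comult H y"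
    and comult_smult: "x \<in> carrier H \<Longrightarrow> comult H (c \<odot> x) = (\<lambda>\<beta>. c * comult H x \<beta>)"
begin

text \<open>A Sweedler representation fixed by choice; as a list, \<open>cop (x \<oplus> y)\<close>
  bears no relation to \<open>cop x\<close> and \<open>cop y\<close>.\<close>

definition cop :: "'a \<Rightarrow> ('a \<times> 'a) list" where
  "cop x = (SOME xs. set xs \<subseteq> carrier H \<times> carrier H \<and> comult H x = tensor_of H xs)"

lemma cop:
  assumes "x \<in> carrier H"
  shows "set (cop x) \<subseteq> carrier H \<times> carrier H" "comult H x = tensor_of H (cop x)"
proof -
  have "\<exists>xs. set xs \<subseteq> carrier H \<times> carrier H \<and> comult H x = tensor_of H xs"
    using comult_tensors[OF assms] by (auto simp: tensors_def)
  from someI_ex[OF this] show "set (cop x) \<subseteq> carrier H \<times> carrier H" "comult H x = tensor_of H (cop x)"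
    by (auto simp: cop_def)
qed

lemma cop_carrier:
  assumes "x \<in> carrier H" "p \<in> set (cop x)"
  shows "fst p \<in> carrier H" "snd p \<in> carrier H"
  using cop(1)[OF assms(1)] assms(2) by auto

lemma comult_eval:
  "x \<in> carrier H \<Longrightarrow> bilinear_form H \<beta> \<Longrightarrow> comult H x \<beta> = (\<Sum>p\<leftarrow>cop x. \<beta> (fst p) (snd p))"
  using cop(2)[of x] by (simp add: tensor_of_def split_def)

text \<open>Evaluates the two iterated coproducts at a trilinear form, so that coassociativity
  becomes an equation between scalars. The last two claims say that the inner coproduct leaves a
  bilinear form, to which the outer one can be applied.\<close>

lemma nested_lift:
  assumes x: "x \<in> carrier H"
  shows "tensor_lift H 0 (+)
      (\<lambda>a b. tensor_lift H 0 (+) (\<lambda>a' a''. pure_tensor3 H a' a'' b) (comult H a)) (comult H x) =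
      (\<lambda>\<tau>. if trilinear_form H \<tau> then \<Sum>p\<leftarrow>cop x. comult H (fst p) (\<lambda>a b. \<tau> a b (snd p)) else 0)" (is ?left)
    and "tensor_lift H 0 (+)
      (\<lambda>a b. tensor_lift H 0 (+) (\<lambda>b' b''. pure_tensor3 H a b' b'') (comult H b)) (comult H x) =
      (\<lambda>\<tau>. if trilinear_form H \<tau> then \<Sum>p\<leftarrow>cop x. comult H (snd p) (\<lambda>a b. \<tau> (fst p) a b) else 0)" (is ?right)
    and "\<And>\<tau>. trilinear_form H \<tau> \<Longrightarrow> bilinear_form H (\<lambda>a b. comult H a (\<lambda>a' a''. \<tau> a' a'' b))"
    and "\<And>\<tau>. trilinear_form H \<tau> \<Longrightarrow> bilinear_form H (\<lambda>a b. comult H b (\<lambda>b' b''. \<tau> a b' b''))"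
proof -
  interpret M: module "ring_of_type_algebra :: 'k ring" H by (rule vecH)
  let ?t = "\<lambda>c (g :: ('k, 'a) tensor3) \<tau>. c * g \<tau>"
  have tri: "bilinear_form H (\<lambda>a b. \<tau> a b z)" "bilinear_form H (\<lambda>a b. \<tau> z a b)"
    if "trilinear_form H \<tau>" "z \<in> carrier H" for z and \<tau> :: "'a \<Rightarrow> 'a \<Rightarrow> 'a \<Rightarrow> 'k"
    using that by (auto simp: trilinear_form_def)
  define g1 where "g1 a b = tensor_lift H 0 (+) (\<lambda>a' a''. pure_tensor3 H a' a'' b) (comult H a)" for a b
  define g2 where "g2 a b = tensor_lift H 0 (+) (\<lambda>b' b''. pure_tensor3 H a b' b'') (comult H b)" for a b
  have p1: "bilin_typ H ?t (\<lambda>a' a''. pure_tensor3 H a' a'' b)" if "b \<in> carrier H" for b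
    using that unfolding bilin_typ_pointwise
    by (auto simp: bilin_typ_bilinear_form pure_tensor3_def tri)
      (auto simp: trilinear_form_def bilinear_form_def linear_form_def)
  have p2: "bilin_typ H ?t (\<lambda>b' b''. pure_tensor3 H a b' b'')" if "a \<in> carrier H" for a
    using that unfolding bilin_typ_pointwise
    by (auto simp: bilin_typ_bilinear_form pure_tensor3_def tri)
      (auto simp: trilinear_form_def bilinear_form_def linear_form_def)
  have g1: "g1 a b = (\<lambda>\<tau>. if trilinear_form H \<tau> then comult H a (\<lambda>a' a''. \<tau> a' a'' b) else 0)"
    if "a \<in> carrier H" "b \<in> carrier H" for a b
    using tensor_lift_typ[OF vector_space_pointwise_smult p1[OF that(2)] cop(1)[OF that(1)]] that
    by (auto simp: g1_def cop(2)[symmetric] split_def sum_list_fun_apply pure_tensor3_def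
        comult_eval tri)
  have g2: "g2 a b = (\<lambda>\<tau>. if trilinear_form H \<tau> then comult H b (\<lambda>b' b''. \<tau> a b' b'') else 0)"
    if "a \<in> carrier H" "b \<in> carrier H" for a b
    using tensor_lift_typ[OF vector_space_pointwise_smult p2[OF that(1)] cop(1)[OF that(2)]] that
    by (auto simp: g2_def cop(2)[symmetric] split_def sum_list_fun_apply pure_tensor3_def
        comult_eval tri)
  have tri_lin: "\<tau> (x \<oplus> y) a b = \<tau> x a b + \<tau> y a b" "\<tau> a b (x \<oplus> y) = \<tau> a b x + \<tau> a b y"
    "\<tau> (c \<odot> x) a b = c * \<tau> x a b" "\<tau> a b (c \<odot> x) = c * \<tau> a b x"
    if "trilinear_form H \<tau>" "x \<in> carrier H" "y \<in> carrier H" "a \<in> carrier H" "b \<in> carrier H"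
    for x y a b c and \<tau> :: "'a \<Rightarrow> 'a \<Rightarrow> 'a \<Rightarrow> 'k"
    using that by (auto simp: trilinear_form_def bilinear_form_def linear_form_def)
  have c1: "comult H a (\<lambda>a' a''. \<tau> a' a'' (x \<oplus> y)) =
      comult H a (\<lambda>a' a''. \<tau> a' a'' x) + comult H a (\<lambda>a' a''. \<tau> a' a'' y)"
    "comult H a (\<lambda>a' a''. \<tau> (x \<oplus> y) a' a'') =
      comult H a (\<lambda>a' a''. \<tau> x a' a'') + comult H a (\<lambda>a' a''. \<tau> y a' a'')"
    "comult H a (\<lambda>a' a''. \<tau> (c \<odot> x) a' a'') = c * comult H a (\<lambda>a' a''. \<tau> x a' a'')"
    "comult H a (\<lambda>a' a''. \<tau> a' a'' (c \<odot> x)) = c * comult H a (\<lambda>a' a''. \<tau> a' a'' x)"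
    if "trilinear_form H \<tau>" "x \<in> carrier H" "y \<in> carrier H" "a \<in> carrier H"
    for x y a c and \<tau> :: "'a \<Rightarrow> 'a \<Rightarrow> 'a \<Rightarrow> 'k"
    using that
    by (simp_all add: comult_eval tri tri_lin vec_smult_closed[OF vecH] cop_carrier[OF that(4)] sum_list_addf
        sum_list_const_mult cong: map_cong)
  show "bilinear_form H (\<lambda>a b. comult H a (\<lambda>a' a''. \<tau> a' a'' b))"
    "bilinear_form H (\<lambda>a b. comult H b (\<lambda>b' b''. \<tau> a b' b''))" if "trilinear_form H \<tau>" for \<tau>
    by (use that in \<open>simp_all add: bilinear_form_def linear_form_def comult_add comult_smult c1\<close>)
  \<comment> \<open>With the inner lifts evaluated, bilinearity is visible: linearity in one
    argument comes from the coproduct, in the other from the trilinear form.\<close>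
  have "bilin_typ H ?t g1" "bilin_typ H ?t g2"
    unfolding bilin_typ_def
    by (auto simp: g1 g2 comult_add comult_smult fun_eq_iff c1)
  from tensor_lift_typ[OF vector_space_pointwise_smult this(1) cop(1)[OF x]]
    tensor_lift_typ[OF vector_space_pointwise_smult this(2) cop(1)[OF x]]
  have "tensor_lift H 0 (+) g1 (comult H x) = (\<Sum>p\<leftarrow>cop x. g1 (fst p) (snd p))"
    "tensor_lift H 0 (+) g2 (comult H x) = (\<Sum>p\<leftarrow>cop x. g2 (fst p) (snd p))"
    by (simp_all add: cop(2)[OF x, symmetric] split_def)
  moreover have "(\<Sum>p\<leftarrow>cop x. g1 (fst p) (snd p)) =
      (\<lambda>\<tau>. if trilinear_form H \<tau> then \<Sum>p\<leftarrow>cop x. comult H (fst p) (\<lambda>a b. \<tau> a b (snd p)) else 0)"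
    "(\<Sum>p\<leftarrow>cop x. g2 (fst p) (snd p)) =
      (\<lambda>\<tau>. if trilinear_form H \<tau> then \<Sum>p\<leftarrow>cop x. comult H (snd p) (\<lambda>a b. \<tau> (fst p) a b) else 0)"
    using cop_carrier[OF x] by (auto simp: fun_eq_iff sum_list_fun_apply g1 g2 cong: map_cong)
  ultimately show ?left ?right
    by (simp_all add: g1_def[abs_def] g2_def[abs_def])
qed

end

locale hopf_alg =
  fixes H :: "('k::field, 'a) hopf" (structure)
  assumes hopf: "hopf_algebra H"
begin

lemma alg: "unital_algebra H" and coalg: "coalgebra H"
  using hopf by (auto simp: hopf_algebra_def)

sublocale precoalg H
  using alg coalg by (intro precoalg.intro) (auto simp: unital_algebra_def coalgebra_def)

sublocale ring H
  using alg by (simp add: unital_algebra_def)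

lemma smult_closed [simp]: "x \<in> carrier H \<Longrightarrow> c \<odot> x \<in> carrier H"
  by (rule vec_smult_closed[OF vecH])

lemma smult_mult:
  "x \<in> carrier H \<Longrightarrow> y \<in> carrier H \<Longrightarrow> (c \<odot> x) \<otimes> y = c \<odot> (x \<otimes> y)"
  "x \<in> carrier H \<Longrightarrow> y \<in> carrier H \<Longrightarrow> x \<otimes> (c \<odot> y) = c \<odot> (x \<otimes> y)"
  using alg by (auto simp: unital_algebra_def)

lemma antipode_closed [simp]: "x \<in> carrier H \<Longrightarrow> antipode H x \<in> carrier H"
  using hopf by (auto simp: hopf_algebra_def)

lemma antipode_linear:
  "x \<in> carrier H \<Longrightarrow> y \<in> carrier H \<Longrightarrow> antipode H (x \<oplus> y) = antipode H x \<oplus> antipode H y"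
  "x \<in> carrier H \<Longrightarrow> antipode H (c \<odot> x) = c \<odot> antipode H x"
  using hopf by (auto simp: hopf_algebra_def)

lemma counit_one [simp]: "counit H \<one> = 1"
  using hopf by (simp add: hopf_algebra_def)

lemma counit_linear: "linear_form H (counit H)"
  using coalg by (simp add: coalgebra_def)

lemma counit_mult: "x \<in> carrier H \<Longrightarrow> y \<in> carrier H \<Longrightarrow> counit H (x \<otimes> y) = counit H x * counit H y"
  using hopf by (simp add: hopf_algebra_def)

lemma comult_mult:
  assumes "x \<in> carrier H" "y \<in> carrier H"
  shows "comult H (x \<otimes> y) =
    tensor_of H (concat (map (\<lambda>p. map (\<lambda>r. (fst p \<otimes> fst r, snd p \<otimes> snd r)) (cop y)) (cop x)))"
proof -
  have "comult H (x \<otimes> y) = tensor_mult H (tensor_of H (cop x)) (tensor_of H (cop y))"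
    using hopf assms by (simp add: hopf_algebra_def cop(2)[symmetric])
  also have "\<dots> = (\<Sum>p\<leftarrow>cop x. \<Sum>r\<leftarrow>cop y. tensor_of H [(fst p \<otimes> fst r, snd p \<otimes> snd r)])"
    by (rule tensor_mult_tensor_of[OF alg cop(1) cop(1)]) fact+
  also have "\<dots> =
    tensor_of H (concat (map (\<lambda>p. map (\<lambda>r. (fst p \<otimes> fst r, snd p \<otimes> snd r)) (cop y)) (cop x)))"
    by (subst (2) tensor_of_sum_list)
      (simp add: map_concat o_def sum_list_concat split_def)
  finally show ?thesis .
qed

lemma coassoc:
  assumes x: "x \<in> carrier H" and \<tau>: "trilinear_form H \<tau>"
  shows "(\<Sum>p\<leftarrow>cop x. comult H (fst p) (\<lambda>a b. \<tau> a b (snd p))) =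
    (\<Sum>p\<leftarrow>cop x. comult H (snd p) (\<lambda>a b. \<tau> (fst p) a b))"
proof -
  have "tensor_lift H 0 (+)
      (\<lambda>a b. tensor_lift H 0 (+) (\<lambda>a' a''. pure_tensor3 H a' a'' b) (comult H a)) (comult H x) =
    tensor_lift H 0 (+)
      (\<lambda>a b. tensor_lift H 0 (+) (\<lambda>b' b''. pure_tensor3 H a b' b'') (comult H b)) (comult H x)"
    using coalg x by (simp add: coalgebra_def)
  from fun_cong[OF this[unfolded nested_lift(1,2)[OF x]], of \<tau>] show ?thesis
    using \<tau> by simp
qed

lemma bilin_counit_left: "bilin H H (\<lambda>a b. counit H a \<odot> b)"
  using counit_linear
  by (simp add: bilin_def bilinear_form_def linear_form_def distrib_left distrib_right mult_ac)

lemma bilin_counit_right: "bilin H H (\<lambda>a b. counit H b \<odot> a)"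
  using counit_linear
  by (simp add: bilin_def bilinear_form_def linear_form_def distrib_left distrib_right mult_ac)

lemma bilin_antipode_left: "bilin H H (\<lambda>a b. antipode H a \<otimes> b)"
  by (simp add: bilin_def bilinear_form_def linear_form_def antipode_linear
      l_distr r_distr smult_mult)

lemma bilin_antipode_right: "bilin H H (\<lambda>a b. a \<otimes> antipode H b)"
  by (simp add: bilin_def bilinear_form_def linear_form_def antipode_linear
      l_distr r_distr smult_mult)

lemma foldr_counit_left: "x \<in> carrier H \<Longrightarrow> foldr (\<lambda>(a, b). (\<oplus>) (counit H a \<odot> b)) (cop x) \<zero> = x"
  using tensor_lift_tensor_of[OF vecH bilin_counit_left cop(1)] coalg
  by (simp add: coalgebra_def cop(2)[symmetric])

lemma foldr_counit_right: "x \<in> carrier H \<Longrightarrow> foldr (\<lambda>(a, b). (\<oplus>) (counit H b \<odot> a)) (cop x) \<zero> = x"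
  using tensor_lift_tensor_of[OF vecH bilin_counit_right cop(1)] coalg
  by (simp add: coalgebra_def cop(2)[symmetric])

lemma foldr_antipode_left:
  "x \<in> carrier H \<Longrightarrow> foldr (\<lambda>(a, b). (\<oplus>) (antipode H a \<otimes> b)) (cop x) \<zero> = counit H x \<odot> \<one>"
  using tensor_lift_tensor_of[OF vecH bilin_antipode_left cop(1)] hopf
  by (simp add: hopf_algebra_def cop(2)[symmetric])

lemma foldr_antipode_right:
  "x \<in> carrier H \<Longrightarrow> foldr (\<lambda>(a, b). (\<oplus>) (a \<otimes> antipode H b)) (cop x) \<zero> = counit H x \<odot> \<one>"
  using tensor_lift_tensor_of[OF vecH bilin_antipode_right cop(1)] hopf
  by (simp add: hopf_algebra_def cop(2)[symmetric])

end

section \<open>The convolution algebra\<close>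

text \<open>The purely algebraic setting, shared by \<open>H\<close> and its quotient.\<close>

locale conv_alg = hopf_alg H for H :: "('k::field, 'a) hopf" (structure) +
  fixes s :: "'k \<Rightarrow> 'b \<Rightarrow> 'b::{comm_ring, comm_monoid_mult}"
  assumes vs: "vector_space s" and s_mult: "s c (x * y) = s c x * y"
begin

sublocale B: vector_space s
  by (rule vs)

lemma s_mult_right: "s c (x * y) = x * s c y"
  by (metis mult.commute s_mult)

lemma s_sum_list: "s c (\<Sum>p\<leftarrow>xs. f p) = (\<Sum>p\<leftarrow>xs. s c (f p))"
  by (induction xs) (auto simp: B.scale_right_distrib)

abbreviation LH where "LH \<equiv> lin_hom H s"

abbreviation conv (infixl "\<star>" 70) where "\<phi> \<star> \<psi> \<equiv> convolution H \<phi> \<psi>"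

definition eps where "eps x = (if x \<in> carrier H then s (counit H x) 1 else 0)"

lemma LH_add: "\<phi> \<in> LH \<Longrightarrow> x \<in> carrier H \<Longrightarrow> y \<in> carrier H \<Longrightarrow> \<phi> (x \<oplus> y) = \<phi> x + \<phi> y"
  by (simp add: lin_hom_def)

lemma LH_smult: "\<phi> \<in> LH \<Longrightarrow> x \<in> carrier H \<Longrightarrow> \<phi> (c \<odot> x) = s c (\<phi> x)"
  by (simp add: lin_hom_def)

lemma LH_outside: "\<phi> \<in> LH \<Longrightarrow> x \<notin> carrier H \<Longrightarrow> \<phi> x = 0"
  by (simp add: lin_hom_def)

lemma LH_ext:
  "\<phi> \<in> LH \<Longrightarrow> \<psi> \<in> LH \<Longrightarrow> (\<And>x. x \<in> carrier H \<Longrightarrow> \<phi> x = \<psi> x) \<Longrightarrow> \<phi> = \<psi>"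
  by (rule ext) (metis LH_outside)

lemma LH_zero: "0 \<in> LH"
  by (simp add: lin_hom_def)

lemma LH_plus: "\<phi> \<in> LH \<Longrightarrow> \<psi> \<in> LH \<Longrightarrow> \<phi> + \<psi> \<in> LH"
  by (simp add: lin_hom_def B.scale_right_distrib)

lemma LH_minus: "\<phi> \<in> LH \<Longrightarrow> \<psi> \<in> LH \<Longrightarrow> \<phi> - \<psi> \<in> LH"
  by (simp add: lin_hom_def B.scale_right_diff_distrib)

lemma LH_scale: "\<phi> \<in> LH \<Longrightarrow> hom_scale s c \<phi> \<in> LH"
  by (simp add: lin_hom_def hom_scale_def B.scale_right_distrib mult.commute)

lemma eps_LH: "eps \<in> LH"
  using counit_linear
  by (auto simp: eps_def lin_hom_def linear_form_def B.scale_left_distrib)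

lemma bilin_LH:
  assumes "\<phi> \<in> LH" "\<psi> \<in> LH"
  shows "bilin_typ H s (\<lambda>a b. \<phi> a * \<psi> b)"
  using assms
  by (simp add: bilin_typ_def LH_add LH_smult distrib_left distrib_right
      s_mult[symmetric] s_mult_right[symmetric])

text \<open>The representing list is arbitrary, so it can be chosen to display structure: membership
  in an ideal, degrees, or a product of two coproducts.\<close>

lemma conv_rep:
  assumes "\<phi> \<in> LH" "\<psi> \<in> LH" "x \<in> carrier H"
    "set xs \<subseteq> carrier H \<times> carrier H" "comult H x = tensor_of H xs"
  shows "(\<phi> \<star> \<psi>) x = (\<Sum>p\<leftarrow>xs. \<phi> (fst p) * \<psi> (snd p))"
  using tensor_lift_typ[OF vs bilin_LH[OF assms(1,2)] assms(4)] assms(3,5)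
  by (simp add: convolution_def split_def)

lemma conv_cop:
  assumes "\<phi> \<in> LH" "\<psi> \<in> LH" "x \<in> carrier H"
  shows "(\<phi> \<star> \<psi>) x = (\<Sum>p\<leftarrow>cop x. \<phi> (fst p) * \<psi> (snd p))"
  using conv_rep[OF assms cop] assms by blast

lemma conv_outside: "x \<notin> carrier H \<Longrightarrow> (\<phi> \<star> \<psi>) x = 0"
  by (simp add: convolution_def)

text \<open>The chosen lists \<open>cop\<close> are not linear in their argument; lists for a sum
  and for a multiple are therefore built by concatenation and by scaling the first entries.\<close>

lemma conv_LH:
  assumes L: "\<phi> \<in> LH" "\<psi> \<in> LH"
  shows "\<phi> \<star> \<psi> \<in> LH"
proof -
  have "(\<phi> \<star> \<psi>) (x \<oplus> y) = (\<phi> \<star> \<psi>) x + (\<phi> \<star> \<psi>) y" if "x \<in> carrier H" "y \<in> carrier H" for x y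
  proof -
    have "comult H (x \<oplus> y) = tensor_of H (cop x @ cop y)"
      using that by (simp add: comult_add cop(2)[symmetric] tensor_of_append)
    moreover have "set (cop x @ cop y) \<subseteq> carrier H \<times> carrier H"
      using that cop(1) by auto
    ultimately show ?thesis
      using conv_rep[OF L, of "x \<oplus> y" "cop x @ cop y"] that by (simp add: conv_cop[OF L])
  qed
  moreover have "(\<phi> \<star> \<psi>) (c \<odot> x) = s c ((\<phi> \<star> \<psi>) x)" if x: "x \<in> carrier H" for c x
  proof -
    let ?xs = "map (\<lambda>(a, b). (c \<odot> a, b)) (cop x)"
    have "comult H (c \<odot> x) = tensor_of H ?xs"
      using tensor_of_smult[OF cop(1)[OF x], of c] x by (simp add: comult_smult cop(2)[symmetric])
    moreover have "set ?xs \<subseteq> carrier H \<times> carrier H"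
      using x cop(1) by fastforce
    ultimately have "(\<phi> \<star> \<psi>) (c \<odot> x) = (\<Sum>p\<leftarrow>cop x. \<phi> (c \<odot> fst p) * \<psi> (snd p))"
      using conv_rep[OF L, of "c \<odot> x" ?xs] x by (simp add: split_def o_def)
    also have "\<dots> = (\<Sum>p\<leftarrow>cop x. s c (\<phi> (fst p) * \<psi> (snd p)))"
      using x by (intro sum_list_cong_set) (simp add: LH_smult[OF L(1)] cop_carrier s_mult)
    also have "\<dots> = s c ((\<phi> \<star> \<psi>) x)"
      using x by (simp add: conv_cop[OF L] s_sum_list)
    finally show ?thesis .
  qed
  ultimately show ?thesis
    by (auto simp: lin_hom_def conv_outside)
qed

end

section \<open>Convolution as an associative product with unit \<open>eps\<close>\<close>

context conv_alg
begin

lemma conv_diff_left: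
  assumes "\<phi> \<in> LH" "\<phi>' \<in> LH" "\<psi> \<in> LH"
  shows "(\<phi> - \<phi>') \<star> \<psi> = \<phi> \<star> \<psi> - \<phi>' \<star> \<psi>"
  by (rule LH_ext[OF conv_LH LH_minus[OF conv_LH conv_LH]])
    (simp_all add: LH_minus assms conv_cop left_diff_distrib sum_list_subtractf)

lemma conv_diff_right:
  assumes "\<phi> \<in> LH" "\<psi> \<in> LH" "\<psi>' \<in> LH"
  shows "\<phi> \<star> (\<psi> - \<psi>') = \<phi> \<star> \<psi> - \<phi> \<star> \<psi>'"
  by (rule LH_ext[OF conv_LH LH_minus[OF conv_LH conv_LH]])
    (simp_all add: LH_minus assms conv_cop right_diff_distrib sum_list_subtractf)

lemma conv_scale_left:
  assumes "\<phi> \<in> LH" "\<psi> \<in> LH"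
  shows "hom_scale s c \<phi> \<star> \<psi> = hom_scale s c (\<phi> \<star> \<psi>)"
proof (rule LH_ext[OF conv_LH LH_scale[OF conv_LH]])
  fix x assume "x \<in> carrier H"
  then show "(hom_scale s c \<phi> \<star> \<psi>) x = hom_scale s c (\<phi> \<star> \<psi>) x"
    using assms LH_scale[OF assms(1), of c] by (simp add: conv_cop s_sum_list hom_scale_def s_mult)
qed (simp_all add: assms LH_scale)

lemma conv_scale_right:
  assumes "\<phi> \<in> LH" "\<psi> \<in> LH"
  shows "\<phi> \<star> hom_scale s c \<psi> = hom_scale s c (\<phi> \<star> \<psi>)"
proof (rule LH_ext[OF conv_LH LH_scale[OF conv_LH]])
  fix x assume "x \<in> carrier H"
  then show "(\<phi> \<star> hom_scale s c \<psi>) x = hom_scale s c (\<phi> \<star> \<psi>) x"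
    using assms LH_scale[OF assms(2), of c] by (simp add: conv_cop s_sum_list hom_scale_def s_mult_right)
qed (simp_all add: assms LH_scale)

text \<open>The functional is applied to the counit axiom, read as a fold over
  \<open>cop x\<close>.\<close>

lemma eps_conv:
  assumes L: "\<phi> \<in> LH"
  shows "eps \<star> \<phi> = \<phi>"
proof (rule LH_ext)
  fix x assume x: "x \<in> carrier H"
  have "\<phi> x = \<phi> (foldr (\<lambda>(a, b). (\<oplus>) (counit H a \<odot> b)) (cop x) \<zero>)"
    using x by (simp add: foldr_counit_left)
  also have "\<dots> = (\<Sum>p\<leftarrow>cop x. \<phi> (counit H (fst p) \<odot> snd p))"
    by (rule lin_hom_foldr[OF vecH vs L cop(1)[OF x]]) auto
  also have "\<dots> = (\<Sum>p\<leftarrow>cop x. eps (fst p) * \<phi> (snd p))"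
    using cop_carrier[OF x]
    by (intro sum_list_cong_set) (simp add: LH_smult[OF L] eps_def s_mult[symmetric])
  finally show "(eps \<star> \<phi>) x = \<phi> x"
    by (simp add: conv_cop eps_LH L x)
qed (auto intro: conv_LH eps_LH L)

lemma conv_eps:
  assumes L: "\<phi> \<in> LH"
  shows "\<phi> \<star> eps = \<phi>"
proof (rule LH_ext)
  fix x assume x: "x \<in> carrier H"
  have "\<phi> x = \<phi> (foldr (\<lambda>(a, b). (\<oplus>) (counit H b \<odot> a)) (cop x) \<zero>)"
    using x by (simp add: foldr_counit_right)
  also have "\<dots> = (\<Sum>p\<leftarrow>cop x. \<phi> (counit H (snd p) \<odot> fst p))"
    by (rule lin_hom_foldr[OF vecH vs L cop(1)[OF x]]) auto
  also have "\<dots> = (\<Sum>p\<leftarrow>cop x. \<phi> (fst p) * eps (snd p))"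
    using cop_carrier[OF x]
    by (intro sum_list_cong_set) (simp add: LH_smult[OF L] eps_def s_mult_right[symmetric])
  finally show "(\<phi> \<star> eps) x = \<phi> x"
    by (simp add: conv_cop eps_LH L x)
qed (auto intro: conv_LH eps_LH L)

lemma sum_list_linear_form:
  assumes "linear_form (typ_module s) l"
  shows "l (\<Sum>p\<leftarrow>xs. f p) = (\<Sum>p\<leftarrow>xs. l (f p))"
proof -
  have "l 0 = 0"
    using linear_form_zero[OF vec_typ_module[OF vs] assms] by simp
  then show ?thesis
    using assms by (induction xs) (auto simp: linear_form_typ_module)
qed

text \<open>After a linear form \<open>l\<close> on \<open>B\<close> both sides become evaluations
  of iterated coproducts at the trilinear form \<open>l (\<phi> a * \<psi> b * \<omega> c)\<close>,
  to which coassociativity applies.\<close>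

lemma conv_assoc:
  assumes L: "\<phi> \<in> LH" "\<psi> \<in> LH" "\<omega> \<in> LH"
  shows "(\<phi> \<star> \<psi>) \<star> \<omega> = \<phi> \<star> (\<psi> \<star> \<omega>)"
proof (rule LH_ext)
  fix x assume x: "x \<in> carrier H"
  show "((\<phi> \<star> \<psi>) \<star> \<omega>) x = (\<phi> \<star> (\<psi> \<star> \<omega>)) x"
  proof (rule linear_forms_eqI[OF vec_typ_module[OF vs]])
    fix l assume l: "linear_form (typ_module s) l"
    note lsimps = LH_add LH_smult linear_form_typ_module distrib_left distrib_right
      s_mult[symmetric] s_mult_right[symmetric]
    have tri: "trilinear_form H (\<lambda>a b c. l (\<phi> a * \<psi> b * \<omega> c))"
      using L l
      by (simp add: trilinear_form_def bilinear_form_def linear_form_def lsimps)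
    have bil1: "bilinear_form H (\<lambda>a b. l (\<phi> a * \<psi> b * \<omega> c))"
      and bil2: "bilinear_form H (\<lambda>a b. l (\<phi> c * \<psi> a * \<omega> b))" if "c \<in> carrier H" for c
      using tri that by (auto simp: trilinear_form_def)
    have "l (((\<phi> \<star> \<psi>) \<star> \<omega>) x) = (\<Sum>p\<leftarrow>cop x. l ((\<phi> \<star> \<psi>) (fst p) * \<omega> (snd p)))"
      using x L by (simp add: conv_cop conv_LH sum_list_linear_form[OF l])
    also have "\<dots> = (\<Sum>p\<leftarrow>cop x. comult H (fst p) (\<lambda>a b. l (\<phi> a * \<psi> b * \<omega> (snd p))))"
      using L cop_carrier[OF x]
      by (intro sum_list_cong_set)
        (simp add: comult_eval bil1 conv_cop sum_list_mult_const[symmetric] sum_list_linear_form[OF l])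
    also have "\<dots> = (\<Sum>p\<leftarrow>cop x. comult H (snd p) (\<lambda>a b. l (\<phi> (fst p) * \<psi> a * \<omega> b)))"
      by (rule coassoc[OF x tri])
    also have "\<dots> = (\<Sum>p\<leftarrow>cop x. l (\<phi> (fst p) * (\<psi> \<star> \<omega>) (snd p)))"
      using L cop_carrier[OF x]
      by (intro sum_list_cong_set)
        (simp add: comult_eval bil2 conv_cop sum_list_const_mult[symmetric]
          sum_list_linear_form[OF l] mult.assoc[symmetric])
    also have "\<dots> = l ((\<phi> \<star> (\<psi> \<star> \<omega>)) x)"
      using x L by (simp add: conv_cop conv_LH sum_list_linear_form[OF l])
    finally show "l (((\<phi> \<star> \<psi>) \<star> \<omega>) x) = l ((\<phi> \<star> (\<psi> \<star> \<omega>)) x)" .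
  qed auto
qed (auto intro: conv_LH L)

lemma conv_product:
  assumes L: "\<phi> \<in> LH" "\<psi> \<in> LH" and xy: "x \<in> carrier H" "y \<in> carrier H"
  shows "(\<phi> \<star> \<psi>) (x \<otimes> y) =
    (\<Sum>p\<leftarrow>cop x. \<Sum>r\<leftarrow>cop y. \<phi> (fst p \<otimes> fst r) * \<psi> (snd p \<otimes> snd r))"
proof -
  let ?xs = "concat (map (\<lambda>p. map (\<lambda>r. (fst p \<otimes> fst r, snd p \<otimes> snd r)) (cop y)) (cop x))"
  have "set ?xs \<subseteq> carrier H \<times> carrier H"
    using cop_carrier[OF xy(1)] cop_carrier[OF xy(2)] by auto
  from conv_rep[OF L _ this comult_mult[OF xy]] show ?thesis
    using xy by (simp add: map_concat o_def sum_list_concat)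
qed

text \<open>If two functionals split on products into finite sums, so does their convolution,
  because the coproduct is multiplicative. One pair of terms serves characters, two serve
  infinitesimal characters, and \<open>Suc n\<close> many serve the powers of the latter.\<close>

lemma conv_product_sum:
  assumes L: "\<phi> \<in> LH" "\<psi> \<in> LH" and xy: "x \<in> carrier H" "y \<in> carrier H"
    and P: "\<And>i. i \<in> I \<Longrightarrow> P i \<in> LH" "\<And>i. i \<in> I \<Longrightarrow> P' i \<in> LH"
    and R: "\<And>j. j \<in> K \<Longrightarrow> R j \<in> LH" "\<And>j. j \<in> K \<Longrightarrow> R' j \<in> LH"
    and \<phi>: "\<And>a b. a \<in> carrier H \<Longrightarrow> b \<in> carrier H \<Longrightarrow> \<phi> (a \<otimes> b) = (\<Sum>i\<in>I. P i a * P' i b)"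
    and \<psi>: "\<And>a b. a \<in> carrier H \<Longrightarrow> b \<in> carrier H \<Longrightarrow> \<psi> (a \<otimes> b) = (\<Sum>j\<in>K. R j a * R' j b)"
  shows "(\<phi> \<star> \<psi>) (x \<otimes> y) = (\<Sum>i\<in>I. \<Sum>j\<in>K. (P i \<star> R j) x * (P' i \<star> R' j) y)"
proof -
  have "(\<phi> \<star> \<psi>) (x \<otimes> y) = (\<Sum>p\<leftarrow>cop x. \<Sum>r\<leftarrow>cop y.
      (\<Sum>i\<in>I. P i (fst p) * P' i (fst r)) * (\<Sum>j\<in>K. R j (snd p) * R' j (snd r)))"
    using cop_carrier[OF xy(1)] cop_carrier[OF xy(2)]
    by (simp add: conv_product[OF L xy] \<phi> \<psi> cong: map_cong)
  \<comment> \<open>Commutativity of \<open>B\<close> brings together the factors coming from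
    \<open>x\<close> and those coming from \<open>y\<close>.\<close>
  also have "\<dots> = (\<Sum>p\<leftarrow>cop x. \<Sum>r\<leftarrow>cop y. \<Sum>i\<in>I. \<Sum>j\<in>K.
      (P i (fst p) * R j (snd p)) * (P' i (fst r) * R' j (snd r)))"
    by (simp add: sum_product algebra_simps)
  also have "\<dots> = (\<Sum>i\<in>I. \<Sum>j\<in>K. \<Sum>p\<leftarrow>cop x. \<Sum>r\<leftarrow>cop y.
      (P i (fst p) * R j (snd p)) * (P' i (fst r) * R' j (snd r)))"
    by (simp add: sum_sum_list_swap)
  also have "\<dots> = (\<Sum>i\<in>I. \<Sum>j\<in>K. (P i \<star> R j) x * (P' i \<star> R' j) y)"
    using P R xy
    by (intro sum.cong refl)
      (simp add: conv_cop sum_list_const_mult sum_list_mult_const)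
  finally show ?thesis .
qed

end

section \<open>Characters and infinitesimal characters\<close>

context conv_alg
begin

lemma charactersD:
  assumes "\<phi> \<in> characters H s"
  shows "\<phi> \<in> LH" "\<phi> \<one> = 1"
    "\<And>x y. x \<in> carrier H \<Longrightarrow> y \<in> carrier H \<Longrightarrow> \<phi> (x \<otimes> y) = \<phi> x * \<phi> y"
  using assms by (auto simp: characters_def)

lemma eps_one: "eps \<one> = 1"
  by (simp add: eps_def)

lemma eps_mult_left: "x \<in> carrier H \<Longrightarrow> eps x * b = s (counit H x) b"
  by (simp add: eps_def s_mult[symmetric])

lemma eps_characters: "eps \<in> characters H s"
  by (simp add: characters_def eps_LH eps_one eps_mult_left) (simp add: eps_def counit_mult)

lemma conv_one:
  assumes "\<phi> \<in> LH" "\<psi> \<in> LH"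
  shows "(\<phi> \<star> \<psi>) \<one> = \<phi> \<one> * \<psi> \<one>"
  using conv_rep[OF assms, of \<one> "[(\<one>, \<one>)]"] hopf by (simp add: hopf_algebra_def)

lemma conv_characters:
  assumes "\<phi> \<in> characters H s" "\<psi> \<in> characters H s"
  shows "\<phi> \<star> \<psi> \<in> characters H s"
proof -
  note \<phi> = charactersD[OF assms(1)] and \<psi> = charactersD[OF assms(2)]
  have "(\<phi> \<star> \<psi>) (x \<otimes> y) = (\<phi> \<star> \<psi>) x * (\<phi> \<star> \<psi>) y" if "x \<in> carrier H" "y \<in> carrier H" for x y
    using conv_product_sum[OF \<phi>(1) \<psi>(1) that, of "{()}" "\<lambda>_. \<phi>" "\<lambda>_. \<phi>" "{()}" "\<lambda>_. \<psi>" "\<lambda>_. \<psi>"]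
    by (simp add: \<phi> \<psi>)
  then show ?thesis
    by (simp add: characters_def conv_LH \<phi>(1,2) \<psi>(1,2) conv_one)
qed

text \<open>Composition with the antipode. That it preserves characters is established later, for
  \<open>H\<close> by exponentials and for the quotient by pulling back.\<close>

definition inverse_char where
  "inverse_char \<phi> x = (if x \<in> carrier H then \<phi> (antipode H x) else 0)"

lemma inverse_char_LH: "\<phi> \<in> LH \<Longrightarrow> inverse_char \<phi> \<in> LH"
  by (simp add: lin_hom_def inverse_char_def antipode_linear)

text \<open>Multiplicativity turns the image of the antipode axiom under \<phi> into a convolution
  product.\<close>

lemma inverse_char_conv:
  assumes "\<phi> \<in> characters H s"
  shows "inverse_char \<phi> \<star> \<phi> = eps" and "\<phi> \<star> inverse_char \<phi> = eps"
proof -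
  note \<phi> = charactersD[OF assms]
  note LI = inverse_char_LH[OF \<phi>(1)]
  have *: "eps x = \<phi> (counit H x \<odot> \<one>)" if "x \<in> carrier H" for x
    using that by (simp add: eps_def LH_smult[OF \<phi>(1)] \<phi>(2))
  show "inverse_char \<phi> \<star> \<phi> = eps"
  proof (rule LH_ext)
    fix x assume x: "x \<in> carrier H"
    have "eps x = \<phi> (foldr (\<lambda>(a, b). (\<oplus>) (antipode H a \<otimes> b)) (cop x) \<zero>)"
      using x by (simp add: * foldr_antipode_left)
    also have "\<dots> = (\<Sum>p\<leftarrow>cop x. \<phi> (antipode H (fst p) \<otimes> snd p))"
      by (rule lin_hom_foldr[OF vecH vs \<phi>(1) cop(1)[OF x]]) auto
    also have "\<dots> = (\<Sum>p\<leftarrow>cop x. inverse_char \<phi> (fst p) * \<phi> (snd p))"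
      using cop_carrier[OF x] by (intro sum_list_cong_set) (simp add: \<phi>(3) inverse_char_def)
    finally show "(inverse_char \<phi> \<star> \<phi>) x = eps x"
      by (simp add: conv_cop LI \<phi>(1) x)
  qed (auto intro: conv_LH eps_LH \<phi>(1) LI)
  show "\<phi> \<star> inverse_char \<phi> = eps"
  proof (rule LH_ext)
    fix x assume x: "x \<in> carrier H"
    have "eps x = \<phi> (foldr (\<lambda>(a, b). (\<oplus>) (a \<otimes> antipode H b)) (cop x) \<zero>)"
      using x by (simp add: * foldr_antipode_right)
    also have "\<dots> = (\<Sum>p\<leftarrow>cop x. \<phi> (fst p \<otimes> antipode H (snd p)))"
      by (rule lin_hom_foldr[OF vecH vs \<phi>(1) cop(1)[OF x]]) auto
    also have "\<dots> = (\<Sum>p\<leftarrow>cop x. \<phi> (fst p) * inverse_char \<phi> (snd p))"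
      using cop_carrier[OF x] by (intro sum_list_cong_set) (simp add: \<phi>(3) inverse_char_def)
    finally show "(\<phi> \<star> inverse_char \<phi>) x = eps x"
      by (simp add: conv_cop LI \<phi>(1) x)
  qed (auto intro: conv_LH eps_LH \<phi>(1) LI)
qed

lemma conv_left_inverse_unique:
  assumes L: "\<phi> \<in> LH" "\<psi> \<in> LH" "\<psi>' \<in> LH" and "\<psi> \<star> \<phi> = eps" "\<phi> \<star> \<psi>' = eps"
  shows "\<psi> = \<psi>'"
proof -
  have "\<psi> = \<psi> \<star> (\<phi> \<star> \<psi>')"
    by (simp add: assms conv_eps)
  also have "\<dots> = (\<psi> \<star> \<phi>) \<star> \<psi>'"
    by (simp add: conv_assoc L)
  also have "\<dots> = \<psi>'"
    by (simp add: assms eps_conv)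
  finally show ?thesis .
qed

text \<open>Closure under inverses stays a hypothesis because \<open>H\<close> and its quotient
  obtain it by different arguments.\<close>

lemma char_group_groupI:
  assumes "\<And>\<phi>. \<phi> \<in> characters H s \<Longrightarrow> inverse_char \<phi> \<in> characters H s"
  shows "group (char_group H s)"
    and "\<phi> \<in> characters H s \<Longrightarrow> inv\<^bsub>char_group H s\<^esub> \<phi> = inverse_char \<phi>"
proof -
  show G: "group (char_group H s)"
  proof (rule groupI)
    fix \<phi> assume "\<phi> \<in> carrier (char_group H s)"
    then have "\<phi> \<in> characters H s" by (simp add: char_group_def)
    then show "\<exists>\<psi>\<in>carrier (char_group H s). \<psi> \<otimes>\<^bsub>char_group H s\<^esub> \<phi> = \<one>\<^bsub>char_group H s\<^esub>"
      using assms inverse_char_conv(1)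
      by (auto simp: char_group_def eps_def[abs_def])
  qed (auto simp: char_group_def conv_characters conv_assoc charactersD(1) eps_characters eps_conv
      eps_def[abs_def, symmetric])
  interpret G: group "char_group H s" by (rule G)
  show "inv\<^bsub>char_group H s\<^esub> \<phi> = inverse_char \<phi>" if "\<phi> \<in> characters H s"
    using that assms[OF that] inverse_char_conv(1)[OF that]
    by (intro G.inv_equality) (auto simp: char_group_def eps_def[abs_def])
qed

lemma infinitesimalD:
  assumes "\<phi> \<in> infinitesimal_characters H s"
  shows "\<phi> \<in> LH"
    "\<And>x y. x \<in> carrier H \<Longrightarrow> y \<in> carrier H \<Longrightarrow> \<phi> (x \<otimes> y) = eps x * \<phi> y + \<phi> x * eps y"
    "\<phi> \<one> = 0"
proof -
  show L: "\<phi> \<in> LH" and p: "\<And>x y. x \<in> carrier H \<Longrightarrow> y \<in> carrier H \<Longrightarrow> \<phi> (x \<otimes> y) = eps x * \<phi> y + \<phi> x * eps y"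
    using assms by (auto simp: infinitesimal_characters_def eps_mult_left mult.commute[of _ "eps _"])
  have "\<phi> \<one> = \<phi> \<one> + \<phi> \<one>"
    using p[of \<one> \<one>] by (simp add: eps_mult_left mult.commute[of _ "eps _"])
  then show "\<phi> \<one> = 0" by simp
qed

lemma infinitesimalI:
  assumes "\<phi> \<in> LH"
    "\<And>x y. x \<in> carrier H \<Longrightarrow> y \<in> carrier H \<Longrightarrow> \<phi> (x \<otimes> y) = eps x * \<phi> y + \<phi> x * eps y"
  shows "\<phi> \<in> infinitesimal_characters H s"
  using assms by (auto simp: infinitesimal_characters_def eps_mult_left mult.commute[of _ "eps _"])

text \<open>The two mixed terms are symmetric in \<phi> and \<psi>, so they cancel in the commutator
  and leave the derivation rule.\<close>

lemma conv_infinitesimal_product: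
  assumes "\<phi> \<in> infinitesimal_characters H s" "\<psi> \<in> infinitesimal_characters H s"
    and xy: "x \<in> carrier H" "y \<in> carrier H"
  shows "(\<phi> \<star> \<psi>) (x \<otimes> y) =
    eps x * (\<phi> \<star> \<psi>) y + \<psi> x * \<phi> y + \<phi> x * \<psi> y + (\<phi> \<star> \<psi>) x * eps y"
proof -
  note \<phi> = infinitesimalD[OF assms(1)] and \<psi> = infinitesimalD[OF assms(2)]
  \<comment> \<open>The index \<open>True\<close> selects the unit \<open>eps\<close>. Taking index
    \<open>i\<close> at the first argument and its negation at the second gives the two terms of the
    derivation rule.\<close>
  let ?P = "\<lambda>\<phi> b. if b then eps else \<phi>"
  have "(\<phi> \<star> \<psi>) (x \<otimes> y) = (\<Sum>i\<in>{True, False}. \<Sum>j\<in>{True, False}.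
      (?P \<phi> i \<star> ?P \<psi> j) x * (?P \<phi> (\<not> i) \<star> ?P \<psi> (\<not> j)) y)"
    by (rule conv_product_sum[OF \<phi>(1) \<psi>(1) xy])
      (auto simp: \<phi> \<psi> eps_LH)
  then show ?thesis
    by (simp add: \<phi> \<psi> eps_LH conv_eps eps_conv algebra_simps)
qed

lemma conv_bracket_infinitesimal:
  assumes "\<phi> \<in> infinitesimal_characters H s" "\<psi> \<in> infinitesimal_characters H s"
  shows "conv_bracket H \<phi> \<psi> \<in> infinitesimal_characters H s"
proof -
  note \<phi> = infinitesimalD[OF assms(1)] and \<psi> = infinitesimalD[OF assms(2)]
  show ?thesis
  proof (rule infinitesimalI)
    show "conv_bracket H \<phi> \<psi> \<in> LH"
      by (simp add: conv_bracket_def LH_minus conv_LH \<phi>(1) \<psi>(1))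
    fix x y assume "x \<in> carrier H" "y \<in> carrier H"
    then show "conv_bracket H \<phi> \<psi> (x \<otimes> y) =
        eps x * conv_bracket H \<phi> \<psi> y + conv_bracket H \<phi> \<psi> x * eps y"
      by (simp add: conv_bracket_def conv_infinitesimal_product assms algebra_simps)
  qed
qed

subsection \<open>Annihilators of Hopf ideals\<close>

lemma hopf_ideal_subset: "hopf_ideal H J \<Longrightarrow> J \<subseteq> carrier H"
  using ideal.Icarr[of J H] by (auto simp: hopf_ideal_def)

lemma annihilatorD: "\<phi> \<in> annihilator H J s \<Longrightarrow> \<phi> \<in> LH" "\<phi> \<in> annihilator H J s \<Longrightarrow> x \<in> J \<Longrightarrow> \<phi> x = 0"
  by (auto simp: annihilator_def)

text \<open>The Hopf ideal condition supplies a list for the coproduct in which every pair has an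
  entry in \<open>J\<close>, so each summand of the convolution vanishes.\<close>

lemma conv_annihilator:
  assumes J: "hopf_ideal H J" and A: "\<phi> \<in> annihilator H J s" "\<psi> \<in> annihilator H J s"
  shows "\<phi> \<star> \<psi> \<in> annihilator H J s"
proof -
  note L = annihilatorD(1)[OF A(1)] annihilatorD(1)[OF A(2)]
  have "(\<phi> \<star> \<psi>) x = 0" if "x \<in> J" for x
  proof -
    have "comult H x \<in> tensors H (J \<times> carrier H \<union> carrier H \<times> J)"
      using J that by (auto simp: hopf_ideal_def)
    then obtain xs where xs: "set xs \<subseteq> J \<times> carrier H \<union> carrier H \<times> J" "comult H x = tensor_of H xs"
      by (auto simp: tensors_def)
    have "set xs \<subseteq> carrier H \<times> carrier H"
      using xs(1) hopf_ideal_subset[OF J] by auto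
    then have "(\<phi> \<star> \<psi>) x = (\<Sum>p\<leftarrow>xs. \<phi> (fst p) * \<psi> (snd p))"
      using conv_rep[OF L _ _ xs(2)] hopf_ideal_subset[OF J] that by auto
    also have "\<dots> = (\<Sum>p\<leftarrow>xs. 0)"
    proof (rule sum_list_cong_set)
      fix p assume "p \<in> set xs"
      then have "fst p \<in> J \<or> snd p \<in> J" using xs(1) by auto
      then show "\<phi> (fst p) * \<psi> (snd p) = 0"
        using annihilatorD(2)[OF A(1)] annihilatorD(2)[OF A(2)] by auto
    qed
    finally show ?thesis by simp
  qed
  then show ?thesis
    by (simp add: annihilator_def conv_LH L)
qed

lemma eps_annihilator: "hopf_ideal H J \<Longrightarrow> eps \<in> annihilator H J s"
  by (auto simp: annihilator_def eps_LH eps_def hopf_ideal_def)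

lemma annihilator_minus:
  "\<phi> \<in> annihilator H J s \<Longrightarrow> \<psi> \<in> annihilator H J s \<Longrightarrow> \<phi> - \<psi> \<in> annihilator H J s"
  by (simp add: annihilator_def LH_minus)

lemma inverse_char_annihilator:
  "hopf_ideal H J \<Longrightarrow> \<phi> \<in> annihilator H J s \<Longrightarrow> inverse_char \<phi> \<in> annihilator H J s"
  by (auto simp: annihilator_def inverse_char_LH inverse_char_def hopf_ideal_def)

subsection \<open>Convolution powers\<close>

primrec cpow :: "('a \<Rightarrow> 'b) \<Rightarrow> nat \<Rightarrow> 'a \<Rightarrow> 'b" where
  "cpow \<rho> 0 = eps"
| "cpow \<rho> (Suc n) = \<rho> \<star> cpow \<rho> n"

lemma cpow_LH: "\<rho> \<in> LH \<Longrightarrow> cpow \<rho> n \<in> LH"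
  by (induction n) (auto intro: eps_LH conv_LH)

lemma cpow_add: "\<rho> \<in> LH \<Longrightarrow> cpow \<rho> m \<star> cpow \<rho> n = cpow \<rho> (m + n)"
  by (induction m) (auto simp: eps_conv cpow_LH conv_assoc)

lemma cpow_one: "\<rho> \<in> LH \<Longrightarrow> cpow \<rho> (Suc 0) = \<rho>"
  by (simp add: conv_eps)

lemma cpow_characters: "\<phi> \<in> characters H s \<Longrightarrow> cpow \<phi> n \<in> characters H s"
  by (induction n) (auto intro: eps_characters conv_characters)

lemma cpow_annihilator:
  "hopf_ideal H J \<Longrightarrow> \<rho> \<in> annihilator H J s \<Longrightarrow> cpow \<rho> n \<in> annihilator H J s"
  by (induction n) (auto intro: eps_annihilator conv_annihilator)

text \<open>Pascal's rule, as used in the Leibniz formula, where \<open>u i j\<close> is a product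
  of an \<open>i\<close>th power at \<open>x\<close> and a \<open>j\<close>th power at
  \<open>y\<close>.\<close>

lemma pascal_sum:
  fixes u :: "nat \<Rightarrow> nat \<Rightarrow> 'b"
  shows "(\<Sum>j\<le>n. s (of_nat (n choose j)) (u j (Suc (n - j)))) +
      (\<Sum>j\<le>n. s (of_nat (n choose j)) (u (Suc j) (n - j))) =
    (\<Sum>j\<le>Suc n. s (of_nat (Suc n choose j)) (u j (Suc n - j)))"
proof -
  \<comment> \<open>The range is extended by the index \<open>Suc n\<close>, whose binomial
    coefficient is zero.\<close>
  have "(\<Sum>j\<le>n. s (of_nat (n choose j)) (u j (Suc (n - j)))) =
      (\<Sum>j\<le>Suc n. s (of_nat (n choose j)) (u j (Suc n - j)))"
    by (simp add: Suc_diff_le binomial_eq_0)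
  also have "\<dots> = u 0 (Suc n) + (\<Sum>j\<le>n. s (of_nat (n choose Suc j)) (u (Suc j) (n - j)))"
    by (subst sum.atMost_Suc_shift) simp
  finally show ?thesis
    by (subst sum.atMost_Suc_shift)
      (simp add: B.scale_left_distrib sum.distrib algebra_simps)
qed

text \<open>The Leibniz formula: on products \<open>D\<close> acts as a sum of two commuting
  operators, one for each argument, and the powers of that sum expand binomially.\<close>

lemma cpow_product:
  assumes "D \<in> infinitesimal_characters H s" and xy: "x \<in> carrier H" "y \<in> carrier H"
  shows "cpow D n (x \<otimes> y) = (\<Sum>k\<le>n. s (of_nat (n choose k)) (cpow D k x * cpow D (n - k) y))"
  using xy
proof (induction n arbitrary: x y)
  case 0
  then show ?case
    using charactersD(3)[OF eps_characters] by simp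
next
  case (Suc n)
  note D = infinitesimalD[OF assms(1)]
  \<comment> \<open>The binomial coefficient is absorbed into the functional at \<open>x\<close>,
    which gives the induction hypothesis the form of a plain sum of products.\<close>
  let ?R = "\<lambda>k. hom_scale s (of_nat (n choose k)) (cpow D k)"
  have "cpow D (Suc n) (x \<otimes> y) = (\<Sum>i\<in>{True, False}. \<Sum>k\<le>n.
      ((if i then eps else D) \<star> ?R k) x * ((if \<not> i then eps else D) \<star> cpow D (n - k)) y)"
    unfolding cpow.simps
    by (rule conv_product_sum[OF D(1) cpow_LH[OF D(1)] Suc.prems])
      (auto simp: D eps_LH Suc.IH LH_scale LH_scale[unfolded hom_scale_def] cpow_LH hom_scale_def s_mult)
  also have "\<dots> = (\<Sum>k\<le>n. s (of_nat (n choose k)) (cpow D k x * cpow D (Suc (n - k)) y)) +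
      (\<Sum>k\<le>n. s (of_nat (n choose k)) (cpow D (Suc k) x * cpow D (n - k) y))"
    by (simp add: eps_conv conv_scale_right D(1) cpow_LH LH_scale eps_LH)
      (simp add: hom_scale_def s_mult)
  also have "\<dots> = (\<Sum>k\<le>Suc n. s (of_nat (Suc n choose k)) (cpow D k x * cpow D (Suc n - k) y))"
    by (rule pascal_sum[of n "\<lambda>i j. cpow D i x * cpow D j y"])
  finally show ?case .
qed

end

section \<open>Functional calculus in graded connected Hopf algebras\<close>

locale graded_conv_alg = conv_alg H s
  for H :: "('k::field_char_0, 'a) hopf" (structure) and s :: "'k \<Rightarrow> 'b \<Rightarrow> 'b::{comm_ring, comm_monoid_mult}" +
  fixes Hn :: "nat \<Rightarrow> 'a set"
  assumes graded: "graded_connected_hopf H Hn"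
begin

lemma Hn_carrier: "x \<in> Hn n \<Longrightarrow> x \<in> carrier H"
proof -
  interpret M: module "ring_of_type_algebra :: 'k ring" H by (rule vecH)
  have "submodule (Hn n) (ring_of_type_algebra :: 'k ring) H"
    using graded by (simp add: graded_connected_hopf_def direct_sum_decomposition_def)
  from M.submoduleE(1)[OF this] show "x \<in> Hn n \<Longrightarrow> x \<in> carrier H"
    by blast
qed

lemma LH_finsum:
  assumes "\<phi> \<in> LH" "finite A" "f \<in> A \<rightarrow> carrier H"
  shows "\<phi> (finsum H f A) = (\<Sum>i\<in>A. \<phi> (f i))"
  using assms(2,3)
  by (induction A rule: finite_induct)
    (auto simp: lin_hom_zero[OF vecH vs assms(1)] LH_add[OF assms(1)] finsum_insert Pi_iff)

text \<open>A decreasing filtration by degree, additive under convolution; it is the source of all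
  finiteness of series.\<close>

definition van :: "nat \<Rightarrow> ('a \<Rightarrow> 'b) set" where
  "van k = {\<phi> \<in> LH. \<forall>j<k. \<forall>x\<in>Hn j. \<phi> x = 0}"

lemma van_LH: "\<phi> \<in> van k \<Longrightarrow> \<phi> \<in> LH"
  by (simp add: van_def)

text \<open>In a pair of degrees \<open>i\<close> and \<open>n - i\<close> with
  \<open>n < j + k\<close>, one of the two degrees lies below the bound of its functional.\<close>

lemma conv_van:
  assumes "\<phi> \<in> van j" "\<psi> \<in> van k"
  shows "\<phi> \<star> \<psi> \<in> van (j + k)"
proof -
  note L = van_LH[OF assms(1)] van_LH[OF assms(2)]
  have "(\<phi> \<star> \<psi>) x = 0" if n: "n < j + k" and x: "x \<in> Hn n" for n x
  proof -
    have "comult H x \<in> tensors H (\<Union>i\<in>{..n}. Hn i \<times> Hn (n - i))"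
      using graded x unfolding graded_connected_hopf_def by blast
    then obtain xs where xs: "set xs \<subseteq> (\<Union>i\<in>{..n}. Hn i \<times> Hn (n - i))" "comult H x = tensor_of H xs"
      by (auto simp: tensors_def)
    have "p \<in> carrier H \<times> carrier H" if p: "p \<in> set xs" for p
    proof -
      obtain i where "p \<in> Hn i \<times> Hn (n - i)"
        using xs(1) p by blast
      then show ?thesis
        using Hn_carrier[of "fst p" i] Hn_carrier[of "snd p" "n - i"] by (cases p) simp
    qed
    then have "set xs \<subseteq> carrier H \<times> carrier H"
      by blast
    then have "(\<phi> \<star> \<psi>) x = (\<Sum>p\<leftarrow>xs. \<phi> (fst p) * \<psi> (snd p))"
      using conv_rep[OF L _ _ xs(2)] Hn_carrier[OF x] by auto
    also have "\<dots> = (\<Sum>p\<leftarrow>xs. 0)"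
    proof (rule sum_list_cong_set)
      fix p assume "p \<in> set xs"
      then have "p \<in> (\<Union>i\<in>{..n}. Hn i \<times> Hn (n - i))"
        using xs(1) by blast
      then obtain i where i: "i \<le> n" "fst p \<in> Hn i" "snd p \<in> Hn (n - i)"
        by (cases p) auto
      then have "i < j \<or> n - i < k"
        using n by linarith
      then show "\<phi> (fst p) * \<psi> (snd p) = 0"
        using i assms by (auto simp: van_def)
    qed
    finally show ?thesis by simp
  qed
  then show ?thesis
    by (simp add: van_def conv_LH L)
qed

text \<open>This is connectedness: the counit shows that the unit is nonzero, hence it spans the
  one-dimensional degree zero part.\<close>

lemma van_1_iff: "\<phi> \<in> van (Suc 0) \<longleftrightarrow> \<phi> \<in> LH \<and> \<phi> \<one> = 0"
proof -
  have 1: "\<one> \<in> Hn 0"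
    using graded by (simp add: graded_connected_hopf_def)
  obtain v where v: "v \<in> Hn 0" "v \<noteq> \<zero>" "Hn 0 = {c \<odot> v | c. True}"
    using graded unfolding graded_connected_hopf_def by blast
  obtain c where c: "\<one> = c \<odot> v"
    using 1 v(3) by blast
  have vc: "v \<in> carrier H"
    using v(1) by (rule Hn_carrier)
  have "c \<noteq> 0"
  proof
    assume "c = 0"
    then have "\<one> = \<zero>"
      using c vc by (simp add: vec_smult_zero_left[OF vecH])
    then show False
      using counit_one linear_form_zero[OF vecH counit_linear] by simp
  qed
  have "\<phi> x = 0" if L: "\<phi> \<in> LH" "\<phi> \<one> = 0" and x: "x \<in> Hn 0" for x
  proof -
    have "s c (\<phi> v) = 0"
      using L vc c by (simp add: LH_smult)
    then have "\<phi> v = 0"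
      using \<open>c \<noteq> 0\<close> by simp
    moreover obtain d where "x = d \<odot> v"
      using x v(3) by blast
    ultimately show ?thesis
      using L vc by (simp add: LH_smult)
  qed
  then show ?thesis
    using 1 by (auto simp: van_def)
qed

lemma eps_van: "eps \<in> van 0"
  by (simp add: van_def eps_LH)

lemma cpow_van: "\<rho> \<in> van (Suc 0) \<Longrightarrow> cpow \<rho> n \<in> van n"
proof (induction n)
  case (Suc n)
  then show ?case
    using conv_van[of \<rho> "Suc 0" "cpow \<rho> n" n] by simp
qed (simp add: eps_van)

text \<open>Only finitely many homogeneous components of \<open>x\<close> are nonzero, so one bound
  serves all functionals at once.\<close>

lemma degree_bound_exists:
  assumes x: "x \<in> carrier H"
  shows "\<exists>N. \<forall>k>N. \<forall>\<phi>\<in>van k. \<phi> x = 0"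
proof -
  have "direct_sum_decomposition H Hn"
    using graded by (simp add: graded_connected_hopf_def)
  then have "\<exists>!f. homogeneous_decomposition H Hn x f"
    using x by (simp add: direct_sum_decomposition_def)
  from ex1_implies_ex[OF this] obtain f where "homogeneous_decomposition H Hn x f"
    by (rule exE)
  then have f: "\<And>n. f n \<in> Hn n" and fin: "finite {n. f n \<noteq> \<zero>}"
    and eq: "x = finsum H f {n. f n \<noteq> \<zero>}"
    by (auto simp: homogeneous_decomposition_def)
  obtain N where N: "\<And>n. f n \<noteq> \<zero> \<Longrightarrow> n \<le> N"
    using fin finite_nat_set_iff_bounded_le by auto
  have "\<phi> x = 0" if "k > N" "\<phi> \<in> van k" for k \<phi>
  proof -
    have "\<phi> x = (\<Sum>n\<in>{n. f n \<noteq> \<zero>}. \<phi> (f n))"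
      using f Hn_carrier by (subst eq) (intro LH_finsum[OF van_LH[OF that(2)] fin]; auto)
    also have "\<dots> = 0"
    proof (rule sum.neutral, safe)
      fix n assume "f n \<noteq> \<zero>"
      then have "n < k"
        using N that(1) by (metis le_less_trans)
      then show "\<phi> (f n) = 0"
        using that(2) f by (auto simp: van_def)
    qed
    finally show ?thesis .
  qed
  then show ?thesis by blast
qed

definition dbound :: "'a \<Rightarrow> nat" where
  "dbound x = (SOME N. \<forall>k>N. \<forall>\<phi>\<in>van k. \<phi> x = 0)"

lemma dbound: "\<phi> \<in> van k \<Longrightarrow> dbound x < k \<Longrightarrow> \<phi> x = 0"
proof (cases "x \<in> carrier H")
  case True
  assume "\<phi> \<in> van k" "dbound x < k"
  moreover have "\<forall>k>dbound x. \<forall>\<phi>\<in>van k. \<phi> x = 0"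
    unfolding dbound_def by (rule someI_ex[OF degree_bound_exists[OF True]])
  ultimately show ?thesis
    by blast
qed (simp add: van_def LH_outside)

text \<open>The bounds \<open>dbound\<close> at different points are chosen independently. Raising
  the cutoff gives series at several points a common length.\<close>

lemma van_series_eq:
  assumes "\<And>k. p k \<in> van k" "dbound x \<le> N"
  shows "(\<Sum>k\<le>dbound x. s (c k) (p k x)) = (\<Sum>k\<le>N. s (c k) (p k x))"
  by (rule sum.mono_neutral_left) (use assms(2) dbound[OF assms(1)] in auto)

text \<open>Stated for any sequence adapted to the filtration rather than for powers of one
  functional: the real and imaginary parts of complexified powers form such sequences, too.\<close>

lemma van_series_LH:
  assumes p: "\<And>k. p k \<in> van k"
  shows "(\<lambda>x. \<Sum>k\<le>dbound x. s (c k) (p k x)) \<in> LH" (is "?f \<in> LH")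
proof -
  note L = van_LH[OF p]
  have "?f (x \<oplus> y) = ?f x + ?f y" if "x \<in> carrier H" "y \<in> carrier H" for x y
  proof -
    let ?N = "dbound x + dbound y + dbound (x \<oplus> y)"
    show ?thesis
      using van_series_eq[OF p, of x ?N c] van_series_eq[OF p, of y ?N c]
        van_series_eq[OF p, of "x \<oplus> y" ?N c] that
      by (simp add: LH_add[OF L] B.scale_right_distrib sum.distrib)
  qed
  moreover have "?f (a \<odot> x) = s a (?f x)" if "x \<in> carrier H" for a x
  proof -
    let ?N = "dbound x + dbound (a \<odot> x)"
    show ?thesis
      using van_series_eq[OF p, of x ?N c] van_series_eq[OF p, of "a \<odot> x" ?N c] that
      by (simp add: LH_smult[OF L] B.scale_sum_right mult.commute)
  qed
  moreover have "?f x = 0" if "x \<notin> carrier H" for x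
    using that by (simp add: LH_outside[OF L])
  ultimately show ?thesis
    by (simp add: lin_hom_def)
qed

lemma van_series_one:
  assumes p: "\<And>k. p k \<in> van k"
  shows "(\<Sum>k\<le>dbound \<one>. s (c k) (p k \<one>)) = s (c 0) (p 0 \<one>)"
proof -
  have "\<one> \<in> Hn 0"
    using graded by (simp add: graded_connected_hopf_def)
  then have "s (c k) (p k \<one>) = 0" if "k \<noteq> 0" for k
    using p[of k] that by (auto simp: van_def)
  then have "(\<Sum>k\<le>dbound \<one>. s (c k) (p k \<one>)) = (\<Sum>k\<in>{0}. s (c k) (p k \<one>))"
    by (intro sum.mono_neutral_right) auto
  then show ?thesis by simp
qed

text \<open>The series \<open>F(\<rho>)\<close>, cut off where all further terms vanish.\<close>

definition fcalc :: "'k fps \<Rightarrow> ('a \<Rightarrow> 'b) \<Rightarrow> 'a \<Rightarrow> 'b" where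
  "fcalc F \<rho> x = (\<Sum>k\<le>dbound x. s (fps_nth F k) (cpow \<rho> k x))"

lemma fcalc_eq:
  assumes "\<rho> \<in> van (Suc 0)" "dbound x \<le> N"
  shows "fcalc F \<rho> x = (\<Sum>k\<le>N. s (fps_nth F k) (cpow \<rho> k x))"
  unfolding fcalc_def by (rule van_series_eq[OF cpow_van[OF assms(1)] assms(2)])

lemma fcalc_LH: "\<rho> \<in> van (Suc 0) \<Longrightarrow> fcalc F \<rho> \<in> LH"
  unfolding fcalc_def[abs_def] by (rule van_series_LH[OF cpow_van])

lemma cpow_conv_cop:
  assumes "\<rho> \<in> LH" "x \<in> carrier H"
  shows "(\<Sum>p\<leftarrow>cop x. cpow \<rho> i (fst p) * cpow \<rho> j (snd p)) = cpow \<rho> (i + j) x"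
  using conv_cop[OF cpow_LH[OF assms(1), of i] cpow_LH[OF assms(1), of j] assms(2)]
  by (simp add: cpow_add assms(1))

text \<open>The Cauchy product: on powers of one functional convolution adds exponents, so
  coefficients multiply as formal power series do.\<close>

lemma fcalc_mult:
  assumes \<rho>: "\<rho> \<in> van (Suc 0)"
  shows "fcalc F \<rho> \<star> fcalc G \<rho> = fcalc (F * G) \<rho>"
proof (rule LH_ext)
  fix x assume x: "x \<in> carrier H"
  note L = van_LH[OF \<rho>]
  \<comment> \<open>A cutoff valid at \<open>x\<close> and at every entry of \<open>cop x\<close>.
    Since it dominates the bound of \<open>x\<close>, terms with \<open>i + j\<close> beyond it
    vanish, which reduces the square of indices to a triangle.\<close>
  define N where "N = dbound x + (\<Sum>p\<leftarrow>cop x. dbound (fst p) + dbound (snd p))"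
  have N: "dbound (fst p) \<le> N" "dbound (snd p) \<le> N" if "p \<in> set (cop x)" for p
    using member_le_sum_list[of "dbound (fst p) + dbound (snd p)" "map (\<lambda>p. dbound (fst p) + dbound (snd p)) (cop x)"] that
    by (auto simp: N_def)
  define g where "g i j = s (fps_nth F i * fps_nth G j) (cpow \<rho> (i + j) x)" for i j
  have g0: "g i j = 0" if "N < i + j" for i j
    using dbound[OF cpow_van[OF \<rho>, of "i + j"], of x] that by (simp add: g_def N_def)
  have "(fcalc F \<rho> \<star> fcalc G \<rho>) x = (\<Sum>p\<leftarrow>cop x. fcalc F \<rho> (fst p) * fcalc G \<rho> (snd p))"
    by (rule conv_cop[OF fcalc_LH[OF \<rho>] fcalc_LH[OF \<rho>] x])
  also have "\<dots> = (\<Sum>p\<leftarrow>cop x. (\<Sum>i\<le>N. s (fps_nth F i) (cpow \<rho> i (fst p))) *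
      (\<Sum>j\<le>N. s (fps_nth G j) (cpow \<rho> j (snd p))))"
    using N by (intro sum_list_cong_set) (simp add: fcalc_eq[OF \<rho>, of _ N])
  also have "\<dots> = (\<Sum>p\<leftarrow>cop x. \<Sum>i\<le>N. \<Sum>j\<le>N.
      s (fps_nth F i * fps_nth G j) (cpow \<rho> i (fst p) * cpow \<rho> j (snd p)))"
    by (simp add: sum_product s_mult[symmetric] s_mult_right[symmetric] mult.commute)
  also have "\<dots> = (\<Sum>i\<le>N. \<Sum>j\<le>N. g i j)"
    by (simp add: sum_sum_list_swap[symmetric] s_sum_list[symmetric] cpow_conv_cop[OF L x] g_def)
  also have "\<dots> = (\<Sum>(i, j)\<in>{..N} \<times> {..N}. g i j)"
    by (simp add: sum.cartesian_product)
  also have "\<dots> = (\<Sum>(i, j)\<in>{(i, j). i + j \<le> N}. g i j)"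
    by (rule sum.mono_neutral_right) (use g0 not_le in \<open>auto intro: g0\<close>)
  also have "\<dots> = (\<Sum>n\<le>N. \<Sum>i\<le>n. g i (n - i))"
    by (rule sum.triangle_reindex_eq)
  also have "\<dots> = (\<Sum>n\<le>N. s (fps_nth (F * G) n) (cpow \<rho> n x))"
    by (simp add: g_def fps_mult_nth B.scale_sum_left atLeast0AtMost)
  also have "\<dots> = fcalc (F * G) \<rho> x"
    by (rule fcalc_eq[OF \<rho>, symmetric]) (simp add: N_def)
  finally show "(fcalc F \<rho> \<star> fcalc G \<rho>) x = fcalc (F * G) \<rho> x" .
qed (auto intro: conv_LH fcalc_LH \<rho>)

lemma fcalc_one: "\<rho> \<in> van (Suc 0) \<Longrightarrow> fcalc 1 \<rho> = eps"
  by (rule ext) (simp add: fcalc_def if_distrib[of "\<lambda>c. s c _"] cong: if_cong)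

lemma fcalc_X: "\<rho> \<in> van (Suc 0) \<Longrightarrow> fcalc fps_X \<rho> = \<rho>"
proof
  fix x assume \<rho>: "\<rho> \<in> van (Suc 0)"
  show "fcalc fps_X \<rho> x = \<rho> x"
    using fcalc_eq[OF \<rho>, of x "Suc (dbound x)" fps_X] cpow_one[OF van_LH[OF \<rho>]]
    by (simp add: fps_X_def if_distrib[of "\<lambda>c. s c _"] cong: if_cong)
qed

lemma fcalc_add: "fcalc (F + G) \<rho> = fcalc F \<rho> + fcalc G \<rho>"
  by (rule ext) (simp add: fcalc_def B.scale_left_distrib sum.distrib)

lemma fcalc_diff: "fcalc (F - G) \<rho> = fcalc F \<rho> - fcalc G \<rho>"
  by (rule ext) (simp add: fcalc_def B.scale_left_diff_distrib sum_subtractf)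

lemma cpow_fcalc: "\<rho> \<in> van (Suc 0) \<Longrightarrow> cpow (fcalc F \<rho>) n = fcalc (F ^ n) \<rho>"
  by (induction n) (simp_all add: fcalc_one fcalc_mult)

lemma fcalc_van:
  assumes \<rho>: "\<rho> \<in> van (Suc 0)" and F: "fps_nth F 0 = 0"
  shows "fcalc F \<rho> \<in> van (Suc 0)"
proof -
  have "fcalc F \<rho> \<one> = 0"
    using van_series_one[OF cpow_van[OF \<rho>], where c = "fps_nth F"] F by (simp add: fcalc_def)
  then show ?thesis
    by (simp add: van_1_iff fcalc_LH[OF \<rho>])
qed

text \<open>Outer and inner series are evaluated at the same \<open>x\<close>, so one cutoff serves
  both and the identity is a rearrangement of a finite double sum.\<close>

lemma fcalc_compose:
  assumes \<rho>: "\<rho> \<in> van (Suc 0)" and G: "fps_nth G 0 = 0"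
  shows "fcalc F (fcalc G \<rho>) = fcalc (F oo G) \<rho>"
proof
  fix x
  let ?N = "dbound x"
  have "fcalc F (fcalc G \<rho>) x = (\<Sum>i\<le>?N. s (fps_nth F i) (\<Sum>n\<le>?N. s (fps_nth (G ^ i) n) (cpow \<rho> n x)))"
    unfolding fcalc_def[of F] by (simp only: cpow_fcalc[OF \<rho>] fcalc_def[of "G ^ _"])
  also have "\<dots> = (\<Sum>i\<le>?N. \<Sum>n\<le>?N. s (fps_nth F i * fps_nth (G ^ i) n) (cpow \<rho> n x))"
    by (simp add: B.scale_sum_right)
  also have "\<dots> = (\<Sum>n\<le>?N. s (\<Sum>i\<le>?N. fps_nth F i * fps_nth (G ^ i) n) (cpow \<rho> n x))"
    by (subst sum.swap) (simp add: B.scale_sum_left)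
  also have "\<dots> = (\<Sum>n\<le>?N. s (fps_nth (F oo G) n) (cpow \<rho> n x))"
  proof (rule sum.cong[OF refl])
    fix n assume n: "n \<in> {..?N}"
    \<comment> \<open>As \<open>G\<close> has no constant term, the \<open>n\<close>th coefficient
      of \<open>G ^ i\<close> is zero for \<open>i\<close> beyond \<open>n\<close>.\<close>
    have "(\<Sum>i\<le>?N. fps_nth F i * fps_nth (G ^ i) n) = (\<Sum>i=0..n. fps_nth F i * fps_nth (G ^ i) n)"
      using n by (intro sum.mono_neutral_right) (auto simp: startsby_zero_power_prefix[OF G])
    then show "s (\<Sum>i\<le>?N. fps_nth F i * fps_nth (G ^ i) n) (cpow \<rho> n x) =
        s (fps_nth (F oo G) n) (cpow \<rho> n x)"
      by (simp add: fps_compose_nth)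
  qed
  finally show "fcalc F (fcalc G \<rho>) x = fcalc (F oo G) \<rho> x"
    by (simp add: fcalc_def)
qed

lemma fcalc_annihilator:
  assumes J: "hopf_ideal H J" and A: "\<rho> \<in> annihilator H J s" and \<rho>: "\<rho> \<in> van (Suc 0)"
  shows "fcalc F \<rho> \<in> annihilator H J s"
  using cpow_annihilator[OF J A] fcalc_LH[OF \<rho>]
  by (simp add: annihilator_def fcalc_def)

end

text \<open>In characteristic zero the natural numbers are infinitely many points, so an identity at
  all of them is one of polynomials and can be compared in degree one.\<close>

lemma nat_polynomial_linear_coeff:
  fixes a :: "nat \<Rightarrow> 'k::field_char_0"
  assumes eq: "\<And>n. (\<Sum>j\<le>N. of_nat n ^ j * a j) = (\<Sum>i\<le>N. \<Sum>j\<le>N. of_nat n ^ (i + j) * b i j)"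
    and N: "1 \<le> N"
  shows "a 1 = b 0 1 + b 1 0"
proof -
  define P where "P = (\<Sum>j\<le>N. Polynomial.monom (a j) j) - (\<Sum>i\<le>N. \<Sum>j\<le>N. Polynomial.monom (b i j) (i + j))"
  have "poly P (of_nat n) = 0" for n
    using eq[of n] by (simp add: P_def poly_sum poly_monom mult.commute)
  then have "range of_nat \<subseteq> {x. poly P x = 0}"
    by auto
  moreover have "infinite (range (of_nat :: nat \<Rightarrow> 'k))"
    using finite_imageD[of "of_nat :: nat \<Rightarrow> 'k" UNIV] by (auto simp: inj_of_nat)
  ultimately have "P = 0"
    using poly_roots_finite[of P] finite_subset by blast
  then have "Polynomial.coeff P 1 = 0" by simp
  moreover have "Polynomial.coeff (\<Sum>j\<le>N. Polynomial.monom (a j) j) 1 = a 1"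
    using N by (simp add: coeff_sum)
  moreover have "Polynomial.coeff (\<Sum>i\<le>N. \<Sum>j\<le>N. Polynomial.monom (b i j) (i + j)) 1 = b 0 1 + b 1 0"
  proof -
    have "Polynomial.coeff (\<Sum>i\<le>N. \<Sum>j\<le>N. Polynomial.monom (b i j) (i + j)) 1 =
        (\<Sum>i\<le>N. \<Sum>j\<le>N. if i + j = 1 then b i j else 0)"
      by (simp add: coeff_sum)
    also have "\<dots> = (\<Sum>(i, j)\<in>{..N} \<times> {..N}. if i + j = 1 then b i j else 0)"
      by (simp add: sum.cartesian_product)
    also have "\<dots> = (\<Sum>(i, j)\<in>{(0, 1), (1, 0)}. if i + j = 1 then b i j else 0)"
      using N by (intro sum.mono_neutral_right) (auto simp: add_is_1 split: if_splits)
    finally show ?thesis by simp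
  qed
  ultimately show ?thesis
    by (simp add: P_def)
qed

text \<open>\<open>fps_ln 1\<close> is the series of ln(1 + X). The constant terms are treated
  asymmetrically because only the series exp(X) - 1, not exp(X), can be substituted into another
  series.\<close>

lemma fps_exp_ln_inverse:
  "fps_exp 1 oo fps_ln (1::'k::field_char_0) = 1 + fps_X" "fps_ln (1::'k) oo (fps_exp 1 - 1) = fps_X"
proof -
  have 0: "fps_nth (fps_exp 1 - 1 :: 'k fps) 0 = 0" "fps_nth (fps_exp 1 - 1 :: 'k fps) 1 \<noteq> 0"
    by auto
  have ln: "fps_ln (1::'k) = fps_inv (fps_exp 1 - 1)"
    by (rule fps_ln_fps_exp_inv) simp
  have "(fps_exp 1 - 1 :: 'k fps) oo fps_ln 1 = fps_X"
    unfolding ln by (rule fps_inv_right[OF 0])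
  then show "fps_exp 1 oo fps_ln (1::'k) = 1 + fps_X"
    by (simp add: fps_compose_sub_distrib algebra_simps)
  show "fps_ln (1::'k) oo (fps_exp 1 - 1) = fps_X"
    unfolding ln by (rule fps_inv[OF 0])
qed

section \<open>Exponential and logarithm between infinitesimal characters and characters\<close>

context graded_conv_alg
begin

definition Exp :: "('a \<Rightarrow> 'b) \<Rightarrow> 'a \<Rightarrow> 'b" where
  "Exp D = fcalc (fps_exp 1) D"

definition Log :: "('a \<Rightarrow> 'b) \<Rightarrow> 'a \<Rightarrow> 'b" where
  "Log \<phi> = fcalc (fps_ln 1) (\<phi> - eps)"

lemma unit_functionals_van: "\<phi> \<in> unit_functionals H s \<Longrightarrow> \<phi> - eps \<in> van (Suc 0)"
  by (simp add: van_1_iff unit_functionals_def LH_minus eps_LH eps_one)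

lemma Exp_unit_functionals:
  assumes D: "D \<in> van (Suc 0)"
  shows "Exp D \<in> unit_functionals H s" "Exp D - eps = fcalc (fps_exp 1 - 1) D"
proof -
  show *: "Exp D - eps = fcalc (fps_exp 1 - 1) D"
    by (simp add: Exp_def fcalc_diff fcalc_one D)
  have "fcalc (fps_exp 1 - 1) D \<in> van (Suc 0)"
    by (rule fcalc_van[OF D]) simp
  then have "(Exp D - eps) \<one> = 0"
    unfolding * by (simp add: van_1_iff)
  then show "Exp D \<in> unit_functionals H s"
    by (simp add: unit_functionals_def eps_one Exp_def fcalc_LH[OF D])
qed

lemma Log_van: "\<phi> \<in> unit_functionals H s \<Longrightarrow> Log \<phi> \<in> van (Suc 0)"
  unfolding Log_def by (rule fcalc_van[OF unit_functionals_van]) auto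

lemma Exp_Log:
  assumes "\<phi> \<in> unit_functionals H s"
  shows "Exp (Log \<phi>) = \<phi>"
  using unit_functionals_van[OF assms]
  by (simp add: Exp_def Log_def fcalc_compose fps_exp_ln_inverse fcalc_add fcalc_one fcalc_X)

lemma Log_Exp:
  assumes D: "D \<in> van (Suc 0)"
  shows "Log (Exp D) = D"
  by (simp add: Log_def Exp_unit_functionals[OF D] fcalc_compose[OF D] fps_exp_ln_inverse fcalc_X[OF D])

text \<open>Displays the value of the \<open>n\<close>th power at a point as a polynomial in
  \<open>n\<close>.\<close>

lemma cpow_eq_fcalc_exp:
  assumes \<phi>: "\<phi> \<in> unit_functionals H s"
  shows "cpow \<phi> n = fcalc (fps_exp (of_nat n)) (Log \<phi>)"
  using cpow_fcalc[OF Log_van[OF \<phi>], of "fps_exp 1" n] Exp_Log[OF \<phi>]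
  by (simp add: Exp_def fps_exp_power_mult)

lemma infinitesimal_van: "D \<in> infinitesimal_characters H s \<Longrightarrow> D \<in> van (Suc 0)"
  using infinitesimalD(1,3) by (simp add: van_1_iff)

text \<open>Divided by factorials, the Leibniz formula is the multiplication rule for exponential
  series.\<close>

lemma Exp_characters:
  assumes D: "D \<in> infinitesimal_characters H s"
  shows "Exp D \<in> characters H s"
proof -
  note V = infinitesimal_van[OF D]
  have "Exp D (x \<otimes> y) = Exp D x * Exp D y" if xy: "x \<in> carrier H" "y \<in> carrier H" for x y
  proof -
    \<comment> \<open>With this cutoff, \<open>N < i + j\<close> forces \<open>i\<close> beyond the
      bound of \<open>x\<close> or \<open>j\<close> beyond that of \<open>y\<close>, so the triangle
      of indices may be filled up to the square.\<close>
    define N where "N = dbound x + dbound y + dbound (x \<otimes> y)"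
    define g where "g i j = s (1 / (fact i * fact j)) (cpow D i x * cpow D j y)" for i j
    have g0: "g i j = 0" if "N < i + j" for i j
    proof -
      have "dbound x < i \<or> dbound y < j"
        using that by (auto simp: N_def)
      then show ?thesis
        using dbound[OF cpow_van[OF V]] by (auto simp: g_def)
    qed
    have "Exp D (x \<otimes> y) = (\<Sum>n\<le>N. s (1 / fact n) (cpow D n (x \<otimes> y)))"
      using fcalc_eq[OF V, of "x \<otimes> y" N "fps_exp 1"] by (simp add: Exp_def N_def)
    also have "\<dots> = (\<Sum>n\<le>N. \<Sum>i\<le>n. g i (n - i))"
      by (simp add: cpow_product[OF D xy] B.scale_sum_right g_def binomial_fact)
    also have "\<dots> = (\<Sum>(i, j)\<in>{(i, j). i + j \<le> N}. g i j)"
      by (rule sum.triangle_reindex_eq[symmetric])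
    also have "\<dots> = (\<Sum>(i, j)\<in>{..N} \<times> {..N}. g i j)"
      by (rule sum.mono_neutral_left) (auto intro: g0)
    also have "\<dots> = (\<Sum>i\<le>N. \<Sum>j\<le>N. g i j)"
      by (simp add: sum.cartesian_product)
    also have "\<dots> = (\<Sum>i\<le>N. s (1 / fact i) (cpow D i x)) * (\<Sum>j\<le>N. s (1 / fact j) (cpow D j y))"
      by (simp add: sum_product g_def s_mult[symmetric] s_mult_right[symmetric] mult.commute)
    also have "\<dots> = Exp D x * Exp D y"
      using fcalc_eq[OF V, of x N "fps_exp 1"] fcalc_eq[OF V, of y N "fps_exp 1"]
      by (simp add: Exp_def N_def)
    finally show ?thesis .
  qed
  then show ?thesis
    using Exp_unit_functionals(1)[OF V] by (simp add: characters_def unit_functionals_def)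
qed

text \<open>The powers \<open>\<phi>\<^sup>n\<close> are characters and polynomial in \<open>n\<close> with linear coefficient \<open>Log \<phi>\<close>; hence
  multiplicativity of \<open>\<phi>\<^sup>n\<close> for all \<open>n\<close> is the derivation property in degree one in \<open>n\<close>.\<close>

lemma Log_infinitesimal:
  assumes \<phi>: "\<phi> \<in> characters H s"
  shows "Log \<phi> \<in> infinitesimal_characters H s"
proof (rule infinitesimalI)
  have U: "\<phi> \<in> unit_functionals H s"
    using \<phi> by (simp add: unit_functionals_def characters_def)
  note V = Log_van[OF U]
  show "Log \<phi> \<in> LH"
    using V by (rule van_LH)
  fix x y assume xy: "x \<in> carrier H" "y \<in> carrier H"
  \<comment> \<open>\<open>Suc\<close> makes \<open>N\<close> at least 1, so that the linear
    coefficient lies within the range of summation.\<close>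
  define N where "N = Suc (dbound x + dbound y + dbound (x \<otimes> y))"
  have NN: "dbound x \<le> N" "dbound y \<le> N" "dbound (x \<otimes> y) \<le> N"
    by (auto simp: N_def)
  \<comment> \<open>The coefficient of the \<open>j\<close>th power of \<open>n\<close> in
    \<open>cpow \<phi> n z\<close>; degree 0 gives \<open>eps\<close>, degree 1 gives
    \<open>Log \<phi>\<close>.\<close>
  define c where "c j z = s (1 / fact j) (cpow (Log \<phi>) j z)" for j z
  have p: "cpow \<phi> n z = (\<Sum>j\<le>N. s (of_nat n ^ j) (c j z))" if "dbound z \<le> N" for n z
    using fcalc_eq[OF V that, of "fps_exp (of_nat n)"]
    by (simp add: cpow_eq_fcalc_exp[OF U] c_def)
  have "c 1 (x \<otimes> y) = c 0 x * c 1 y + c 1 x * c 0 y"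
  \<comment> \<open>Linear forms on \<open>B\<close> turn the polynomials with values in
    \<open>B\<close> into scalar ones, whose coefficients can be compared.\<close>
  proof (rule linear_forms_eqI[OF vec_typ_module[OF vs]])
    fix l assume l: "linear_form (typ_module s) l"
    have l_sum: "l (\<Sum>i\<in>I. f i) = (\<Sum>i\<in>I. l (f i))" for I :: "nat set" and f
      using linear_form_zero[OF vec_typ_module[OF vs] l] l
      by (induction I rule: infinite_finite_induct) (auto simp: linear_form_typ_module)
    have l_s: "l (s r b) = r * l b" and l_add: "l (a + b) = l a + l b" for r a b
      using l by (auto simp: linear_form_typ_module)
    have "(\<Sum>j\<le>N. of_nat n ^ j * l (c j (x \<otimes> y))) =
        (\<Sum>i\<le>N. \<Sum>j\<le>N. of_nat n ^ (i + j) * l (c i x * c j y))" for n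
    proof -
      have "cpow \<phi> n (x \<otimes> y) = cpow \<phi> n x * cpow \<phi> n y"
        by (rule charactersD(3)[OF cpow_characters[OF \<phi>] xy])
      then have "(\<Sum>j\<le>N. s (of_nat n ^ j) (c j (x \<otimes> y))) =
          (\<Sum>i\<le>N. \<Sum>j\<le>N. s (of_nat n ^ (i + j)) (c i x * c j y))"
        by (simp add: p NN sum_product s_mult[symmetric] s_mult_right[symmetric] power_add mult.commute)
      from arg_cong[OF this, of l] show ?thesis
        by (simp add: l_sum l_s)
    qed
    from nat_polynomial_linear_coeff[OF this]
    show "l (c 1 (x \<otimes> y)) = l (c 0 x * c 1 y + c 1 x * c 0 y)"
      by (simp add: N_def l_add)
  qed auto
  then show "Log \<phi> (x \<otimes> y) = eps x * Log \<phi> y + Log \<phi> x * eps y"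
    by (simp add: c_def cpow_one[OF van_LH[OF V], simplified])
qed

text \<open>The negative of \<open>Log \<phi>\<close> is infinitesimal, so its exponential is a
  character. It is a right inverse of \<phi>, while composition with the antipode is a left inverse;
  the two coincide.\<close>

lemma inverse_char_characters:
  assumes \<phi>: "\<phi> \<in> characters H s"
  shows "inverse_char \<phi> \<in> characters H s"
proof -
  have U: "\<phi> \<in> unit_functionals H s"
    using \<phi> by (simp add: unit_functionals_def characters_def)
  note I = Log_infinitesimal[OF \<phi>] and L = charactersD(1)[OF \<phi>]
  have exp_minus: "fps_exp (1::'k) oo - fps_X = fps_exp (- 1)"
    by (simp add: fps_compose_uminus' fps_eq_iff)
  define \<psi> where "\<psi> = Exp (hom_scale s (- 1) (Log \<phi>))"
  have "hom_scale s (- 1) (Log \<phi>) \<in> infinitesimal_characters H s"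
    using infinitesimalD(1,2)[OF I]
    by (intro infinitesimalI LH_scale) (auto simp: hom_scale_def algebra_simps)
  then have \<psi>: "\<psi> \<in> characters H s"
    unfolding \<psi>_def by (rule Exp_characters)
  have "hom_scale s (- 1) (Log \<phi>) = fcalc (- fps_X) (Log \<phi>)"
    using fcalc_X[OF Log_van[OF U]] fcalc_diff[of 0 fps_X "Log \<phi>"]
    by (auto simp: hom_scale_def fcalc_def fun_eq_iff)
  then have "\<psi> = fcalc (fps_exp (- 1)) (Log \<phi>)"
    using fcalc_compose[OF Log_van[OF U], of "- fps_X" "fps_exp 1"] exp_minus
    by (simp add: \<psi>_def Exp_def)
  moreover have "\<phi> = fcalc (fps_exp 1) (Log \<phi>)"
    using Exp_Log[OF U] by (simp add: Exp_def)
  ultimately have "\<phi> \<star> \<psi> = fcalc (fps_exp 1 * fps_exp (- 1)) (Log \<phi>)"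
    using fcalc_mult[OF Log_van[OF U]] by metis
  then have "\<phi> \<star> \<psi> = eps"
    by (simp add: fps_exp_add_mult[symmetric] fcalc_one Log_van[OF U])
  then have "inverse_char \<phi> = \<psi>"
    using conv_left_inverse_unique[OF L inverse_char_LH[OF L] charactersD(1)[OF \<psi>]]
      inverse_char_conv(1)[OF \<phi>] by blast
  then show ?thesis
    using \<psi> by simp
qed

lemma Exp_annihilator:
  assumes "hopf_ideal H J" "D \<in> annihilator H J s" "D \<in> van (Suc 0)"
  shows "Exp D \<in> annihilator H J s"
  unfolding Exp_def by (rule fcalc_annihilator[OF assms])

lemma Log_annihilator:
  assumes "hopf_ideal H J" "\<phi> \<in> annihilator H J s" "\<phi> \<in> unit_functionals H s"
  shows "Log \<phi> \<in> annihilator H J s"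
  unfolding Log_def
  by (rule fcalc_annihilator[OF assms(1) annihilator_minus[OF assms(2) eps_annihilator[OF assms(1)]]
        unit_functionals_van[OF assms(3)]])

lemmas char_group_group = char_group_groupI(1)[OF inverse_char_characters]
  and char_group_inverse = char_group_groupI(2)[OF inverse_char_characters]

end

section \<open>Polynomial maps are analytic\<close>

lemma tendsto_binop:
  assumes "continuous_on UNIV (\<lambda>(x, y). f x y)" "(g \<longlongrightarrow> a) F" "(h \<longlongrightarrow> b) F"
  shows "((\<lambda>z. f (g z) (h z)) \<longlongrightarrow> f a b) F"
proof -
  from continuous_on_tendsto_compose[OF assms(1) tendsto_Pair[OF assms(2,3)]] show ?thesis
    by simp
qed

lemma continuous_on_binop:
  assumes "continuous_on UNIV (\<lambda>(x, y). f x y)" "continuous_on S g" "continuous_on S h"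
  shows "continuous_on S (\<lambda>z. f (g z) (h z))"
  using continuous_on_compose2[OF assms(1) continuous_on_Pair[OF assms(2,3)]] by simp

lemma tendsto_fun_iff:
  fixes f :: "'c \<Rightarrow> 'i \<Rightarrow> 'f::topological_space"
  shows "(f \<longlongrightarrow> l) F \<longleftrightarrow> (\<forall>i. ((\<lambda>z. f z i) \<longlongrightarrow> l i) F)"
proof -
  have "(f \<longlongrightarrow> l) F \<longleftrightarrow> limitin (product_topology (\<lambda>i. euclidean) UNIV) f l F"
    by (simp add: euclidean_product_topology)
  also have "\<dots> \<longleftrightarrow> (\<forall>i. ((\<lambda>z. f z i) \<longlongrightarrow> l i) F)"
    by (subst limitin_componentwise) simp
  finally show ?thesis .
qed

text \<open>Polynomials as syntax: derivatives are again expressions, and one expression can be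
  interpreted in several algebras. \<open>PVar i l\<close> is coordinate \<open>l\<close> of the
  \<open>i\<close>th vector variable.\<close>

datatype ('l, 'c) pexp = PZero | PCst 'c | PVar nat 'l
  | PAdd "('l, 'c) pexp" "('l, 'c) pexp" | PMul "('l, 'c) pexp" "('l, 'c) pexp"

primrec peval :: "('l \<Rightarrow> 'e \<Rightarrow> 'f) \<Rightarrow> ('c \<Rightarrow> 'f) \<Rightarrow> ('f \<Rightarrow> 'f \<Rightarrow> 'f) \<Rightarrow> ('l, 'c) pexp \<Rightarrow> (nat \<Rightarrow> 'e) \<Rightarrow> 'f::ab_group_add"
  where
  "peval ev cst mul PZero v = 0"
| "peval ev cst mul (PCst c) v = cst c"
| "peval ev cst mul (PVar i l) v = ev l (v i)"
| "peval ev cst mul (PAdd a b) v = peval ev cst mul a v + peval ev cst mul b v"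
| "peval ev cst mul (PMul a b) v = mul (peval ev cst mul a v) (peval ev cst mul b v)"

text \<open>Variable \<open>0\<close> is the base point.  Differentiation inserts the direction as variable \<open>1\<close>, so
  that earlier directions move up by one.\<close>

primrec pshift :: "('l, 'c) pexp \<Rightarrow> ('l, 'c) pexp" where
  "pshift PZero = PZero"
| "pshift (PCst c) = PCst c"
| "pshift (PVar i l) = PVar (case i of 0 \<Rightarrow> 0 | Suc j \<Rightarrow> Suc (Suc j)) l"
| "pshift (PAdd a b) = PAdd (pshift a) (pshift b)"
| "pshift (PMul a b) = PMul (pshift a) (pshift b)"

primrec pdiff :: "('l, 'c) pexp \<Rightarrow> ('l, 'c) pexp" where
  "pdiff PZero = PZero"
| "pdiff (PCst c) = PZero"
| "pdiff (PVar i l) = (case i of 0 \<Rightarrow> PVar (Suc 0) l | Suc j \<Rightarrow> PZero)"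
| "pdiff (PAdd a b) = PAdd (pdiff a) (pdiff b)"
| "pdiff (PMul a b) = PAdd (PMul (pdiff a) (pshift b)) (PMul (pshift a) (pdiff b))"

lemma peval_pshift:
  "peval ev cst mul (pshift e) (case_nat x (case_nat w r)) = peval ev cst mul e (case_nat x r)"
  by (induction e) (auto split: nat.splits)

definition psum :: "('l, 'c) pexp list \<Rightarrow> ('l, 'c) pexp" where
  "psum es = foldr PAdd es PZero"

lemma peval_psum: "peval ev cst mul (psum es) v = (\<Sum>e\<leftarrow>es. peval ev cst mul e v)"
  by (induction es) (auto simp: psum_def)

definition penv :: "'e \<Rightarrow> 'e list \<Rightarrow> nat \<Rightarrow> 'e::zero" where
  "penv x vs = case_nat x (\<lambda>n. if n < length vs then vs ! n else 0)"

lemma penv_Cons: "penv x (w # vs) = case_nat x (case_nat w (\<lambda>n. if n < length vs then vs ! n else 0))"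
  by (auto simp: penv_def fun_eq_iff split: nat.splits)

text \<open>Instantiated by functionals with values in \<open>B\<close>, by their complexification,
  and by a real line, on which coordinate \<open>l\<close> of the parameter \<open>r\<close> is
  \<open>r\<close> times \<open>v l\<close>.\<close>

locale pexp_eval = T: vector_space t
  for t :: "'k::real_normed_field \<Rightarrow> 'f \<Rightarrow> 'f::{ab_group_add, topological_space}" +
  fixes s :: "'k \<Rightarrow> 'e \<Rightarrow> 'e::{ab_group_add, topological_space}"
    and ev :: "'l \<Rightarrow> 'e \<Rightarrow> 'f" and cst :: "'c \<Rightarrow> 'f" and mul :: "'f \<Rightarrow> 'f \<Rightarrow> 'f"
  assumes add_cont: "continuous_on UNIV (\<lambda>(x, y). x + y :: 'f)"
    and t_cont: "continuous_on UNIV (\<lambda>(c, x). t c x)"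
    and mul_cont: "continuous_on UNIV (\<lambda>(x, y). mul x y)"
    and mul_add: "mul (x + y) z = mul x z + mul y z" "mul z (x + y) = mul z x + mul z y"
    and mul_t: "mul (t c x) y = t c (mul x y)" "mul x (t c y) = t c (mul x y)"
    and ev_add: "ev l (p + q) = ev l p + ev l q"
    and ev_s: "ev l (s c p) = t c (ev l p)"
    and ev_cont: "continuous_on UNIV (ev l)"
begin

abbreviation eval where "eval \<equiv> peval ev cst mul"

lemma mul_diff: "mul (x - y) z = mul x z - mul y z" "mul z (x - y) = mul z x - mul z y"
  using mul_add(1)[of "x - y" y z] mul_add(2)[of z "x - y" y] by (simp_all add: algebra_simps)

text \<open>Differentiability gives continuity: the difference quotient is multiplied by
  \<open>h\<close>, which tends to 0.\<close>

lemma eval_tendsto: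
  assumes "((\<lambda>h. t (inverse h) (f h - f0)) \<longlongrightarrow> d) (at 0)"
  shows "(f \<longlongrightarrow> f0) (at 0)"
proof -
  have 1: "((\<lambda>h. f0 + t h (t (inverse h) (f h - f0))) \<longlongrightarrow> f0 + t 0 d) (at 0)"
    by (intro tendsto_binop[OF add_cont] tendsto_binop[OF t_cont] tendsto_const tendsto_ident_at assms)
  have 2: "\<forall>\<^sub>F h in at 0. f0 + t h (t (inverse h) (f h - f0)) = f h"
    by (simp add: eventually_at_filter)
  from Lim_transform_eventually[OF 1 2] show ?thesis
    by simp
qed

lemma eval_has_derivative:
  "((\<lambda>h. t (inverse h) (eval e (case_nat (x + s h w) r) - eval e (case_nat x r)))
     \<longlongrightarrow> eval (pdiff e) (case_nat x (case_nat w r))) (at 0)"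
proof (induction e)
  case (PVar i l)
  show ?case
  proof (cases i)
    case 0
    have "\<forall>\<^sub>F h in at 0. ev l w = t (inverse h) (ev l (x + s h w) - ev l x)"
      by (rule eventually_at_filter[THEN iffD2]) (simp add: ev_add ev_s)
    from Lim_transform_eventually[OF tendsto_const this] show ?thesis
      using 0 by simp
  qed simp
next
  case (PAdd a b)
  have "t (inverse h) (eval (PAdd a b) (case_nat (x + s h w) r) - eval (PAdd a b) (case_nat x r)) =
      t (inverse h) (eval a (case_nat (x + s h w) r) - eval a (case_nat x r)) +
      t (inverse h) (eval b (case_nat (x + s h w) r) - eval b (case_nat x r))" for h
    by (simp add: T.scale_right_distrib[symmetric] add_diff_add)
  then show ?case
    using tendsto_binop[OF add_cont PAdd.IH] by simp
next
  case (PMul a b)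
  let ?q = "\<lambda>e h. t (inverse h) (eval e (case_nat (x + s h w) r) - eval e (case_nat x r))"
  \<comment> \<open>The product rule for difference quotients; the factor left at the moved point
    converges by \<open>eval_tendsto\<close>.\<close>
  have "?q (PMul a b) h = mul (?q a h) (eval b (case_nat (x + s h w) r)) +
      mul (eval a (case_nat x r)) (?q b h)" for h
    by (simp add: mul_t T.scale_right_distrib[symmetric] mul_diff)
  moreover have "((\<lambda>h. mul (?q a h) (eval b (case_nat (x + s h w) r)) +
      mul (eval a (case_nat x r)) (?q b h)) \<longlongrightarrow>
      mul (eval (pdiff a) (case_nat x (case_nat w r))) (eval b (case_nat x r)) +
      mul (eval a (case_nat x r)) (eval (pdiff b) (case_nat x (case_nat w r)))) (at 0)"
    by (intro tendsto_binop[OF add_cont] tendsto_binop[OF mul_cont] tendsto_const PMul.IH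
        eval_tendsto[OF PMul.IH(2)])
  ultimately show ?case
    by (simp add: peval_pshift)
qed auto

lemma continuous_on_eval: "continuous_on UNIV (\<lambda>v. eval e v)"
proof (induction e)
  case (PVar i l)
  show ?case
    using continuous_on_compose2[OF ev_cont[of l] continuous_on_product_coordinates[of i]] by simp
qed (auto intro: continuous_on_binop[OF add_cont] continuous_on_binop[OF mul_cont])

text \<open>The values of all coordinates are assembled by \<open>\<kappa>\<close>, which is the
  identity for functions into \<open>B\<close>. The complexification of a function space consists of
  pairs of functions instead of functions into pairs, and there \<open>\<kappa>\<close> is the
  passage between the two.\<close>

lemma C_map_polynomial:
  fixes u :: "'k \<Rightarrow> 'g \<Rightarrow> 'g::{ab_group_add, topological_space}" and \<kappa> :: "('i \<Rightarrow> 'f) \<Rightarrow> 'g"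
    and e :: "'i \<Rightarrow> ('l, 'c) pexp"
  assumes \<kappa>: "\<And>F G. \<kappa> (\<lambda>i. F i - G i) = \<kappa> F - \<kappa> G" "\<And>c F. \<kappa> (\<lambda>i. t c (F i)) = u c (\<kappa> F)"
      "continuous_on UNIV \<kappa>"
    and f: "\<And>x. x \<in> A \<Longrightarrow> f x = \<kappa> (\<lambda>i. eval (e i) (\<lambda>n. if n = 0 then x else 0))" "f ` A \<subseteq> B"
    and A: "\<And>x w c. x \<in> A \<Longrightarrow> w \<in> dir A \<Longrightarrow> x + s c w \<in> A"
    and B: "closed (dir B)" "\<And>x y. x \<in> dir B \<Longrightarrow> y \<in> dir B \<Longrightarrow> x - y \<in> dir B"
      "\<And>c x. x \<in> dir B \<Longrightarrow> u c x \<in> dir B"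
  shows "C_map r s u A B A f"
proof -
  define D where "D x vs = \<kappa> (\<lambda>i. eval ((pdiff ^^ length vs) (e i)) (penv x vs))" for x vs
  have "penv x [] = (\<lambda>n. if n = 0 then x else 0)" for x :: 'e
    by (auto simp: penv_def fun_eq_iff split: nat.splits)
  then have D0: "D x [] = f x" if "x \<in> A" for x
    using that by (simp add: D_def f(1))
  have lim: "((\<lambda>h. u (inverse h) (D (x + s h w) vs - D x vs)) \<longlongrightarrow> D x (w # vs)) (at 0)" for x w vs
  proof -
    let ?E = "\<lambda>i. (pdiff ^^ length vs) (e i)"
    have "((\<lambda>h i. t (inverse h) (eval (?E i) (penv (x + s h w) vs) - eval (?E i) (penv x vs)))
        \<longlongrightarrow> (\<lambda>i. eval (pdiff (?E i)) (penv x (w # vs)))) (at 0)"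
      unfolding tendsto_fun_iff penv_Cons unfolding penv_def
      using eval_has_derivative by blast
    from continuous_on_tendsto_compose[OF \<kappa>(3) this] show ?thesis
      by (simp add: D_def \<kappa>(1,2))
  qed
  \<comment> \<open>A derivative lies in the closed space \<open>dir B\<close> as a limit of
    difference quotients: of values in \<open>B\<close> at order one, of earlier derivatives
    afterwards.\<close>
  have mem: "D x (w # vs) \<in> dir B" if "x \<in> A" "w \<in> dir A" "set vs \<subseteq> dir A" for x w vs
    using that
  proof (induction vs arbitrary: x w)
    case Nil
    have "u (inverse h) (D (x + s h w) [] - D x []) \<in> dir B" for h
    proof -
      have "f (x + s h w) \<in> B" "f x \<in> B"
        using f(2) Nil A by auto
      then have "f (x + s h w) - f x \<in> dir B"
        unfolding dir_def by blast
      then show ?thesis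
        using Nil A B(3) by (simp add: D0)
    qed
    then show ?case
      by (intro Lim_in_closed_set[OF B(1) _ _ lim[of x w "[]"]]) auto
  next
    case (Cons v vs)
    have "u (inverse h) (D (x + s h w) (v # vs) - D x (v # vs)) \<in> dir B" for h
      using Cons.prems by (intro B(2,3) Cons.IH A) auto
    then show ?case
      by (intro Lim_in_closed_set[OF B(1) _ _ lim[of x w "v # vs"]]) auto
  qed
  have cont: "continuous_on S (\<lambda>(x, v). D x (map v [0..<k]))" for k S
  proof -
    have "penv x (map v [0..<k]) = case_nat x (\<lambda>n. if n < k then v n else 0)" for x and v :: "nat \<Rightarrow> 'e"
      by (auto simp: penv_def fun_eq_iff split: nat.splits)
    then have eq: "(\<lambda>(x, v). D x (map v [0..<k])) =
        (\<lambda>p. \<kappa> (\<lambda>i. eval ((pdiff ^^ k) (e i)) (case_nat (fst p) (\<lambda>n. if n < k then snd p n else 0))))"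
      by (simp add: D_def split_def)
    have "continuous_on UNIV (\<lambda>p :: 'e \<times> (nat \<Rightarrow> 'e). case_nat (fst p) (\<lambda>n. if n < k then snd p n else 0))"
    proof (rule continuous_on_coordinatewise_then_product)
      fix i
      have "continuous_on UNIV (\<lambda>p :: 'e \<times> (nat \<Rightarrow> 'e). snd p n)" for n
        by (rule continuous_on_product_then_coordinatewise[OF continuous_on_snd[OF continuous_on_id]])
      then show "continuous_on UNIV (\<lambda>p :: 'e \<times> (nat \<Rightarrow> 'e). (case i of 0 \<Rightarrow> fst p | Suc n \<Rightarrow> if n < k then snd p n else 0))"
        by (cases i; cases "i - 1 < k") (auto intro: continuous_on_fst continuous_on_id continuous_on_const)
    qed
    then have "continuous_on UNIV (\<lambda>p :: 'e \<times> (nat \<Rightarrow> 'e).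
        eval E (case_nat (fst p) (\<lambda>n. if n < k then snd p n else 0)))" for E
      using continuous_on_compose2[OF continuous_on_eval] by auto
    then have "continuous_on UNIV (\<lambda>(x, v). D x (map v [0..<k]))"
      unfolding eq
      by (intro continuous_on_compose2[OF \<kappa>(3)] continuous_on_coordinatewise_then_product) auto
    then show ?thesis
      by (rule continuous_on_subset) simp
  qed
  show ?thesis
    unfolding C_map_def
    using f(2) D0 lim mem cont by (intro conjI exI[of _ D]) auto
qed

end

lemma C_map_subset:
  assumes "C_map r s t A B U f" "U' \<subseteq> U" "openin (top_of_set A) U'"
  shows "C_map r s t A B U' f"
proof -
  from assms(1) obtain D where D: "\<forall>x\<in>U. D x [] = f x"
    "\<forall>x\<in>U. \<forall>vs. \<forall>w\<in>dir A. set vs \<subseteq> dir A \<and> enat (length vs) < r \<longrightarrow>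
       D x (w # vs) \<in> dir B \<and>
       ((\<lambda>h. t (inverse h) (D (x + s h w) vs - D x vs)) \<longlongrightarrow> D x (w # vs)) (at 0)"
    "\<forall>k. enat k \<le> r \<longrightarrow> continuous_on (U \<times> {v. range v \<subseteq> dir A}) (\<lambda>(x, v). D x (map v [0..<k]))"
    unfolding C_map_def by blast
  have "continuous_on (U' \<times> {v. range v \<subseteq> dir A}) (\<lambda>(x, v). D x (map v [0..<k]))" if "enat k \<le> r" for k
    using D(3) that assms(2) by (meson Sigma_mono continuous_on_subset order_refl)
  then show ?thesis
    using assms D(1,2) unfolding C_map_def
    by (intro conjI exI[of _ D]) blast+
qed

section \<open>Evaluation in \<open>B\<close> and in its complexification\<close>

lemma locally_convex_algebraD:
  fixes s :: "'k::real_or_complex \<Rightarrow> 'b \<Rightarrow> 'b::{comm_ring, comm_monoid_mult, t2_space}"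
  assumes "locally_convex_algebra s"
  shows "vector_space s" "s c (x * y) = s c x * y"
    "continuous_on UNIV (\<lambda>(x, y). x + y :: 'b)" "continuous_on UNIV (\<lambda>(c, x). s c x)"
    "continuous_on UNIV (\<lambda>(x, y). x * y :: 'b)"
  using assms by (auto simp: locally_convex_algebra_def locally_convex_space_def)

text \<open>Multiplication of the complexified algebra, a pair standing for its real and imaginary
  parts.\<close>

definition cmul :: "'b \<times> 'b \<Rightarrow> 'b \<times> 'b \<Rightarrow> 'b \<times> 'b::comm_ring" where
  "cmul x y = (fst x * fst y - snd x * snd y, fst x * snd y + snd x * fst y)"

definition cev :: "'l \<Rightarrow> ('l \<Rightarrow> 'b) \<times> ('l \<Rightarrow> 'b) \<Rightarrow> 'b \<times> 'b" where
  "cev l p = (fst p l, snd p l)"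

abbreviation revl :: "('l, 'b) pexp \<Rightarrow> ('l \<Rightarrow> 'b) \<Rightarrow> 'b::comm_ring" where
  "revl e \<phi> \<equiv> peval (\<lambda>l \<phi>. \<phi> l) (\<lambda>c. c) (*) e (\<lambda>n. if n = 0 then \<phi> else 0)"

abbreviation cevl :: "('l, 'b) pexp \<Rightarrow> ('l \<Rightarrow> 'b) \<times> ('l \<Rightarrow> 'b) \<Rightarrow> 'b \<times> 'b::comm_ring" where
  "cevl e p \<equiv> peval cev (\<lambda>c. (c, 0)) cmul e (\<lambda>n. if n = 0 then p else 0)"

text \<open>Constants, and coordinates of real points, have imaginary part zero; hence the extension
  restricts to the given map.\<close>

lemma cevl_real: "cevl e (\<phi>, 0) = (revl e \<phi>, 0)"
  by (induction e) (auto simp: cmul_def cev_def zero_prod_def)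

context
  fixes s :: "'k::real_or_complex \<Rightarrow> 'b \<Rightarrow> 'b::{comm_ring, comm_monoid_mult, t2_space}"
  assumes lca: "locally_convex_algebra s"
begin

interpretation S: vector_space s
  by (rule locally_convex_algebraD[OF lca])

lemmas lca_cont = locally_convex_algebraD(3-5)[OF lca]

lemma lca_mult: "s c x * y = s c (x * y)" "x * s c y = s c (x * y)"
  using locally_convex_algebraD(2)[OF lca] by (metis mult.commute)+

lemma lca_diff_cont: "continuous_on UNIV (\<lambda>(x, y). x - y :: 'b)"
proof -
  have "continuous_on UNIV (\<lambda>p :: 'b \<times> 'b. fst p + s (- 1) (snd p))"
    by (intro continuous_on_binop[OF lca_cont(1)] continuous_on_binop[OF lca_cont(2)]
        continuous_intros continuous_on_fst continuous_on_snd)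
  then show ?thesis
    by (simp add: split_def)
qed

lemma pexp_eval_plain: "pexp_eval s (hom_scale s) (\<lambda>l \<phi>. \<phi> l) (*)"
  by unfold_locales
    (auto simp: lca_cont hom_scale_def lca_mult distrib_left distrib_right)

lemma vector_space_of_real: "vector_space (\<lambda>r. s (of_real r))"
  by unfold_locales (auto simp: S.scale_left_distrib S.scale_right_distrib)

lemma pexp_eval_curve:
  "pexp_eval (\<lambda>r. s (of_real r)) (*) (\<lambda>l r. s (of_real r) (v l)) ((*) :: 'b \<Rightarrow> _)"
proof -
  interpret R: vector_space "\<lambda>r. s (of_real r)" by (rule vector_space_of_real)
  have 1: "continuous_on UNIV (\<lambda>(r, x). s (of_real r) x)"
    unfolding split_def
    by (intro continuous_on_binop[OF lca_cont(2)] continuous_on_of_real continuous_on_fst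
        continuous_on_snd continuous_on_id)
  have 2: "continuous_on UNIV (\<lambda>r. s (of_real r) (v l))" for l
    by (intro continuous_on_binop[OF lca_cont(2)] continuous_on_of_real continuous_on_id
        continuous_on_const)
  show ?thesis
    by unfold_locales
      (auto simp: lca_cont 1 2 lca_mult distrib_left distrib_right S.scale_left_distrib)
qed

lemma vector_space_complexify:
  fixes s' :: "'k \<Rightarrow> 'd \<Rightarrow> 'd::ab_group_add"
  assumes "vector_space s'"
  shows "vector_space (complexify s')"
proof -
  interpret S': vector_space s' by (rule assms)
  show ?thesis
    by unfold_locales
      (auto simp: complexify_def S'.scale_left_distrib S'.scale_right_distrib
        S'.scale_left_diff_distrib S'.scale_right_diff_distrib algebra_simps)
qed

lemma complexify_cont: "continuous_on UNIV (\<lambda>(z, x). complexify s z x)"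
  unfolding complexify_def split_def
  by (intro continuous_on_Pair continuous_on_binop[OF lca_cont(1)] continuous_on_binop[OF lca_diff_cont]
      continuous_on_binop[OF lca_cont(2)] continuous_intros)

lemma pexp_eval_complexify:
  "pexp_eval (complexify s) (complexify (hom_scale s)) cev cmul"
proof -
  interpret R: vector_space "complexify s"
    by (rule vector_space_complexify[OF S.vector_space_axioms])
  have 1: "continuous_on UNIV (\<lambda>(x, y). x + y :: 'b \<times> 'b)"
    unfolding plus_prod_def split_def
    by (intro continuous_on_Pair continuous_on_binop[OF lca_cont(1)] continuous_intros)
  have 2: "continuous_on UNIV (\<lambda>(x, y). cmul x y :: 'b \<times> 'b)"
    unfolding cmul_def split_def
    by (intro continuous_on_Pair continuous_on_binop[OF lca_cont(1)] continuous_on_binop[OF lca_diff_cont]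
        continuous_on_binop[OF lca_cont(3)] continuous_intros)
  have 3: "continuous_on UNIV (cev l :: _ \<Rightarrow> 'b \<times> 'b)" for l :: 'l
    unfolding cev_def
    by (intro continuous_on_Pair continuous_on_product_then_coordinatewise[OF continuous_on_fst]
        continuous_on_product_then_coordinatewise[OF continuous_on_snd] continuous_on_id)
  show ?thesis
    by (unfold_locales;
      (rule 1 2 3 complexify_cont | auto simp: cmul_def cev_def complexify_def hom_scale_def lca_mult
        S.scale_right_distrib S.scale_right_diff_distrib algebra_simps))
qed

definition lin_closed :: "('x \<Rightarrow> 'b) set \<Rightarrow> bool" where
  "lin_closed L \<longleftrightarrow> 0 \<in> L \<and> (\<forall>x\<in>L. \<forall>y\<in>L. x + y \<in> L) \<and> (\<forall>c. \<forall>x\<in>L. hom_scale s c x \<in> L) \<and> closed L"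

lemma lin_closed_minus:
  assumes "lin_closed L" "x \<in> L" "y \<in> L"
  shows "x - y \<in> L"
proof -
  have "x + hom_scale s (- 1) y \<in> L"
    using assms by (simp add: lin_closed_def)
  moreover have "x + hom_scale s (- 1) y = x - y"
    by (auto simp: hom_scale_def)
  ultimately show ?thesis by simp
qed

lemma dir_lin_closed: "lin_closed L \<Longrightarrow> dir L = L"
proof -
  assume L: "lin_closed L"
  have "x \<in> dir L" if "x \<in> L" for x
  proof -
    have "x = x - 0" "0 \<in> L"
      using L by (auto simp: lin_closed_def)
    then show ?thesis
      using that unfolding dir_def by blast
  qed
  then show ?thesis
    using lin_closed_minus[OF L] by (auto simp: dir_def)
qed

lemma dir_Times: "dir (A \<times> B) = dir A \<times> dir B"
  unfolding dir_def by (auto simp: image_iff)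

text \<open>The expressions represent \<open>f\<close> on \<open>A\<close> only, so the last
  hypothesis must state separately that their complexified values lie in the complexification of the
  affine space \<open>B\<close>. Over the reals the extension is the pair of real and imaginary
  parts of these values.\<close>

lemma analytic_map_polynomial:
  fixes A :: "('x \<Rightarrow> 'b) set" and B :: "('i \<Rightarrow> 'b) set" and e :: "'i \<Rightarrow> ('x, 'b) pexp"
  assumes A: "lin_closed (dir A)" "\<And>x w. x \<in> A \<Longrightarrow> w \<in> dir A \<Longrightarrow> x + w \<in> A"
    and B: "lin_closed (dir B)"
    and f: "\<And>\<phi>. \<phi> \<in> A \<Longrightarrow> f \<phi> = (\<lambda>i. revl (e i) \<phi>)" "f ` A \<subseteq> B"
    and c: "\<And>\<phi> \<psi>. \<phi> \<in> A \<Longrightarrow> \<psi> \<in> dir A \<Longrightarrow>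
      (\<lambda>i. fst (cevl (e i) (\<phi>, \<psi>))) \<in> B \<and> (\<lambda>i. snd (cevl (e i) (\<phi>, \<psi>))) \<in> dir B"
  shows "analytic_map (hom_scale s) (hom_scale s) A B A f"
proof -
  interpret P: pexp_eval s "hom_scale s" "\<lambda>l \<phi>. \<phi> l" "\<lambda>c. c" "(*)"
    by (rule pexp_eval_plain)
  interpret C: pexp_eval "complexify s" "complexify (hom_scale s)" cev "\<lambda>c. (c, 0)" cmul
    by (rule pexp_eval_complexify)
  have plain: "C_map \<infinity> (hom_scale s) (hom_scale s) A B A f"
  proof (rule P.C_map_polynomial[where \<kappa> = "\<lambda>F. F" and e = e])
    show "x + hom_scale s c w \<in> A" if "x \<in> A" "w \<in> dir A" for x w c
      using A that by (auto simp: lin_closed_def)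
    show "closed (dir B)"
      using B by (simp add: lin_closed_def)
    show "x - y \<in> dir B" if "x \<in> dir B" "y \<in> dir B" for x y
      using lin_closed_minus[OF B that] .
    show "hom_scale s c x \<in> dir B" if "x \<in> dir B" for x c
      using B that by (auto simp: lin_closed_def)
  qed (use f in \<open>auto simp: hom_scale_def fun_diff_def continuous_on_id\<close>)
  show ?thesis
  proof (cases "A = {}")
    case True
    then have "C_map \<infinity> (complexify (hom_scale s)) (complexify (hom_scale s)) (A \<times> dir A) (B \<times> dir B) {} (\<lambda>_. 0)"
      by (auto simp: C_map_def)
    then show ?thesis
      using plain True unfolding analytic_map_def by auto
  next
    case False
    define f' where "f' p = (\<lambda>i. fst (cevl (e i) p), \<lambda>i. snd (cevl (e i) p))" for p
    have 0: "0 \<in> dir A" "0 \<in> dir B"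
      using A(1) B by (auto simp: lin_closed_def)
    have dA: "dir (A \<times> dir A) = dir A \<times> dir A"
      by (simp add: dir_Times dir_lin_closed[OF A(1)])
    have dB: "dir (B \<times> dir B) = dir B \<times> dir B"
      by (simp add: dir_Times dir_lin_closed[OF B])
    have lin: "hom_scale s c x - hom_scale s d y \<in> dir L" "hom_scale s c x + hom_scale s d y \<in> dir L"
      if "lin_closed (dir L)" "x \<in> dir L" "y \<in> dir L" for c d x y and L :: "('z \<Rightarrow> 'b) set"
      using that lin_closed_minus[OF that(1)] by (auto simp: lin_closed_def)
    have "C_map \<infinity> (complexify (hom_scale s)) (complexify (hom_scale s))
        (A \<times> dir A) (B \<times> dir B) (A \<times> dir A) f'"
    proof (rule C.C_map_polynomial[where \<kappa> = "\<lambda>F. (\<lambda>i. fst (F i), \<lambda>i. snd (F i))" and e = e])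
      show "f' ` (A \<times> dir A) \<subseteq> B \<times> dir B"
        using c by (auto simp: f'_def)
      show "x + complexify (hom_scale s) z w \<in> A \<times> dir A"
        if "x \<in> A \<times> dir A" "w \<in> dir (A \<times> dir A)" for x w z
        using that A lin[OF A(1)] unfolding dA
        by (auto simp: complexify_def lin_closed_def)
      show "closed (dir (B \<times> dir B))"
        using B unfolding dB by (auto simp: lin_closed_def intro: closed_Times)
      show "x - y \<in> dir (B \<times> dir B)" if "x \<in> dir (B \<times> dir B)" "y \<in> dir (B \<times> dir B)" for x y
        using that lin_closed_minus[OF B] unfolding dB by auto
      show "complexify (hom_scale s) z x \<in> dir (B \<times> dir B)" if "x \<in> dir (B \<times> dir B)" for x z
        using that lin[OF B] unfolding dB by (auto simp: complexify_def)
      have "continuous_on UNIV (\<lambda>F :: 'i \<Rightarrow> 'b \<times> 'b. F i)" for i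
        by (rule continuous_on_product_coordinates)
      then show "continuous_on UNIV (\<lambda>F :: 'i \<Rightarrow> 'b \<times> 'b. (\<lambda>i. fst (F i), \<lambda>i. snd (F i)))"
        by (intro continuous_on_Pair continuous_on_coordinatewise_then_product)
          (auto intro: continuous_on_fst continuous_on_snd)
    qed (auto simp: f'_def complexify_def hom_scale_def fun_eq_iff split_def)
    moreover have "\<forall>x\<in>A. f' (x, 0) = (f x, 0)"
      by (simp add: f'_def cevl_real f(1)) (simp add: zero_fun_def)
    moreover have "A \<times> {0} \<subseteq> A \<times> dir A"
      using 0 by auto
    ultimately show ?thesis
      using plain f(2) unfolding analytic_map_def
      by (auto intro!: exI[of _ "A \<times> dir A"] exI[of _ f'])
  qed
qed

end

section \<open>Character groups as submanifolds\<close>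

lemma C_map_cong:
  assumes "C_map r s t A B U f" "\<And>x. x \<in> U \<Longrightarrow> f x = g x"
  shows "C_map r s t A B U g"
proof -
  have 1: "f ` U = g ` U"
    using assms(2) by auto
  have 2: "(\<forall>x\<in>U. D x [] = f x) \<longleftrightarrow> (\<forall>x\<in>U. D x [] = g x)" for D
    using assms(2) by auto
  show ?thesis
    using assms(1) unfolding C_map_def 1 2 .
qed

lemma analytic_map_cong:
  assumes "analytic_map s t A B U f" "\<And>x. x \<in> U \<Longrightarrow> f x = g x"
  shows "analytic_map s t A B U g"
proof (cases "\<exists>i::'a. i * i = - 1")
  case True
  then show ?thesis
    using assms C_map_cong[OF _ assms(2)] unfolding analytic_map_def by auto
next
  case False
  then have "openin (top_of_set A) U" "f ` U \<subseteq> B"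
    and "\<exists>U' f'. U \<times> {0} \<subseteq> U' \<and> (\<forall>x\<in>U. f' (x, 0) = (f x, 0)) \<and>
           C_map \<infinity> (complexify s) (complexify t) (A \<times> dir A) (B \<times> dir B) U' f'"
    using assms(1) unfolding analytic_map_def by auto
  then obtain U' f' where *: "U \<times> {0} \<subseteq> U'" "\<forall>x\<in>U. f' (x, 0) = (f x, 0)"
    "C_map \<infinity> (complexify s) (complexify t) (A \<times> dir A) (B \<times> dir B) U' f'"
    by blast
  have "\<forall>x\<in>U. f' (x, 0) = (g x, 0)" "g ` U \<subseteq> B"
    using *(2) assms(2) \<open>f ` U \<subseteq> B\<close> by auto
  then show ?thesis
    using False * \<open>openin (top_of_set A) U\<close> unfolding analytic_map_def by auto
qed

lemma fst_sum_list: "fst (\<Sum>p\<leftarrow>xs. f p) = (\<Sum>p\<leftarrow>xs. fst (f p))"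
  and snd_sum_list: "snd (\<Sum>p\<leftarrow>xs. f p) = (\<Sum>p\<leftarrow>xs. snd (f p))"
  by (induction xs) auto

lemma sum_list_upt: "(\<Sum>k\<leftarrow>[0..<Suc n]. f k) = (\<Sum>k\<le>n. f k :: 'c::comm_monoid_add)"
  by (simp add: interv_sum_list_conv_sum_set_nat atLeast0LessThan lessThan_Suc_atMost del: upt_Suc)

section \<open>Convolution powers and series as polynomial expressions\<close>

context conv_alg
begin

text \<open>The recursion of \<open>cpow\<close> on the level of expressions, \<open>g a\<close>
  being an expression for the value at \<open>a\<close> of the functional whose powers are
  taken.\<close>

primrec wexp :: "('a \<Rightarrow> ('a, 'b) pexp) \<Rightarrow> nat \<Rightarrow> 'a \<Rightarrow> ('a, 'b) pexp" where
  "wexp g 0 = (\<lambda>x. PCst (eps x))"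
| "wexp g (Suc k) = (\<lambda>x. if x \<in> carrier H
     then psum (map (\<lambda>p. PMul (g (fst p)) (wexp g k (snd p))) (cop x)) else PZero)"

lemma revl_wexp:
  assumes \<rho>: "\<rho> \<in> LH" "\<And>a. a \<in> carrier H \<Longrightarrow> peval ev (\<lambda>c. c) (*) (g a) v = \<rho> a"
  shows "peval ev (\<lambda>c. c) (*) (wexp g k x) v = cpow \<rho> k x"
proof (induction k arbitrary: x)
  case (Suc k)
  show ?case
    using cop_carrier[of x]
    by (auto simp: peval_psum o_def Suc.IH \<rho>(2) conv_cop[OF \<rho>(1) cpow_LH[OF \<rho>(1)]]
        LH_outside[OF conv_LH[OF \<rho>(1) cpow_LH[OF \<rho>(1)]]] cong: map_cong)
qed simp

text \<open>Real and imaginary parts of the convolution powers of \<open>\<rho> + i \<tau>\<close>.\<close>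

primrec cpow2 :: "('a \<Rightarrow> 'b) \<Rightarrow> ('a \<Rightarrow> 'b) \<Rightarrow> nat \<Rightarrow> ('a \<Rightarrow> 'b) \<times> ('a \<Rightarrow> 'b)" where
  "cpow2 \<rho> \<tau> 0 = (eps, 0)"
| "cpow2 \<rho> \<tau> (Suc k) = (\<rho> \<star> fst (cpow2 \<rho> \<tau> k) - \<tau> \<star> snd (cpow2 \<rho> \<tau> k),
     \<rho> \<star> snd (cpow2 \<rho> \<tau> k) + \<tau> \<star> fst (cpow2 \<rho> \<tau> k))"

lemma cpow2_LH: "\<rho> \<in> LH \<Longrightarrow> \<tau> \<in> LH \<Longrightarrow> fst (cpow2 \<rho> \<tau> k) \<in> LH \<and> snd (cpow2 \<rho> \<tau> k) \<in> LH"
  by (induction k) (auto intro: eps_LH LH_zero LH_plus LH_minus conv_LH)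

lemma cevl_wexp:
  assumes \<rho>: "\<rho> \<in> LH" "\<tau> \<in> LH" "\<And>a. a \<in> carrier H \<Longrightarrow> cevl (g a) p = (\<rho> a, \<tau> a)"
  shows "cevl (wexp g k x) p = (fst (cpow2 \<rho> \<tau> k) x, snd (cpow2 \<rho> \<tau> k) x)"
proof (induction k arbitrary: x)
  case (Suc k)
  note L = conjunct1[OF cpow2_LH[OF \<rho>(1,2)]] conjunct2[OF cpow2_LH[OF \<rho>(1,2)]]
  show ?case
  proof (cases "x \<in> carrier H")
    case True
    then have eq: "cevl (wexp g (Suc k) x) p =
        (\<Sum>r\<leftarrow>cop x. cmul (\<rho> (fst r), \<tau> (fst r)) (fst (cpow2 \<rho> \<tau> k) (snd r), snd (cpow2 \<rho> \<tau> k) (snd r)))"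
      using cop_carrier[OF True] by (simp add: peval_psum o_def Suc.IH \<rho>(3) cong: map_cong)
    show ?thesis
      unfolding eq using True
      by (intro prod_eqI) (simp_all add: fst_sum_list snd_sum_list cmul_def conv_cop \<rho>(1,2) L
          sum_list_subtractf sum_list_addf)
  next
    case False
    then show ?thesis
      by (simp add: zero_prod_def conv_outside)
  qed
qed simp

end

context graded_conv_alg
begin

text \<open>Expressions have no scalar multiplication; a coefficient enters as the constant given by
  that multiple of the unit of \<open>B\<close>.\<close>

definition fexp :: "'k fps \<Rightarrow> ('a \<Rightarrow> ('a, 'b) pexp) \<Rightarrow> 'a \<Rightarrow> ('a, 'b) pexp" where
  "fexp F g x = psum (map (\<lambda>k. PMul (PCst (s (fps_nth F k) 1)) (wexp g k x)) [0..<Suc (dbound x)])"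

lemma revl_fexp:
  assumes "\<rho> \<in> LH" "\<And>a. a \<in> carrier H \<Longrightarrow> peval ev (\<lambda>c. c) (*) (g a) v = \<rho> a"
  shows "peval ev (\<lambda>c. c) (*) (fexp F g x) v = fcalc F \<rho> x"
  unfolding fexp_def peval_psum map_map o_def sum_list_upt fcalc_def
  by (simp add: revl_wexp[OF assms] s_mult[symmetric])

lemma cpow2_van:
  assumes "\<rho> \<in> van (Suc 0)" "\<tau> \<in> van (Suc 0)"
  shows "fst (cpow2 \<rho> \<tau> k) \<in> van k" "snd (cpow2 \<rho> \<tau> k) \<in> van k"
proof -
  have "fst (cpow2 \<rho> \<tau> k) \<in> van k \<and> snd (cpow2 \<rho> \<tau> k) \<in> van k"
  proof (induction k)
    case 0
    then show ?case by (simp add: van_def eps_LH LH_zero[unfolded zero_fun_def])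
  next
    case (Suc k)
    have pm: "\<phi> + \<psi> \<in> van n" "\<phi> - \<psi> \<in> van n" if "\<phi> \<in> van n" "\<psi> \<in> van n" for \<phi> \<psi> n
      using that by (auto simp: van_def LH_plus LH_minus)
    then show ?case
      unfolding cpow2.simps fst_conv snd_conv
      using conv_van[of _ "Suc 0" _ k] assms Suc by (intro conjI pm) simp_all
  qed
  then show "fst (cpow2 \<rho> \<tau> k) \<in> van k" "snd (cpow2 \<rho> \<tau> k) \<in> van k"
    by auto
qed

text \<open>Shows that complexified series stay in the complexified affine space. The parts
  \<open>R\<close> and \<open>I\<close> are series adapted to the filtration by degree, hence linear
  functionals, and at the unit only the constant coefficient survives.\<close>

lemma cevl_fexp:
  fixes F :: "'k fps"
  assumes \<rho>: "\<rho> \<in> van (Suc 0)" "\<tau> \<in> van (Suc 0)"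
    and g: "\<And>a. a \<in> carrier H \<Longrightarrow> cevl (g a) p = (\<rho> a, \<tau> a)"
  defines "R \<equiv> \<lambda>x. fst (cevl (fexp F g x) p)" and "I \<equiv> \<lambda>x. snd (cevl (fexp F g x) p)"
  shows "R \<in> LH" "I \<in> LH" "R \<one> = s (fps_nth F 0) 1" "I \<one> = 0"
proof -
  have R: "R = (\<lambda>x. \<Sum>k\<le>dbound x. s (fps_nth F k) (fst (cpow2 \<rho> \<tau> k) x))"
    and I: "I = (\<lambda>x. \<Sum>k\<le>dbound x. s (fps_nth F k) (snd (cpow2 \<rho> \<tau> k) x))"
    unfolding R_def I_def fexp_def peval_psum map_map o_def fst_sum_list snd_sum_list sum_list_upt
    by (simp_all add: cevl_wexp[OF van_LH[OF \<rho>(1)] van_LH[OF \<rho>(2)] g] cmul_def s_mult[symmetric] fst_sum snd_sum)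
  show "R \<in> LH"
    unfolding R by (rule van_series_LH[OF cpow2_van(1)[OF \<rho>]])
  show "I \<in> LH"
    unfolding I by (rule van_series_LH[OF cpow2_van(2)[OF \<rho>]])
  show "R \<one> = s (fps_nth F 0) 1"
    unfolding R by (subst van_series_one[OF cpow2_van(1)[OF \<rho>]]) (simp add: eps_one)
  show "I \<one> = 0"
    unfolding I by (subst van_series_one[OF cpow2_van(2)[OF \<rho>]]) simp
qed

end

section \<open>The logarithm as a global chart\<close>

lemma closed_Int_Collect: "closed A \<Longrightarrow> closed {x. P x} \<Longrightarrow> closed {x \<in> A. P x}"
  by (simp add: closed_Int Collect_conj_eq)

locale lca_hopf = graded_conv_alg H s Hn
  for H :: "('k::real_or_complex, 'a) hopf" (structure)
    and s :: "'k \<Rightarrow> 'b \<Rightarrow> 'b::{comm_ring, comm_monoid_mult, t2_space}" and Hn +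
  assumes lca: "locally_convex_algebra s"
begin

abbreviation "hs \<equiv> hom_scale s"
abbreviation "UF \<equiv> unit_functionals H s"
abbreviation "V1 \<equiv> van (Suc 0)"
abbreviation "infs \<equiv> infinitesimal_characters H s"

lemma s_cont: "continuous_on UNIV f \<Longrightarrow> continuous_on UNIV (\<lambda>x. s c (f x))"
  using continuous_on_binop[OF locally_convex_algebraD(4)[OF lca] continuous_on_const] by blast

lemma add_cont: "continuous_on UNIV f \<Longrightarrow> continuous_on UNIV g \<Longrightarrow> continuous_on UNIV (\<lambda>x. f x + g x :: 'b)"
  by (rule continuous_on_binop[OF locally_convex_algebraD(3)[OF lca]])

lemma mul_cont: "continuous_on UNIV f \<Longrightarrow> continuous_on UNIV g \<Longrightarrow> continuous_on UNIV (\<lambda>x. f x * g x :: 'b)"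
  by (rule continuous_on_binop[OF locally_convex_algebraD(5)[OF lca]])

lemma coord_cont: "continuous_on UNIV (\<lambda>\<phi> :: 'a \<Rightarrow> 'b. \<phi> x)"
  by (rule continuous_on_product_coordinates)

lemmas closed_rules = closed_Collect_all closed_Collect_imp closed_Collect_conj open_Collect_const
  closed_Collect_eq s_cont add_cont mul_cont coord_cont continuous_on_const

lemma closed_LH: "closed LH"
  unfolding lin_hom_def Ball_def by (intro closed_rules)

lemma closed_van: "closed (van k)"
proof -
  have "van k = LH \<inter> (\<Inter>j\<in>{..<k}. \<Inter>x\<in>Hn j. {\<phi>. \<phi> x = 0})"
    by (auto simp: van_def)
  also have "closed \<dots>"
    by (intro closed_Int closed_LH closed_INT ballI closed_Collect_eq coord_cont continuous_on_const)
  finally show ?thesis .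
qed

lemma closed_infinitesimal: "closed infs"
  unfolding infinitesimal_characters_def Ball_def by (intro closed_Int_Collect closed_LH closed_rules)

lemma closed_annihilator: "closed (annihilator H J s)"
  unfolding annihilator_def Ball_def by (intro closed_Int_Collect closed_LH closed_rules)

lemma lin_closed_van: "lin_closed s (van k)"
  by (simp add: lin_closed_def[OF lca] closed_van)
    (auto simp: van_def LH_zero LH_plus hom_scale_def LH_scale[unfolded hom_scale_def])

lemma lin_closed_infinitesimal: "lin_closed s infs"
  by (auto simp: lin_closed_def[OF lca] closed_infinitesimal)
    (auto simp: infinitesimal_characters_def LH_zero LH_plus LH_scale hom_scale_def
      B.scale_right_distrib algebra_simps LH_scale[unfolded hom_scale_def] mult.commute)

lemma lin_closed_annihilator: "lin_closed s (annihilator H J s \<inter> infs)"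
  using lin_closed_infinitesimal closed_annihilator[of J]
  by (auto simp: lin_closed_def[OF lca] annihilator_def LH_zero LH_plus LH_scale)
    (auto simp: hom_scale_def)

text \<open>\<open>UF\<close> is the translate of \<open>V1\<close> by \<open>eps\<close>.\<close>

lemma dir_UF: "dir UF = V1"
proof -
  have "v \<in> dir UF" if "v \<in> V1" for v
  proof -
    have "v + eps \<in> UF" "eps \<in> UF"
      using that by (auto simp: van_1_iff unit_functionals_def LH_plus eps_LH eps_one)
    moreover have "v = (v + eps) - eps" by simp
    ultimately show ?thesis
      unfolding dir_def by blast
  qed
  then show ?thesis
    by (auto simp: dir_def van_1_iff unit_functionals_def LH_minus)
qed

lemma dir_lin: "lin_closed s L \<Longrightarrow> dir L = L"
  by (rule dir_lin_closed[OF lca])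

lemma analytic_Exp: "analytic_map hs hs V1 UF V1 Exp"
proof (rule analytic_map_polynomial[OF lca, where e = "fexp (fps_exp 1) (PVar 0)"])
  show "lin_closed s (dir V1)" "lin_closed s (dir UF)"
    by (simp_all add: dir_lin[OF lin_closed_van] dir_UF lin_closed_van)
  show "x + w \<in> V1" if "x \<in> V1" "w \<in> dir V1" for x w
    using that lin_closed_van by (auto simp: dir_lin[OF lin_closed_van] lin_closed_def[OF lca])
  show "Exp \<phi> = (\<lambda>i. revl (fexp (fps_exp 1) (PVar 0) i) \<phi>)" if "\<phi> \<in> V1" for \<phi>
    using revl_fexp[OF van_LH[OF that], of "\<lambda>l \<phi>. \<phi> l" "PVar 0"] by (auto simp: Exp_def)
  show "Exp ` V1 \<subseteq> UF"
    using Exp_unit_functionals(1) by blast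
  fix \<phi> \<psi> assume "\<phi> \<in> V1" "\<psi> \<in> dir V1"
  then have "\<phi> \<in> V1" "\<psi> \<in> V1"
    by (simp_all add: dir_lin[OF lin_closed_van])
  from cevl_fexp[OF this, where g = "PVar 0" and p = "(\<phi>, \<psi>)" and F = "fps_exp 1"]
  show "(\<lambda>i. fst (cevl (fexp (fps_exp 1) (PVar 0) i) (\<phi>, \<psi>))) \<in> UF \<and>
      (\<lambda>i. snd (cevl (fexp (fps_exp 1) (PVar 0) i) (\<phi>, \<psi>))) \<in> dir UF"
    unfolding dir_UF by (simp add: cev_def unit_functionals_def van_1_iff)
qed

lemma analytic_Log: "analytic_map hs hs UF V1 UF Log"
\<comment> \<open>The expression stands for \<phi> - \<open>eps\<close>. Its constant has imaginary
  part zero, so in the complexification only the real part is shifted.\<close>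
proof (rule analytic_map_polynomial[OF lca, where e = "fexp (fps_ln 1) (\<lambda>a. PAdd (PVar 0 a) (PCst (- eps a)))"])
  let ?g = "\<lambda>a. PAdd (PVar 0 a) (PCst (- eps a))"
  show "lin_closed s (dir V1)" "lin_closed s (dir UF)"
    by (simp_all add: dir_lin[OF lin_closed_van] dir_UF lin_closed_van)
  show "x + w \<in> UF" if "x \<in> UF" "w \<in> dir UF" for x w
    using that unfolding dir_UF by (auto simp: van_1_iff unit_functionals_def LH_plus)
  show "Log \<phi> = (\<lambda>i. revl (fexp (fps_ln 1) ?g i) \<phi>)" if "\<phi> \<in> UF" for \<phi>
    using revl_fexp[OF van_LH[OF unit_functionals_van[OF that]], of "\<lambda>l \<phi>. \<phi> l" ?g]
    by (auto simp: Log_def)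
  show "Log ` UF \<subseteq> V1"
    using Log_van by blast
  fix \<phi> \<psi> assume "\<phi> \<in> UF" "\<psi> \<in> dir UF"
  then have "\<phi> - eps \<in> V1" "\<psi> \<in> V1"
    by (simp_all add: dir_UF unit_functionals_van)
  from cevl_fexp[OF this, where g = ?g and p = "(\<phi>, \<psi>)" and F = "fps_ln 1"]
  show "(\<lambda>i. fst (cevl (fexp (fps_ln 1) ?g i) (\<phi>, \<psi>))) \<in> V1 \<and>
      (\<lambda>i. snd (cevl (fexp (fps_ln 1) ?g i) (\<phi>, \<psi>))) \<in> dir V1"
    by (simp add: cev_def dir_lin[OF lin_closed_van] van_1_iff)
qed

lemma bij_Log: "bij_betw Log UF V1"
  by (rule bij_betwI[where g = Exp]) (auto simp: Log_van Exp_unit_functionals(1) Exp_Log Log_Exp)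

lemma inv_into_Log: "v \<in> V1 \<Longrightarrow> inv_into UF Log v = Exp v"
  using bij_Log Log_Exp Exp_unit_functionals(1) by (metis bij_betw_imp_inj_on inv_into_f_f)

lemma subspace_lin_closed: "lin_closed s L \<Longrightarrow> Modules.module.subspace hs L"
proof -
  interpret HS: vector_space hs
    by unfold_locales (auto simp: hom_scale_def B.scale_left_distrib B.scale_right_distrib)
  show "lin_closed s L \<Longrightarrow> Modules.module.subspace hs L"
    by (simp add: HS.subspace_def lin_closed_def[OF lca])
qed

text \<open>The set \<open>S\<close> is left open, because a closed Lie subgroup asks for one chart
  that flattens the group and the subgroup simultaneously.\<close>

lemma submanifold_chart_Log:
  assumes F: "lin_closed s F" "F \<subseteq> V1" and S: "S \<subseteq> UF" "Log ` S = F"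
  shows "submanifold_chart hs UF S UF V1 Log F"
  unfolding submanifold_chart_def dir_UF
proof (intro conjI)
  show "analytic_map hs hs V1 UF V1 (inv_into UF Log)"
    by (rule analytic_map_cong[OF analytic_Exp]) (simp add: inv_into_Log)
  show "closedin (top_of_set V1) F"
    using F by (auto simp: lin_closed_def[OF lca] closedin_closed_eq closed_van intro: closed_subset)
  show "Log ` (UF \<inter> S) = V1 \<inter> F"
    using F S by (simp add: inf_absorb2)
qed (use bij_Log analytic_Log F subspace_lin_closed in auto)

lemma Log_image_characters: "Log ` characters H s = infs"
proof
  show "Log ` characters H s \<subseteq> infs"
    using Log_infinitesimal by blast
  show "infs \<subseteq> Log ` characters H s"
    using Exp_characters Log_Exp[OF infinitesimal_van] by (metis imageI subsetI)
qed

lemma characters_UF: "characters H s \<subseteq> UF"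
  by (auto simp: characters_def unit_functionals_def)

lemma infs_V1: "infs \<subseteq> V1"
  using infinitesimal_van by blast

lemma Log_image_annihilator:
  assumes J: "hopf_ideal H J"
  shows "Log ` (annihilator H J s \<inter> characters H s) = annihilator H J s \<inter> infs"
proof
  show "Log ` (annihilator H J s \<inter> characters H s) \<subseteq> annihilator H J s \<inter> infs"
    using Log_infinitesimal Log_annihilator[OF J] characters_UF by blast
  show "annihilator H J s \<inter> infs \<subseteq> Log ` (annihilator H J s \<inter> characters H s)"
  proof
    fix D assume "D \<in> annihilator H J s \<inter> infs"
    then have "Exp D \<in> annihilator H J s \<inter> characters H s" "Log (Exp D) = D"
      using Exp_characters Exp_annihilator[OF J] Log_Exp infinitesimal_van by auto
    then show "D \<in> Log ` (annihilator H J s \<inter> characters H s)"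
      by (metis imageI)
  qed
qed

lemma chart_characters: "submanifold_chart hs UF (characters H s) UF V1 Log infs"
  by (rule submanifold_chart_Log[OF lin_closed_infinitesimal infs_V1 characters_UF Log_image_characters])

lemma chart_annihilator:
  assumes "hopf_ideal H J"
  shows "submanifold_chart hs UF (annihilator H J s \<inter> characters H s) UF V1 Log (annihilator H J s \<inter> infs)"
  by (rule submanifold_chart_Log[OF lin_closed_annihilator _ _ Log_image_annihilator[OF assms]])
    (use infs_V1 characters_UF in auto)

lemma subgroup_annihilator:
  assumes J: "hopf_ideal H J"
  shows "subgroup (annihilator H J s \<inter> characters H s) (char_group H s)"
  using eps_annihilator[OF J] conv_annihilator[OF J] inverse_char_annihilator[OF J]
    inverse_char_characters conv_characters eps_characters
  by (intro subgroup.intro; simp add: char_group_inverse; simp add: char_group_def eps_def[abs_def, symmetric])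

lemma closed_lie_subgroup_annihilator:
  assumes J: "hopf_ideal H J"
  shows "closed_lie_subgroup hs UF (char_group H s) (annihilator H J s \<inter> characters H s)"
  unfolding closed_lie_subgroup_def
proof (intro conjI ballI)
  show "closedin (top_of_set (carrier (char_group H s))) (annihilator H J s \<inter> characters H s)"
    using closedin_closed_Int[OF closed_annihilator[of J], of "characters H s"]
    by (simp add: char_group_def Int_commute)
  fix x assume "x \<in> annihilator H J s \<inter> characters H s"
  then have "x \<in> UF"
    using characters_UF by blast
  then show "\<exists>U W \<Phi> F F'. x \<in> U \<and> submanifold_chart hs UF (carrier (char_group H s)) U W \<Phi> F \<and>
      F' \<subseteq> F \<and> submanifold_chart hs UF (annihilator H J s \<inter> characters H s) U W \<Phi> F'"
    using chart_characters chart_annihilator[OF J]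
    by - (rule exI[of _ UF], rule exI[of _ V1], rule exI[of _ Log], rule exI[of _ infs],
        rule exI[of _ "annihilator H J s \<inter> infs"], auto simp: char_group_def)
qed (rule subgroup_annihilator[OF J])

end

section \<open>The Lie algebra\<close>

lemma eventually_nhds_at: "\<forall>\<^sub>F h in nhds a. P h \<Longrightarrow> \<forall>\<^sub>F h in at a. P h"
  by (simp add: eventually_at_filter eventually_mono)

context lca_hopf
begin

section \<open>Limits of convolutions and velocities of curves\<close>

lemma lim_add: "(f \<longlongrightarrow> a) F \<Longrightarrow> (g \<longlongrightarrow> b) F \<Longrightarrow> ((\<lambda>x. f x + g x :: 'b) \<longlongrightarrow> a + b) F"
  by (rule tendsto_binop[OF locally_convex_algebraD(3)[OF lca]])

lemma lim_mul: "(f \<longlongrightarrow> a) F \<Longrightarrow> (g \<longlongrightarrow> b) F \<Longrightarrow> ((\<lambda>x. f x * g x :: 'b) \<longlongrightarrow> a * b) F"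
  by (rule tendsto_binop[OF locally_convex_algebraD(5)[OF lca]])

lemma lim_s: "(c \<longlongrightarrow> d) F \<Longrightarrow> (g \<longlongrightarrow> b) F \<Longrightarrow> ((\<lambda>x. s (c x) (g x)) \<longlongrightarrow> s d b) F"
  by (rule tendsto_binop[OF locally_convex_algebraD(4)[OF lca]])

lemma lim_diff: "(f \<longlongrightarrow> a) F \<Longrightarrow> (g \<longlongrightarrow> b) F \<Longrightarrow> ((\<lambda>x. f x - g x :: 'b) \<longlongrightarrow> a - b) F"
  by (rule tendsto_binop[OF lca_diff_cont[OF lca]])

lemma lim_sum:
  "(\<And>i. i \<in> I \<Longrightarrow> ((\<lambda>x. f x i) \<longlongrightarrow> a i) F) \<Longrightarrow> ((\<lambda>x. \<Sum>i\<in>I. f x i :: 'b) \<longlongrightarrow> (\<Sum>i\<in>I. a i)) F"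
  by (induction I rule: infinite_finite_induct) (auto intro: lim_add)

lemma lim_sum_list:
  "(\<And>i. i \<in> set xs \<Longrightarrow> ((\<lambda>x. f x i) \<longlongrightarrow> a i) F) \<Longrightarrow>
    ((\<lambda>x. \<Sum>i\<leftarrow>xs. f x i :: 'b) \<longlongrightarrow> (\<Sum>i\<leftarrow>xs. a i)) F"
  by (induction xs) (auto intro: lim_add)

text \<open>At each point a convolution is a fixed finite polynomial in values of its factors.
  Linearity is demanded eventually because curves are controlled only near the parameter 0.\<close>

lemma conv_tendsto:
  assumes lim: "(p \<longlongrightarrow> p0) F" "(q \<longlongrightarrow> q0) F"
    and L: "\<forall>\<^sub>F h in F. p h \<in> LH" "\<forall>\<^sub>F h in F. q h \<in> LH" "p0 \<in> LH" "q0 \<in> LH"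
  shows "((\<lambda>h. p h \<star> q h) \<longlongrightarrow> p0 \<star> q0) F"
  unfolding tendsto_fun_iff
proof
  fix x
  show "((\<lambda>h. (p h \<star> q h) x) \<longlongrightarrow> (p0 \<star> q0) x) F"
  proof (cases "x \<in> carrier H")
    case True
    have "((\<lambda>h. \<Sum>r\<leftarrow>cop x. p h (fst r) * q h (snd r)) \<longlongrightarrow> (\<Sum>r\<leftarrow>cop x. p0 (fst r) * q0 (snd r))) F"
      using lim unfolding tendsto_fun_iff by (intro lim_sum_list lim_mul) auto
    moreover have "\<forall>\<^sub>F h in F. (\<Sum>r\<leftarrow>cop x. p h (fst r) * q h (snd r)) = (p h \<star> q h) x"
      using L(1,2) by eventually_elim (simp add: conv_cop True)
    ultimately show ?thesis
      by (simp add: conv_cop True L(3,4) Lim_transform_eventually)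
  qed (simp add: conv_outside)
qed

lemma velocity_continuous:
  assumes "has_velocity hs \<gamma> v"
  shows "(\<gamma> \<longlongrightarrow> \<gamma> 0) (at 0)"
  unfolding tendsto_fun_iff
proof
  fix x
  have "((\<lambda>h. s (of_real (inverse h)) (\<gamma> h x - \<gamma> 0 x)) \<longlongrightarrow> v x) (at 0)"
    using assms by (simp add: has_velocity_def tendsto_fun_iff hom_scale_def)
  then have "((\<lambda>h. \<gamma> 0 x + s (of_real h) (s (of_real (inverse h)) (\<gamma> h x - \<gamma> 0 x))) \<longlongrightarrow>
      \<gamma> 0 x + s (of_real 0) (v x)) (at 0)"
    by (intro lim_add lim_s tendsto_const tendsto_of_real tendsto_ident_at)
  moreover have "\<forall>\<^sub>F h in at 0. \<gamma> 0 x + s (of_real h) (s (of_real (inverse h)) (\<gamma> h x - \<gamma> 0 x)) = \<gamma> h x"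
    by (simp add: eventually_at_filter of_real_inverse[symmetric] of_real_mult[symmetric]
        del: of_real_inverse of_real_mult)
  ultimately show "((\<lambda>h. \<gamma> h x) \<longlongrightarrow> \<gamma> 0 x) (at 0)"
    by (simp add: Lim_transform_eventually)
qed

lemma curve_eventually:
  assumes "curve_in hs A S x v \<gamma>"
  shows "\<forall>\<^sub>F h in nhds 0. \<gamma> h \<in> S"
proof -
  obtain \<delta> where \<delta>: "\<delta> > 0" "\<gamma> ` {-\<delta><..<\<delta>} \<subseteq> S"
    using assms unfolding curve_in_def by blast
  have "\<forall>\<^sub>F h in nhds 0. h \<in> {-\<delta><..<\<delta>}"
    using \<delta>(1) by (intro eventually_nhds_in_open) auto
  then show ?thesis
    by eventually_elim (use \<delta>(2) in auto)
qed

text \<open>Multiplicativity is differentiated at \<open>eps\<close>; the derivation rule follows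
  from uniqueness of limits in the Hausdorff space \<open>B\<close>.\<close>

lemma velocity_infinitesimal:
  assumes vel: "has_velocity hs \<gamma> v" and ev: "\<forall>\<^sub>F h in at 0. \<gamma> h \<in> characters H s" and 0: "\<gamma> 0 = eps"
  shows "v \<in> infs"
proof (rule infinitesimalI)
  let ?q = "\<lambda>h. hs (of_real (inverse h)) (\<gamma> h - \<gamma> 0)"
  have lim: "((\<lambda>h. ?q h x) \<longlongrightarrow> v x) (at 0)" for x
    using vel by (simp add: has_velocity_def tendsto_fun_iff)
  have qLH: "\<forall>\<^sub>F h in at 0. ?q h \<in> LH"
    using ev by eventually_elim (simp add: 0 LH_scale LH_minus eps_LH charactersD(1))
  show "v \<in> LH"
    by (rule Lim_in_closed_set[OF closed_LH qLH]) (use vel in \<open>auto simp: has_velocity_def\<close>)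
  fix x y assume xy: "x \<in> carrier H" "y \<in> carrier H"
  have "((\<lambda>h. eps x * ?q h y + ?q h x * \<gamma> h y) \<longlongrightarrow> eps x * v y + v x * eps y) (at 0)"
    using velocity_continuous[OF vel] unfolding tendsto_fun_iff 0
    by (intro lim_add lim_mul lim[unfolded 0] tendsto_const) auto
  \<comment> \<open>The product rule before passage to the limit, with the second factor at the
    moved point.\<close>
  moreover have "\<forall>\<^sub>F h in at 0. eps x * ?q h y + ?q h x * \<gamma> h y = ?q h (x \<otimes> y)"
    using ev
  proof eventually_elim
    case (elim h)
    have "eps x * ?q h y + ?q h x * \<gamma> h y =
        s (of_real (inverse h)) (eps x * (\<gamma> h y - eps y) + (\<gamma> h x - eps x) * \<gamma> h y)"
      by (simp add: hom_scale_def 0 s_mult s_mult_right[symmetric] B.scale_right_distrib)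
    also have "eps x * (\<gamma> h y - eps y) + (\<gamma> h x - eps x) * \<gamma> h y = \<gamma> h x * \<gamma> h y - eps x * eps y"
      by (simp add: right_diff_distrib left_diff_distrib)
    also have "\<dots> = \<gamma> h (x \<otimes> y) - eps (x \<otimes> y)"
      by (simp add: charactersD(3)[OF elim xy] charactersD(3)[OF eps_characters xy])
    finally show ?case
      by (simp add: hom_scale_def 0)
  qed
  ultimately have fin: "((\<lambda>h. ?q h (x \<otimes> y)) \<longlongrightarrow> eps x * v y + v x * eps y) (at 0)"
    by (rule Lim_transform_eventually)
  show "v (x \<otimes> y) = eps x * v y + v x * eps y"
    by (rule tendsto_unique[OF _ lim fin]) simp
qed

lemma velocity_annihilator:
  assumes J: "hopf_ideal H J" and vel: "has_velocity hs \<gamma> v"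
    and ev: "\<forall>\<^sub>F h in at 0. \<gamma> h \<in> annihilator H J s" and 0: "\<gamma> 0 = eps"
  shows "v \<in> annihilator H J s"
proof (rule Lim_in_closed_set[OF closed_annihilator])
  show "\<forall>\<^sub>F h in at 0. hs (of_real (inverse h)) (\<gamma> h - \<gamma> 0) \<in> annihilator H J s"
    using ev
    by eventually_elim
      (simp add: 0 annihilator_def LH_scale LH_minus eps_LH, simp add: hom_scale_def annihilatorD(2)[OF eps_annihilator[OF J]])
  show "((\<lambda>h. hs (of_real (inverse h)) (\<gamma> h - \<gamma> 0)) \<longlongrightarrow> v) (at 0)"
    using vel by (simp add: has_velocity_def)
qed auto

lemma cpow_scale: "\<rho> \<in> LH \<Longrightarrow> cpow (hs c \<rho>) n = hs (c ^ n) (cpow \<rho> n)"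
proof (induction n)
  case (Suc n)
  then show ?case
    by (simp add: conv_scale_left conv_scale_right LH_scale cpow_LH) (simp add: hom_scale_def mult.commute)
qed (simp add: hom_scale_def)

text \<open>Along a line the exponential is, at each point, a polynomial in the scalar.\<close>

lemma Exp_scale:
  assumes "v \<in> V1" "dbound x \<le> N"
  shows "Exp (hs c v) x = (\<Sum>k\<le>N. s (c ^ k / fact k) (cpow v k x))"
proof -
  have "hs c v \<in> V1"
    using assms(1) lin_closed_van by (auto simp: lin_closed_def[OF lca])
  from fcalc_eq[OF this assms(2), of "fps_exp 1"] show ?thesis
    by (simp add: Exp_def cpow_scale[OF van_LH[OF assms(1)]]) (simp add: hom_scale_def)
qed

lemma Exp_zero: "v \<in> V1 \<Longrightarrow> Exp (hs 0 v) = eps"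
  by (rule ext) (simp add: Exp_scale[OF _ order_refl] power_0_left if_distrib[of "\<lambda>c. s (c / _) _"]
      if_distrib[of "\<lambda>c. s c _"] cong: if_cong)

lemma Exp_velocity:
  assumes v: "v \<in> V1"
  shows "has_velocity hs (\<lambda>r. Exp (hs (of_real r) v)) v"
  unfolding has_velocity_def tendsto_fun_iff
proof
  fix x
  let ?N = "dbound x"
  \<comment> \<open>The difference quotient with the constant term gone and one factor
    \<open>h\<close> cancelled, whence the index shift.\<close>
  let ?f = "\<lambda>h. \<Sum>j\<le>?N. s (of_real h ^ j / fact (Suc j)) (cpow v (Suc j) x)"
  have "(?f \<longlongrightarrow> (\<Sum>j\<le>?N. s (of_real 0 ^ j / fact (Suc j)) (cpow v (Suc j) x))) (at (0::real))"
    by (intro lim_sum lim_s tendsto_divide tendsto_power tendsto_of_real tendsto_ident_at tendsto_const) (auto simp del: fact_Suc)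
  also have "(\<Sum>j\<le>?N. s (of_real 0 ^ j / fact (Suc j)) (cpow v (Suc j) x)) = cpow v (Suc 0) x"
    by (simp add: power_0_left if_distrib[of "\<lambda>c. s (c / _) _"] if_distrib[of "\<lambda>c. s c _"]
        del: cpow.simps fact_Suc cong: if_cong)
  also have "\<dots> = v x"
    using cpow_one[OF van_LH[OF v]] by simp
  finally have 1: "(?f \<longlongrightarrow> v x) (at 0)" .
  have 2: "\<forall>\<^sub>F h in at 0. ?f h = hs (of_real (inverse h)) (Exp (hs (of_real h) v) - Exp (hs (of_real 0) v)) x"
    unfolding eventually_at_filter
  proof (rule always_eventually, intro allI impI)
    fix h :: real assume "h \<noteq> 0"
    \<comment> \<open>The cutoff is raised by one, so that splitting off the zeroth term leaves a
      sum up to \<open>?N\<close>, as in \<open>?f\<close>.\<close>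
    have "Exp (hs (of_real h) v) x = eps x + (\<Sum>j\<le>?N. s (of_real h ^ Suc j / fact (Suc j)) (cpow v (Suc j) x))"
      by (subst Exp_scale[OF v, of x "Suc ?N"], simp, subst sum.atMost_Suc_shift) simp
    moreover have "s (of_real (inverse h)) (\<Sum>j\<le>?N. s (of_real h ^ Suc j / fact (Suc j)) (cpow v (Suc j) x)) = ?f h"
      using \<open>h \<noteq> 0\<close>
      by (simp add: B.scale_sum_right of_real_inverse mult.assoc[symmetric] del: cpow.simps fact_Suc)
    ultimately show "?f h = hs (of_real (inverse h)) (Exp (hs (of_real h) v) - Exp (hs (of_real 0) v)) x"
      by (simp add: Exp_zero[OF v]) (simp add: hom_scale_def)
  qed
  show "((\<lambda>h. hs (of_real (inverse h)) (Exp (hs (of_real h) v) - Exp (hs (of_real 0) v)) x) \<longlongrightarrow> v x) (at 0)"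
    by (rule Lim_transform_eventually[OF 1 2])
qed

lemma Exp_curve:
  assumes v: "v \<in> V1" and S: "\<And>r. Exp (hs (of_real r) v) \<in> S"
  shows "curve_in hs UF S eps v (\<lambda>r. Exp (hs (of_real r) v))"
proof -
  interpret C: pexp_eval "\<lambda>r. s (of_real r)" "(*)" "\<lambda>l r. s (of_real r) (v l)" "\<lambda>c. c" "(*)"
    by (rule pexp_eval_curve[OF lca])
  have hv: "hs c v \<in> V1" for c
    using v lin_closed_van by (auto simp: lin_closed_def[OF lca])
  have "C_map 1 (*) (\<lambda>r. hs (of_real r)) UNIV UF UNIV (\<lambda>r. Exp (hs (of_real r) v))"
  proof (rule C.C_map_polynomial[where \<kappa> = "\<lambda>F. F" and e = "fexp (fps_exp 1) (PVar 0)"])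
    show "Exp (hs (of_real r) v) =
        (\<lambda>i. C.eval (fexp (fps_exp 1) (PVar 0) i) (\<lambda>n. if n = 0 then r else 0))" for r
      using revl_fexp[OF van_LH[OF hv[of "of_real r"]], where g = "PVar 0" and
          ev = "\<lambda>l r. s (of_real r) (v l)" and v = "\<lambda>n. if n = 0 then r else 0"]
      by (auto simp: Exp_def hom_scale_def)
    show "closed (dir UF)" "\<And>x y. x \<in> dir UF \<Longrightarrow> y \<in> dir UF \<Longrightarrow> x - y \<in> dir UF"
      "\<And>c x. x \<in> dir UF \<Longrightarrow> hs (of_real c) x \<in> dir UF"
      using lin_closed_van[of "Suc 0"] lin_closed_minus[OF lca lin_closed_van]
      unfolding dir_UF by (auto simp: lin_closed_def[OF lca])
    show "(\<lambda>r. Exp (hs (of_real r) v)) ` UNIV \<subseteq> UF"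
      using Exp_unit_functionals(1)[OF hv] by auto
  qed (auto simp: hom_scale_def continuous_on_id fun_diff_def)
  \<comment> \<open>The curve is smooth on the whole line, but \<open>curve_in\<close> speaks of a
    symmetric interval.\<close>
  then have "C_map 1 (*) (\<lambda>r. hs (of_real r)) UNIV UF {-1<..<1} (\<lambda>r. Exp (hs (of_real r) v))"
    by (rule C_map_subset) auto
  then show ?thesis
    unfolding curve_in_def using S Exp_velocity[OF v] Exp_zero[OF v]
    by (intro conjI exI[of _ 1]) auto
qed

text \<open>Velocities inherit the linearised and closed conditions. Conversely the exponential of
  the line through \<open>v\<close> has velocity \<open>v\<close> and remains in the
  subgroup.\<close>

lemma tangent_space_annihilator:
  assumes J: "hopf_ideal H J"
  shows "tangent_space hs UF (annihilator H J s \<inter> characters H s) eps = annihilator H J s \<inter> infs"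
proof
  show "tangent_space hs UF (annihilator H J s \<inter> characters H s) eps \<subseteq> annihilator H J s \<inter> infs"
  proof
    fix v assume "v \<in> tangent_space hs UF (annihilator H J s \<inter> characters H s) eps"
    then obtain \<gamma> where c: "curve_in hs UF (annihilator H J s \<inter> characters H s) eps v \<gamma>"
      by (auto simp: tangent_space_def)
    then have vel: "has_velocity hs \<gamma> v" and 0: "\<gamma> 0 = eps"
      by (auto simp: curve_in_def)
    have "\<forall>\<^sub>F h in at 0. \<gamma> h \<in> annihilator H J s \<inter> characters H s"
      by (rule eventually_nhds_at[OF curve_eventually[OF c]])
    then have "\<forall>\<^sub>F h in at 0. \<gamma> h \<in> annihilator H J s" "\<forall>\<^sub>F h in at 0. \<gamma> h \<in> characters H s"
      by (auto elim: eventually_mono)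
    then show "v \<in> annihilator H J s \<inter> infs"
      using velocity_annihilator[OF J vel _ 0] velocity_infinitesimal[OF vel _ 0] by blast
  qed
  show "annihilator H J s \<inter> infs \<subseteq> tangent_space hs UF (annihilator H J s \<inter> characters H s) eps"
  proof
    fix v assume v: "v \<in> annihilator H J s \<inter> infs"
    then have "hs c v \<in> annihilator H J s \<inter> infs" for c
      using lin_closed_annihilator by (auto simp: lin_closed_def[OF lca])
    then have "Exp (hs c v) \<in> annihilator H J s \<inter> characters H s" for c
      using Exp_characters Exp_annihilator[OF J] infinitesimal_van by blast
    then have "curve_in hs UF (annihilator H J s \<inter> characters H s) eps v (\<lambda>r. Exp (hs (of_real r) v))"
      using v infinitesimal_van by (intro Exp_curve) auto
    then show "v \<in> tangent_space hs UF (annihilator H J s \<inter> characters H s) eps"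
      by (auto simp: tangent_space_def)
  qed
qed

lemma conv_bracket_annihilator:
  assumes "hopf_ideal H J" "v \<in> annihilator H J s \<inter> infs" "w \<in> annihilator H J s \<inter> infs"
  shows "conv_bracket H v w \<in> annihilator H J s \<inter> infs"
  using assms conv_bracket_infinitesimal[of v w]
  by (auto simp: conv_bracket_def[of H v w] intro: annihilator_minus conv_annihilator)

lemma inverse_char_eps: "inverse_char eps = eps"
  using inverse_char_conv(1)[OF eps_characters] by (simp add: conv_eps inverse_char_LH eps_LH)

lemma inverse_char_tendsto:
  assumes "(\<gamma> \<longlongrightarrow> \<phi>) F"
  shows "((\<lambda>h. inverse_char (\<gamma> h)) \<longlongrightarrow> inverse_char \<phi>) F"
  using assms by (auto simp: tendsto_fun_iff inverse_char_def)

text \<open>Conjugation is computed in the ambient convolution algebra, where it is linear in the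
  conjugated element and continuous; its derivative at the unit is a commutator. A general subgroup
  is allowed, since inverses there agree with those of the whole group.\<close>

lemma is_lie_bracket_conv:
  assumes sub: "subgroup S (char_group H s)" and v: "v \<in> LH" "w \<in> LH"
  shows "is_lie_bracket hs UF (char_group H s\<lparr>carrier := S\<rparr>) v w (conv_bracket H v w)"
  unfolding is_lie_bracket_def
proof (intro allI impI, elim conjE)
  let ?G = "char_group H s\<lparr>carrier := S\<rparr>"
  have SC: "S \<subseteq> characters H s"
    using subgroup.subset[OF sub] by (simp add: char_group_def)
  have op: "\<phi> \<otimes>\<^bsub>?G\<^esub> \<psi> = \<phi> \<star> \<psi>" "\<one>\<^bsub>?G\<^esub> = eps" for \<phi> \<psi>
    by (simp_all add: char_group_def eps_def[abs_def])
  have inv: "inv\<^bsub>?G\<^esub> \<phi> = inverse_char \<phi>" if "\<phi> \<in> S" for \<phi>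
    using group.m_inv_consistent[OF char_group_group sub that] char_group_inverse SC that by auto
  fix \<gamma> \<eta>
  assume "curve_in hs UF (carrier ?G) \<one>\<^bsub>?G\<^esub> v \<gamma>" "curve_in hs UF (carrier ?G) \<one>\<^bsub>?G\<^esub> w \<eta>"
  then have \<gamma>: "curve_in hs UF S eps v \<gamma>" and \<eta>: "curve_in hs UF S eps w \<eta>"
    by (simp_all add: op)
  then have vel: "has_velocity hs \<gamma> v" "has_velocity hs \<eta> w" and 0: "\<gamma> 0 = eps" "\<eta> 0 = eps"
    by (auto simp: curve_in_def)
  have L: "\<phi> \<in> LH" "inverse_char \<phi> \<in> LH" if "\<phi> \<in> S" for \<phi>
    using SC that charactersD(1) inverse_char_LH by blast+
  \<comment> \<open>The adjoint action of \<open>\<gamma> r\<close> on \<open>w\<close>.\<close>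
  define a where "a r = \<gamma> r \<star> w \<star> inverse_char (\<gamma> r)" for r
  have ev\<eta>: "\<forall>\<^sub>F h in at 0. \<eta> h \<in> S"
    by (rule eventually_nhds_at[OF curve_eventually[OF \<eta>]])
  have ev\<gamma>: "\<forall>\<^sub>F h in at 0. \<gamma> h \<in> S"
    by (rule eventually_nhds_at[OF curve_eventually[OF \<gamma>]])
  have vel_a: "has_velocity hs (\<lambda>h. \<gamma> r \<otimes>\<^bsub>?G\<^esub> \<eta> h \<otimes>\<^bsub>?G\<^esub> inv\<^bsub>?G\<^esub> (\<gamma> r)) (a r)" if r: "\<gamma> r \<in> S" for r
    unfolding has_velocity_def op inv[OF r] a_def 0
  proof (rule Lim_transform_eventually)
    let ?q = "\<lambda>h. hs (of_real (inverse h)) (\<eta> h - eps)"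
    have q: "\<forall>\<^sub>F h in at 0. ?q h \<in> LH"
      using ev\<eta> by eventually_elim (simp add: LH_scale LH_minus L eps_LH)
    then have q2: "\<forall>\<^sub>F h in at 0. \<gamma> r \<star> ?q h \<in> LH"
      by eventually_elim (simp add: conv_LH L r)
    have "(?q \<longlongrightarrow> w) (at 0)"
      using vel(2) by (simp add: has_velocity_def 0)
    from conv_tendsto[OF conv_tendsto[OF tendsto_const this _ q] tendsto_const q2]
    show "((\<lambda>h. \<gamma> r \<star> ?q h \<star> inverse_char (\<gamma> r)) \<longlongrightarrow> \<gamma> r \<star> w \<star> inverse_char (\<gamma> r)) (at 0)"
      using L[OF r] v by (simp add: conv_LH)
    show "\<forall>\<^sub>F h in at 0. \<gamma> r \<star> ?q h \<star> inverse_char (\<gamma> r) =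
        hs (of_real (inverse h)) (\<gamma> r \<star> \<eta> h \<star> inverse_char (\<gamma> r) - \<gamma> r \<star> eps \<star> inverse_char (\<gamma> r))"
      using ev\<eta>
      by eventually_elim
        (simp add: conv_scale_left conv_scale_right conv_diff_left conv_diff_right conv_LH LH_minus L r eps_LH
          LH_scale)
  qed
  have 1: "\<forall>\<^sub>F r in nhds 0. has_velocity hs (\<lambda>h. \<gamma> r \<otimes>\<^bsub>?G\<^esub> \<eta> h \<otimes>\<^bsub>?G\<^esub> inv\<^bsub>?G\<^esub> (\<gamma> r)) (a r)"
    by (rule eventually_mono[OF curve_eventually[OF \<gamma>] vel_a])
  have a0: "a 0 = w"
    using v by (simp add: a_def 0 inverse_char_eps eps_conv conv_eps conv_LH)
  let ?q = "\<lambda>h. hs (of_real (inverse h)) (\<gamma> h - eps)"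
  have q: "\<forall>\<^sub>F h in at 0. ?q h \<in> LH"
    using ev\<gamma> by eventually_elim (simp add: LH_scale LH_minus L eps_LH)
  have i: "\<forall>\<^sub>F h in at 0. inverse_char (\<gamma> h) \<in> LH"
    using ev\<gamma> by eventually_elim (simp add: L)
  have qw: "\<forall>\<^sub>F h in at 0. ?q h \<star> w \<in> LH" "\<forall>\<^sub>F h in at 0. w \<star> ?q h \<in> LH"
    using q by (eventually_elim, simp add: conv_LH v)+
  have qlim: "(?q \<longlongrightarrow> v) (at 0)"
    using vel(1) by (simp add: has_velocity_def 0)
  have ilim: "((\<lambda>h. inverse_char (\<gamma> h)) \<longlongrightarrow> eps) (at 0)"
    using inverse_char_tendsto[OF velocity_continuous[OF vel(1)]] by (simp add: 0 inverse_char_eps)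
  have c1: "((\<lambda>h. ?q h \<star> w \<star> inverse_char (\<gamma> h)) \<longlongrightarrow> v \<star> w \<star> eps) (at 0)"
    using v by (intro conv_tendsto qlim ilim tendsto_const q qw i) (auto intro: conv_LH eps_LH)
  have c2: "((\<lambda>h. w \<star> ?q h \<star> inverse_char (\<gamma> h)) \<longlongrightarrow> w \<star> v \<star> eps) (at 0)"
    using v by (intro conv_tendsto qlim ilim tendsto_const q qw i) (auto intro: conv_LH eps_LH)
  \<comment> \<open>With g = \<gamma> h and its inverse g', one has g w g' - w = (g - eps) w g' - w
    (g - eps) g'. Dividing by \<open>h\<close> differentiates \<open>\<gamma>\<close> alone, while
    inversion enters through its continuity.\<close>
  have lim: "((\<lambda>h. ?q h \<star> w \<star> inverse_char (\<gamma> h) - w \<star> ?q h \<star> inverse_char (\<gamma> h)) \<longlongrightarrow> conv_bracket H v w) (at 0)"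
    using c1 c2 v unfolding tendsto_fun_iff conv_bracket_def
    by (auto simp: conv_eps conv_LH intro: lim_diff)
  have 2: "has_velocity hs a (conv_bracket H v w)"
    unfolding has_velocity_def a0
  proof (rule Lim_transform_eventually[OF lim])
    show "\<forall>\<^sub>F h in at 0. ?q h \<star> w \<star> inverse_char (\<gamma> h) - w \<star> ?q h \<star> inverse_char (\<gamma> h) =
        hs (of_real (inverse h)) (a h - w)"
      using ev\<gamma>
    proof eventually_elim
      case (elim h)
      note G = L[OF elim]
      define g where "g = \<gamma> h - eps"
      have g: "g \<in> LH" by (simp add: g_def LH_minus G eps_LH)
      have "w \<star> g \<star> inverse_char (\<gamma> h) = w \<star> (\<gamma> h \<star> inverse_char (\<gamma> h)) - w \<star> inverse_char (\<gamma> h)"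
        by (simp add: g_def conv_diff_left conv_diff_right conv_assoc conv_LH G v eps_LH eps_conv)
      also have "\<dots> = w - w \<star> inverse_char (\<gamma> h)"
        using SC elim by (simp add: inverse_char_conv(2) conv_eps v subset_iff)
      finally have "g \<star> w \<star> inverse_char (\<gamma> h) - w \<star> g \<star> inverse_char (\<gamma> h) = a h - w"
        by (simp add: g_def conv_diff_left a_def conv_LH G v eps_LH eps_conv)
      moreover have "hs c g \<star> w \<star> inverse_char (\<gamma> h) - w \<star> hs c g \<star> inverse_char (\<gamma> h) =
          hs c (g \<star> w \<star> inverse_char (\<gamma> h) - w \<star> g \<star> inverse_char (\<gamma> h))" for c
        by (simp add: conv_scale_left conv_scale_right conv_LH G v g LH_scale)
          (auto simp: hom_scale_def B.scale_right_diff_distrib)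
      ultimately show ?case
        by (simp add: g_def)
    qed
  qed
  show "\<exists>a. (\<forall>\<^sub>F r in nhds 0. has_velocity hs (\<lambda>h. \<gamma> r \<otimes>\<^bsub>?G\<^esub> \<eta> h \<otimes>\<^bsub>?G\<^esub> inv\<^bsub>?G\<^esub> (\<gamma> r)) (a r)) \<and>
      has_velocity hs a (conv_bracket H v w)"
    using 1 2 by blast
qed

lemma has_lie_algebra_annihilator:
  assumes J: "hopf_ideal H J"
  shows "has_lie_algebra hs UF (char_group H s\<lparr>carrier := annihilator H J s \<inter> characters H s\<rparr>)
    (annihilator H J s \<inter> infs) (conv_bracket H)"
proof -
  have "\<one>\<^bsub>char_group H s\<lparr>carrier := annihilator H J s \<inter> characters H s\<rparr>\<^esub> = eps"
    by (simp add: char_group_def eps_def[abs_def])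
  then show ?thesis
    unfolding has_lie_algebra_def
    using tangent_space_annihilator[OF J] subspace_lin_closed[OF lin_closed_annihilator]
      conv_bracket_annihilator[OF J] is_lie_bracket_conv[OF subgroup_annihilator[OF J]] infinitesimalD(1)
    by auto
qed

end

section \<open>Quotients by Hopf ideals\<close>

locale hopf_quot = hopf_alg H for H :: "('k::field, 'a) hopf" (structure) +
  fixes J :: "'a set"
  assumes J: "hopf_ideal H J"
begin

abbreviation "Q \<equiv> quot_hopf H J"
abbreviation "q \<equiv> \<lambda>x. J +> x"

sublocale I: ideal J H
  using J by (simp add: hopf_ideal_def)

section \<open>The algebra structure on cosets\<close>

lemma Q_fields:
  "carrier Q = carrier (H Quot J)" "mult Q = mult (H Quot J)" "one Q = one (H Quot J)"
  "zero Q = zero (H Quot J)" "add Q = add (H Quot J)"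
  "smult Q = (\<lambda>c C. \<Union>x\<in>C. q (c \<odot> x))"
  "comult Q = (\<lambda>C. THE t. \<exists>x\<in>C. t = tensor_lift H 0 (+)
        (\<lambda>a b. tensor_of (quot_module H J) [(q a, q b)]) (comult H x))"
  "counit Q = (\<lambda>C. THE r. \<exists>x\<in>C. r = counit H x)"
  "antipode Q = (\<lambda>C. \<Union>x\<in>C. q (antipode H x))"
  by (simp_all add: quot_hopf_def quot_module_def module.defs hopf.defs)

lemma Q_carrier: "carrier Q = q ` carrier H"
  by (auto simp: Q_fields FactRing_def A_RCOSETS_def')

lemma q_closed [simp]: "x \<in> carrier H \<Longrightarrow> q x \<in> carrier Q"
  by (simp add: Q_carrier)

lemma Q_carrierE: "C \<in> carrier Q \<Longrightarrow> (\<And>x. x \<in> carrier H \<Longrightarrow> C = q x \<Longrightarrow> P) \<Longrightarrow> P"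
  by (auto simp: Q_carrier)

lemma q_eq_iff: "x \<in> carrier H \<Longrightarrow> y \<in> carrier H \<Longrightarrow> q x = q y \<longleftrightarrow> x \<ominus> y \<in> J"
  using quotient_eq_iff_same_a_r_cos[OF I.ideal_axioms] by blast

lemma coset_mem: "x \<in> carrier H \<Longrightarrow> y \<in> q x \<Longrightarrow> y \<in> carrier H \<and> q y = q x"
  using I.a_repr_independence'[of y x] I.a_elemrcos_carrier[of x y] by simp

lemma coset_self: "x \<in> carrier H \<Longrightarrow> x \<in> q x"
  by (rule I.a_rcos_self)

lemma J_carrier: "x \<in> J \<Longrightarrow> x \<in> carrier H"
  by (rule I.a_Hcarr)

lemma J_smult: "x \<in> J \<Longrightarrow> c \<odot> x \<in> J"
  using I.I_l_closed[of x "c \<odot> \<one>"] by (simp add: smult_mult J_carrier)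

text \<open>Independence of representatives. Structure maps with cosets as values are unions over a
  coset, the others definite descriptions, for which \<open>coset_the\<close> is the
  analogue.\<close>

lemma coset_union:
  assumes x: "x \<in> carrier H" and f: "\<And>y. y \<in> carrier H \<Longrightarrow> q y = q x \<Longrightarrow> f y = f x"
  shows "(\<Union>y\<in>q x. f y) = f x"
proof -
  have "(\<Union>y\<in>q x. f y) = (\<Union>y\<in>q x. f x)"
    by (rule SUP_cong[OF refl]) (use coset_mem[OF x] f in blast)
  also have "\<dots> = f x"
    using coset_self[OF x] by blast
  finally show ?thesis .
qed

lemma coset_the:
  assumes x: "x \<in> carrier H" and f: "\<And>y. y \<in> carrier H \<Longrightarrow> q y = q x \<Longrightarrow> f y = f x"
  shows "(THE t. \<exists>y\<in>q x. t = f y) = f x"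
proof (rule the_equality)
  show "\<exists>y\<in>q x. f x = f y"
    using coset_self[OF x] by blast
  show "t = f x" if "\<exists>y\<in>q x. t = f y" for t
    using that coset_mem[OF x] f by blast
qed

lemma smult_minus: "x \<in> carrier H \<Longrightarrow> y \<in> carrier H \<Longrightarrow> c \<odot> (x \<ominus> y) = c \<odot> x \<ominus> c \<odot> y"
  by (simp add: a_minus_def vec_a_inv[OF vecH] vec_smult_add_right[OF vecH] vec_smult_assoc[OF vecH])

lemma Q_smult: "x \<in> carrier H \<Longrightarrow> c \<odot>\<^bsub>Q\<^esub> q x = q (c \<odot> x)"
  unfolding Q_fields
proof (rule coset_union)
  fix y assume x: "x \<in> carrier H" and y: "y \<in> carrier H" "q y = q x"
  then have "c \<odot> (y \<ominus> x) \<in> J"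
    using q_eq_iff J_smult by blast
  then show "q (c \<odot> y) = q (c \<odot> x)"
    unfolding q_eq_iff[OF smult_closed[OF y(1)] smult_closed[OF x]] smult_minus[OF y(1) x, symmetric] .
qed

lemma Q_ops:
  "x \<in> carrier H \<Longrightarrow> y \<in> carrier H \<Longrightarrow> q x \<otimes>\<^bsub>Q\<^esub> q y = q (x \<otimes> y)"
  "x \<in> carrier H \<Longrightarrow> y \<in> carrier H \<Longrightarrow> q x \<oplus>\<^bsub>Q\<^esub> q y = q (x \<oplus> y)"
  "\<one>\<^bsub>Q\<^esub> = q \<one>" "\<zero>\<^bsub>Q\<^esub> = q \<zero>"
  unfolding Q_fields
     apply (erule (1) ring_hom_mult[OF I.rcos_ring_hom, symmetric])
    apply (erule (1) ring_hom_add[OF I.rcos_ring_hom, symmetric])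
   apply (rule ring_hom_one[OF I.rcos_ring_hom, symmetric])
  apply (simp add: FactRing_def a_coset_add_zero[OF I.a_subset])
  done

lemma q_zero_iff: "x \<in> carrier H \<Longrightarrow> q x = \<zero>\<^bsub>Q\<^esub> \<longleftrightarrow> x \<in> J"
  by (simp add: Q_ops q_eq_iff a_minus_def)

lemma ring_Q: "ring Q"
  using I.quotient_is_ring
  unfolding ring_def ring_axioms_def abelian_group_def abelian_group_axioms_def abelian_monoid_def
    comm_group_def Group.comm_monoid_def comm_monoid_axioms_def group_def group_axioms_def
    Group.monoid_def Units_def Q_fields monoid.simps partial_object.simps .

lemma vecQ: "vecsp Q"
proof (rule moduleI)
  show "cring (ring_of_type_algebra :: 'k ring)" ..
  show "abelian_group Q"
    using ring_Q by (rule ring.is_abelian_group)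
qed (auto simp: Q_smult Q_ops vec_simps[OF vecH] elim!: Q_carrierE)

lemma unital_algebra_Q: "unital_algebra Q"
  unfolding unital_algebra_def
  by (auto simp: ring_Q vecQ Q_smult Q_ops smult_mult elim!: Q_carrierE)

text \<open>Forms on the quotient are tested on representatives, which brings statements on tensors
  over \<open>Q\<close> back to tensors over \<open>H\<close>.\<close>

lemma linear_form_Q_iff: "linear_form Q l \<longleftrightarrow> linear_form H (\<lambda>x. l (q x))"
  by (auto simp: linear_form_def Q_carrier Q_ops Q_smult)

lemma bilinear_form_Q_iff: "bilinear_form Q \<beta> \<longleftrightarrow> bilinear_form H (\<lambda>x y. \<beta> (q x) (q y))"
  by (simp add: bilinear_form_def linear_form_Q_iff Q_carrier)

lemma trilinear_form_Q_iff: "trilinear_form Q \<tau> \<longleftrightarrow> trilinear_form H (\<lambda>x y z. \<tau> (q x) (q y) (q z))"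
  by (simp add: trilinear_form_def bilinear_form_Q_iff Q_carrier)

lemma bilin_Q:
  assumes "bilin H H g" "\<And>a b. a \<in> carrier H \<Longrightarrow> b \<in> carrier H \<Longrightarrow> f (q a) (q b) = q (g a b)"
  shows "bilin Q Q f"
proof -
  have "bilinear_form H (\<lambda>x y. l (f (q x) (q y)))" if "linear_form H (\<lambda>x. l (q x))" for l
  proof -
    have "\<forall>l. linear_form H l \<longrightarrow> bilinear_form H (\<lambda>x y. l (g x y))"
      using assms(1) by (simp add: bilin_def)
    from this[rule_format, OF that] show ?thesis
      using assms(2) vec_smult_closed[OF vecH]
      by (simp add: bilinear_form_def linear_form_def)
  qed
  then show ?thesis
    using assms unfolding bilin_def bilinear_form_Q_iff linear_form_Q_iff
    by (auto simp: Q_carrier)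
qed

section \<open>The coalgebra structure of the quotient\<close>

abbreviation "qq \<equiv> map (\<lambda>p. (q (fst p), q (snd p)))"

lemma qq_carrier: "set xs \<subseteq> carrier H \<times> carrier H \<Longrightarrow> set (qq xs) \<subseteq> carrier Q \<times> carrier Q"
  by auto

text \<open>The map \<open>q \<otimes> q\<close>.\<close>

definition push :: "('k, 'a) tensor2 \<Rightarrow> ('k, 'a set) tensor2" where
  "push t = (\<lambda>\<beta>. if bilinear_form Q \<beta> then t (\<lambda>x y. \<beta> (q x) (q y)) else 0)"

lemma push_tensor_of: "push (tensor_of H xs) = tensor_of Q (qq xs)"
  by (auto simp: push_def tensor_of_def bilinear_form_Q_iff o_def split_def)

lemma push_add: "push (t + u) = push t + push u"
  by (auto simp: push_def)

lemma push_smult: "push (\<lambda>\<beta>. c * t \<beta>) = (\<lambda>\<beta>. c * push t \<beta>)"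
  by (auto simp: push_def)

lemma q_J: "x \<in> J \<Longrightarrow> q x = \<zero>\<^bsub>Q\<^esub>"
  using q_zero_iff J_carrier by blast

text \<open>In the coproduct of an element of \<open>J\<close> every pure tensor has a factor that
  \<open>q\<close> sends to zero. This makes the quotient coproduct independent of
  representatives.\<close>

lemma push_J:
  assumes "x \<in> J"
  shows "push (comult H x) = 0"
proof
  fix \<beta>
  have "comult H x \<in> tensors H (J \<times> carrier H \<union> carrier H \<times> J)"
    using J assms by (auto simp: hopf_ideal_def)
  then obtain xs where xs: "set xs \<subseteq> J \<times> carrier H \<union> carrier H \<times> J" "comult H x = tensor_of H xs"
    by (auto simp: tensors_def)
  have "\<beta> (q (fst p)) (q (snd p)) = 0" if \<beta>: "bilinear_form Q \<beta>" and p: "p \<in> set xs" for p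
  proof -
    have "fst p \<in> J \<and> snd p \<in> carrier H \<or> fst p \<in> carrier H \<and> snd p \<in> J"
      using xs(1) p by auto
    moreover have "\<beta> \<zero>\<^bsub>Q\<^esub> c = 0" "\<beta> c \<zero>\<^bsub>Q\<^esub> = 0" if "c \<in> carrier Q" for c
      using \<beta> that linear_form_zero[OF vecQ, of "\<lambda>x. \<beta> x c"] linear_form_zero[OF vecQ, of "\<beta> c"]
      by (auto simp: bilinear_form_def)
    ultimately show ?thesis
      by (auto simp: q_J)
  qed
  then show "push (comult H x) \<beta> = 0 \<beta>"
    unfolding xs(2) push_tensor_of by (simp add: tensor_of_def o_def split_def cong: map_cong)
qed

lemma minus_add: "x \<in> carrier H \<Longrightarrow> y \<in> carrier H \<Longrightarrow> y = (y \<ominus> x) \<oplus> x"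
  by (simp add: a_minus_def a_assoc l_neg)

lemma push_cong:
  assumes "x \<in> carrier H" "y \<in> carrier H" "q y = q x"
  shows "push (comult H y) = push (comult H x)"
proof -
  have "y \<ominus> x \<in> J"
    using assms q_eq_iff by blast
  then have "push (comult H ((y \<ominus> x) \<oplus> x)) = push (comult H x)"
    using assms by (simp add: comult_add push_add push_J J_carrier)
  then show ?thesis
    using minus_add[OF assms(1,2)] by simp
qed

text \<open>The quotient coproduct is defined over the smaller record; tensors see only the carrier,
  addition and scalar multiplication, which both records share.\<close>

lemma tensor_of_quot_module: "tensor_of (quot_module H J) = tensor_of Q"
  by (simp add: tensor_of_def[abs_def] bilinear_form_def linear_form_def Q_fields)
    (simp add: quot_module_def)

text \<open>Trades the lift in the definition of the quotient coproduct for \<open>push\<close>,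
  which can be evaluated without a representing list.\<close>

lemma comult_lift:
  assumes x: "x \<in> carrier H"
  shows "tensor_lift H 0 (+) (\<lambda>a b. tensor_of (quot_module H J) [(q a, q b)]) (comult H x) = push (comult H x)"
proof -
  have "bilin_typ H (\<lambda>c g \<beta>. c * g \<beta>) (\<lambda>a b. tensor_of Q [(q a, q b)])"
    unfolding bilin_typ_pointwise
  proof
    fix \<beta> :: "'a set \<Rightarrow> 'a set \<Rightarrow> 'k"
    show "bilin_typ H (*) (\<lambda>a b. tensor_of Q [(q a, q b)] \<beta>)"
    proof (cases "bilinear_form Q \<beta>")
      case True
      then show ?thesis
        using bilinear_form_Q_iff[of \<beta>]
        by (simp add: tensor_of_def bilin_typ_bilinear_form[symmetric])
    qed (simp add: tensor_of_def bilin_typ_def)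
  qed
  from tensor_lift_typ[OF vector_space_pointwise_smult this cop(1)[OF x]]
  have "tensor_lift H 0 (+) (\<lambda>a b. tensor_of Q [(q a, q b)]) (comult H x) =
      (\<Sum>(x, y)\<leftarrow>qq (cop x). tensor_of Q [(x, y)])"
    by (simp add: cop(2)[OF x, symmetric] split_def o_def)
  also have "\<dots> = tensor_of Q (qq (cop x))"
    by (rule tensor_of_sum_list[symmetric])
  also have "\<dots> = push (comult H x)"
    by (simp add: cop(2)[OF x] push_tensor_of)
  finally show ?thesis
    by (simp add: tensor_of_quot_module)
qed

lemma comult_Q:
  assumes x: "x \<in> carrier H"
  shows "comult Q (q x) = push (comult H x)"
proof -
  have "comult Q (q x) = (THE t. \<exists>y\<in>q x. t = push (comult H y))"
    unfolding Q_fields using coset_mem[OF x] by (simp add: comult_lift cong: bex_cong)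
  also have "\<dots> = push (comult H x)"
    using push_cong[OF x] by (intro coset_the[OF x]) auto
  finally show ?thesis .
qed

lemma comult_Q_rep:
  assumes x: "x \<in> carrier H"
  shows "comult Q (q x) = tensor_of Q (qq (cop x))"
  by (simp add: comult_Q x cop(2) push_tensor_of)

lemma counit_Q:
  assumes x: "x \<in> carrier H"
  shows "counit Q (q x) = counit H x"
  unfolding Q_fields
proof (rule coset_the[OF x])
  fix y assume y: "y \<in> carrier H" "q y = q x"
  then have "counit H (y \<ominus> x) = 0"
    using J q_eq_iff x by (auto simp: hopf_ideal_def)
  moreover have "counit H ((y \<ominus> x) \<oplus> x) = counit H (y \<ominus> x) + counit H x"
    using counit_linear x y by (simp add: linear_form_def)
  ultimately show "counit H y = counit H x"
    using minus_add[OF x y(1)] by simp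
qed

lemma antipode_Q:
  assumes x: "x \<in> carrier H"
  shows "antipode Q (q x) = q (antipode H x)"
  unfolding Q_fields
proof (rule coset_union[OF x])
  fix y assume y: "y \<in> carrier H" "q y = q x"
  then have "y \<ominus> x \<in> J"
    using q_eq_iff x by blast
  then have "antipode H (y \<ominus> x) \<in> J"
    using J by (auto simp: hopf_ideal_def)
  moreover have "antipode H (y \<ominus> x) = antipode H y \<ominus> antipode H x"
    using x y by (simp add: a_minus_def vec_a_inv[OF vecH] antipode_linear)
  ultimately show "q (antipode H y) = q (antipode H x)"
    using x y by (simp add: q_eq_iff)
qed

sublocale Qc: precoalg Q
proof (rule precoalg.intro)
  fix C D c assume C: "C \<in> carrier Q"
  then obtain x where x: "x \<in> carrier H" "C = q x"
    by (rule Q_carrierE)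
  show "comult Q C \<in> tensors Q (carrier Q \<times> carrier Q)"
    using qq_carrier[OF cop(1)[OF x(1)]] comult_Q_rep[OF x(1)] x(2) unfolding tensors_def by blast
  show "comult Q (c \<odot>\<^bsub>Q\<^esub> C) = (\<lambda>\<beta>. c * comult Q C \<beta>)"
    using x by (simp add: Q_smult comult_Q comult_smult push_smult)
  assume "D \<in> carrier Q"
  then obtain y where y: "y \<in> carrier H" "D = q y"
    by (rule Q_carrierE)
  then show "comult Q (C \<oplus>\<^bsub>Q\<^esub> D) = comult Q C + comult Q D"
    using x by (simp add: Q_ops comult_Q comult_add push_add)
qed (rule vecQ)

lemma q_foldr:
  assumes "set xs \<subseteq> carrier H \<times> carrier H"
    and "\<And>a b. a \<in> carrier H \<Longrightarrow> b \<in> carrier H \<Longrightarrow> g a b \<in> carrier H"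
    and "\<And>a b. a \<in> carrier H \<Longrightarrow> b \<in> carrier H \<Longrightarrow> f (q a) (q b) = q (g a b)"
  shows "foldr (\<lambda>(a, b). add Q (f a b)) (qq xs) \<zero>\<^bsub>Q\<^esub> = q (foldr (\<lambda>(a, b). add H (g a b)) xs \<zero>)"
  using assms(1)
proof (induction xs)
  case Nil
  then show ?case by (simp add: Q_ops)
next
  case (Cons p xs)
  have "foldr (\<lambda>(a, b). add H (g a b)) xs \<zero> \<in> carrier H"
    using Cons.prems by (intro foldr_closed[OF vecH _ assms(2)]) auto
  then show ?case
    using Cons assms(2,3) by (auto simp: Q_ops split_def)
qed

text \<open>Lifts over the quotient are computed on the image of \<open>cop x\<close>; this
  transports the counit and antipode axioms from \<open>H\<close>.\<close>

lemma lift_Q: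
  assumes x: "x \<in> carrier H" and g: "bilin H H g"
    and f: "\<And>a b. a \<in> carrier H \<Longrightarrow> b \<in> carrier H \<Longrightarrow> f (q a) (q b) = q (g a b)"
  shows "tensor_lift Q \<zero>\<^bsub>Q\<^esub> (add Q) f (comult Q (q x)) = q (foldr (\<lambda>(a, b). add H (g a b)) (cop x) \<zero>)"
proof -
  have gc: "\<And>a b. a \<in> carrier H \<Longrightarrow> b \<in> carrier H \<Longrightarrow> g a b \<in> carrier H"
    using g by (simp add: bilin_def)
  have "bilin Q Q f"
    by (rule bilin_Q[where f = f and g = g]) (use g f in auto)
  from tensor_lift_tensor_of[OF vecQ this qq_carrier[OF cop(1)[OF x]]]
  show ?thesis
    unfolding comult_Q_rep[OF x] using q_foldr[where f = f and g = g, OF cop(1)[OF x] gc f] by simp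
qed

text \<open>The list chosen over the quotient is unrelated to the image of \<open>cop x\<close>, but
  both represent the same tensor and so agree on bilinear forms.\<close>

lemma comult_Q_form:
  assumes "x \<in> carrier H" "bilinear_form Q \<beta>"
  shows "(\<Sum>p\<leftarrow>Qc.cop (q x). \<beta> (fst p) (snd p)) = (\<Sum>p\<leftarrow>cop x. \<beta> (q (fst p)) (q (snd p)))"
  using Qc.comult_eval[of "q x" \<beta>] assms bilinear_form_Q_iff[of \<beta>] comult_eval[of x "\<lambda>x y. \<beta> (q x) (q y)"]
  by (simp add: comult_Q push_def)

lemma coassoc_Q:
  assumes x: "x \<in> carrier H" and \<tau>: "trilinear_form Q \<tau>"
  shows "(\<Sum>p\<leftarrow>Qc.cop (q x). comult Q (fst p) (\<lambda>a b. \<tau> a b (snd p))) =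
    (\<Sum>p\<leftarrow>Qc.cop (q x). comult Q (snd p) (\<lambda>a b. \<tau> (fst p) a b))"
proof -
  have \<tau>H: "trilinear_form H (\<lambda>x y z. \<tau> (q x) (q y) (q z))"
    using \<tau> trilinear_form_Q_iff by blast
  have bil: "bilinear_form Q (\<lambda>a b. \<tau> a b (q z))" "bilinear_form Q (\<lambda>a b. \<tau> (q z) a b)"
    if "z \<in> carrier H" for z
    using \<tau> that by (auto simp: trilinear_form_def)
  have "(\<Sum>p\<leftarrow>Qc.cop (q x). comult Q (fst p) (\<lambda>a b. \<tau> a b (snd p))) =
      (\<Sum>p\<leftarrow>cop x. comult Q (q (fst p)) (\<lambda>a b. \<tau> a b (q (snd p))))"
    by (rule comult_Q_form[OF x Qc.nested_lift(3)[OF q_closed[OF x] \<tau>]])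
  also have "\<dots> = (\<Sum>p\<leftarrow>cop x. comult H (fst p) (\<lambda>a b. \<tau> (q a) (q b) (q (snd p))))"
    using cop_carrier[OF x] by (simp add: comult_Q push_def bil cong: map_cong)
  also have "\<dots> = (\<Sum>p\<leftarrow>cop x. comult H (snd p) (\<lambda>a b. \<tau> (q (fst p)) (q a) (q b)))"
    by (rule coassoc[OF x \<tau>H])
  also have "\<dots> = (\<Sum>p\<leftarrow>cop x. comult Q (q (snd p)) (\<lambda>a b. \<tau> (q (fst p)) a b))"
    using cop_carrier[OF x] by (simp add: comult_Q push_def bil cong: map_cong)
  also have "\<dots> = (\<Sum>p\<leftarrow>Qc.cop (q x). comult Q (snd p) (\<lambda>a b. \<tau> (fst p) a b))"
    by (rule comult_Q_form[OF x Qc.nested_lift(4)[OF q_closed[OF x] \<tau>], symmetric])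
  finally show ?thesis .
qed

lemma coalgebra_Q: "coalgebra Q"
  unfolding coalgebra_def
proof (intro conjI ballI allI)
  show "comult Q ` carrier Q \<subseteq> tensors Q (carrier Q \<times> carrier Q)"
    using Qc.comult_tensors by blast
  show "linear_form Q (counit Q)"
    using counit_linear by (simp add: linear_form_Q_iff) (simp add: linear_form_def counit_Q)
  fix C assume C: "C \<in> carrier Q"
  then obtain x where x: "x \<in> carrier H" "C = q x"
    by (rule Q_carrierE)
  show "tensor_lift Q 0 (+)
      (\<lambda>a b. tensor_lift Q 0 (+) (\<lambda>a' a''. pure_tensor3 Q a' a'' b) (comult Q a)) (comult Q C) =
    tensor_lift Q 0 (+)
      (\<lambda>a b. tensor_lift Q 0 (+) (\<lambda>b' b''. pure_tensor3 Q a b' b'') (comult Q b)) (comult Q C)"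
    unfolding Qc.nested_lift(1,2)[OF C] using coassoc_Q[OF x(1)] x(2) by auto
  show "tensor_lift Q \<zero>\<^bsub>Q\<^esub> (add Q) (\<lambda>a b. counit Q a \<odot>\<^bsub>Q\<^esub> b) (comult Q C) = C"
    unfolding x(2) by (subst lift_Q[OF x(1) bilin_counit_left]) (simp_all add: counit_Q Q_smult foldr_counit_left x)
  show "tensor_lift Q \<zero>\<^bsub>Q\<^esub> (add Q) (\<lambda>a b. counit Q b \<odot>\<^bsub>Q\<^esub> a) (comult Q C) = C"
    unfolding x(2) by (subst lift_Q[OF x(1) bilin_counit_right]) (simp_all add: counit_Q Q_smult foldr_counit_right x)
qed (auto simp: vecQ Qc.comult_add Qc.comult_smult)

lemma hopf_algebra_Q: "hopf_algebra Q"
  unfolding hopf_algebra_def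
proof (intro conjI ballI allI)
  have 1: "comult H \<one> = tensor_of H [(\<one>, \<one>)]"
    using hopf by (simp add: hopf_algebra_def)
  show "comult Q \<one>\<^bsub>Q\<^esub> = tensor_of Q [(\<one>\<^bsub>Q\<^esub>, \<one>\<^bsub>Q\<^esub>)]"
    unfolding Q_ops by (simp add: comult_Q 1 push_tensor_of)
  show "counit Q \<one>\<^bsub>Q\<^esub> = 1"
    unfolding Q_ops by (simp add: counit_Q)
  show "antipode Q \<in> carrier Q \<rightarrow> carrier Q"
    by (auto simp: antipode_Q elim!: Q_carrierE)
  fix C assume "C \<in> carrier Q"
  then obtain x where x: "x \<in> carrier H" "C = q x"
    by (rule Q_carrierE)
  show "antipode Q (c \<odot>\<^bsub>Q\<^esub> C) = c \<odot>\<^bsub>Q\<^esub> antipode Q C" for c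
    using x by (simp add: Q_smult antipode_Q antipode_linear)
  show "tensor_lift Q \<zero>\<^bsub>Q\<^esub> (add Q) (\<lambda>a b. antipode Q a \<otimes>\<^bsub>Q\<^esub> b) (comult Q C) = counit Q C \<odot>\<^bsub>Q\<^esub> \<one>\<^bsub>Q\<^esub>"
    unfolding x(2) by (subst lift_Q[OF x(1) bilin_antipode_left])
      (simp_all add: antipode_Q Q_ops(1) counit_Q Q_ops(3) Q_smult foldr_antipode_left x)
  show "tensor_lift Q \<zero>\<^bsub>Q\<^esub> (add Q) (\<lambda>a b. a \<otimes>\<^bsub>Q\<^esub> antipode Q b) (comult Q C) = counit Q C \<odot>\<^bsub>Q\<^esub> \<one>\<^bsub>Q\<^esub>"
    unfolding x(2) by (subst lift_Q[OF x(1) bilin_antipode_right])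
      (simp_all add: antipode_Q Q_ops(1) counit_Q Q_ops(3) Q_smult foldr_antipode_right x)
  fix D assume "D \<in> carrier Q"
  then obtain y where y: "y \<in> carrier H" "D = q y"
    by (rule Q_carrierE)
  show "counit Q (C \<otimes>\<^bsub>Q\<^esub> D) = counit Q C * counit Q D"
    using x y by (simp add: Q_ops counit_Q counit_mult)
  show "antipode Q (C \<oplus>\<^bsub>Q\<^esub> D) = antipode Q C \<oplus>\<^bsub>Q\<^esub> antipode Q D"
    using x y by (simp add: Q_ops antipode_Q antipode_linear)
  let ?zs = "concat (map (\<lambda>p. map (\<lambda>r. (fst p \<otimes> fst r, snd p \<otimes> snd r)) (cop y)) (cop x))"
  have "comult Q (C \<otimes>\<^bsub>Q\<^esub> D) = tensor_of Q (qq ?zs)"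
    using x y by (simp add: Q_ops comult_Q comult_mult push_tensor_of)
  also have "\<dots> = (\<Sum>p\<leftarrow>cop x. \<Sum>r\<leftarrow>cop y. tensor_of Q [(q (fst p \<otimes> fst r), q (snd p \<otimes> snd r))])"
    by (subst tensor_of_sum_list) (simp add: map_concat o_def sum_list_concat split_def)
  also have "\<dots> = (\<Sum>p\<leftarrow>qq (cop x). \<Sum>r\<leftarrow>qq (cop y). tensor_of Q [(fst p \<otimes>\<^bsub>Q\<^esub> fst r, snd p \<otimes>\<^bsub>Q\<^esub> snd r)])"
    using cop_carrier[OF x(1)] cop_carrier[OF y(1)] by (simp add: o_def Q_ops(1) cong: map_cong)
  also have "\<dots> = tensor_mult Q (comult Q C) (comult Q D)"
    unfolding x(2) y(2) comult_Q_rep[OF x(1)] comult_Q_rep[OF y(1)]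
    by (rule tensor_mult_tensor_of[OF unital_algebra_Q, symmetric]) (use cop(1)[OF x(1)] cop(1)[OF y(1)] in \<open>auto intro!: q_closed\<close>)
  finally show "comult Q (C \<otimes>\<^bsub>Q\<^esub> D) = tensor_mult Q (comult Q C) (comult Q D)" .
qed (auto simp: unital_algebra_Q coalgebra_Q)

end

subsection \<open>Graded quotients\<close>

lemma finsum_superset:
  assumes "abelian_group M" "finite A" "B \<subseteq> A" "\<And>i. i \<in> A \<Longrightarrow> f i \<in> carrier M"
    "\<And>i. i \<in> A - B \<Longrightarrow> f i = \<zero>\<^bsub>M\<^esub>"
  shows "finsum M f A = finsum M f B"
proof -
  interpret abelian_group M by (rule assms)
  have "finite B"
    using assms(2,3) by (rule rev_finite_subset)
  have "finsum M f (B \<union> C) = finsum M f B" if "finite C" "C \<subseteq> A - B" for C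
    using that
  proof (induction C rule: finite_induct)
    case (insert c C)
    have "finsum M f (insert c (B \<union> C)) = f c \<oplus>\<^bsub>M\<^esub> finsum M f (B \<union> C)"
      using insert assms(3,4) \<open>finite B\<close> by (intro finsum_insert) auto
    then show ?case
      using insert assms by (auto intro!: l_zero finsum_closed)
  qed simp
  from this[of "A - B"] show ?thesis
    using assms(2,3) by (simp add: Un_absorb1)
qed

text \<open>Allows any finite set containing the support, so that two decompositions can be summed
  over one index set and images may acquire further zeros.\<close>

lemma homogeneous_decomposition_iff:
  assumes "abelian_group M" "finite A" "\<And>n. f n \<in> Mn n" "\<And>n. Mn n \<subseteq> carrier M"
    "\<And>n. n \<notin> A \<Longrightarrow> f n = \<zero>\<^bsub>M\<^esub>"
  shows "homogeneous_decomposition M Mn x f \<longleftrightarrow> x = finsum M f A"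
proof -
  have sub: "{n. f n \<noteq> \<zero>\<^bsub>M\<^esub>} \<subseteq> A"
    using assms(5) by auto
  have "finsum M f A = finsum M f {n. f n \<noteq> \<zero>\<^bsub>M\<^esub>}"
    by (rule finsum_superset[OF assms(1,2) sub]) (use assms(3,4) in auto)
  then show ?thesis
    using assms(3) finite_subset[OF sub assms(2)] by (auto simp: homogeneous_decomposition_def)
qed

context hopf_quot
begin

lemma q_finsum:
  assumes "finite A" "\<And>i. i \<in> A \<Longrightarrow> h i \<in> carrier H"
  shows "q (finsum H h A) = finsum Q (\<lambda>i. q (h i)) A"
proof -
  interpret R: ring Q by (rule ring_Q)
  show ?thesis
    using assms
    by (induction A rule: finite_induct)
      (auto simp: Q_ops(4) Q_ops(2)[symmetric] finsum_insert R.finsum_insert Pi_iff finsum_closed)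
qed

context
  fixes Hn
  assumes graded: "graded_connected_hopf H Hn" and hom: "homogeneous_ideal H Hn J"
begin

lemma Hn_submodule: "submodule (Hn n) (ring_of_type_algebra :: 'k ring) H"
  using graded by (simp add: graded_connected_hopf_def direct_sum_decomposition_def)

lemma Hn_closed:
  "Hn n \<subseteq> carrier H" "\<zero> \<in> Hn n" "x \<in> Hn n \<Longrightarrow> c \<odot> x \<in> Hn n"
  "x \<in> Hn n \<Longrightarrow> y \<in> Hn n \<Longrightarrow> x \<oplus> y \<in> Hn n" "x \<in> Hn n \<Longrightarrow> y \<in> Hn n \<Longrightarrow> x \<ominus> y \<in> Hn n"
proof -
  interpret M: module "ring_of_type_algebra :: 'k ring" H by (rule vecH)
  note E = M.submoduleE[OF Hn_submodule[of n]]
  show sub: "Hn n \<subseteq> carrier H" and sm: "x \<in> Hn n \<Longrightarrow> c \<odot> x \<in> Hn n" for x c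
    using E(1,4) by auto
  show "x \<in> Hn n \<Longrightarrow> y \<in> Hn n \<Longrightarrow> x \<oplus> y \<in> Hn n" "x \<in> Hn n \<Longrightarrow> y \<in> Hn n \<Longrightarrow> x \<ominus> y \<in> Hn n"
    using E(3,5) by (auto simp: a_minus_def)
  obtain x where "x \<in> Hn n" using E(2) by blast
  then have "0 \<odot> x \<in> Hn n" "x \<in> carrier H"
    using sm sub by auto
  then show "\<zero> \<in> Hn n"
    using vec_smult_zero_left[OF vecH] by metis
qed

lemma Qn_decomposition_exists:
  assumes "C \<in> carrier Q"
  shows "\<exists>f. homogeneous_decomposition Q (\<lambda>n. q ` Hn n) C f"
proof -
  obtain x where x: "x \<in> carrier H" "C = q x"
    using assms by (rule Q_carrierE)
  have "direct_sum_decomposition H Hn"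
    using graded by (simp add: graded_connected_hopf_def)
  then have "\<exists>!f. homogeneous_decomposition H Hn x f"
    using x by (simp add: direct_sum_decomposition_def)
  then obtain h where h: "homogeneous_decomposition H Hn x h"
    by blast
  let ?A = "{n. h n \<noteq> \<zero>}"
  have hn: "h n \<in> Hn n" "finite ?A" "x = finsum H h ?A" for n
    using h by (auto simp: homogeneous_decomposition_def)
  have "C = finsum Q (\<lambda>n. q (h n)) ?A"
    unfolding x(2) hn(3) using hn(1) Hn_closed(1) by (subst q_finsum[OF hn(2)]) auto
  then have "homogeneous_decomposition Q (\<lambda>n. q ` Hn n) C (\<lambda>n. q (h n))"
    using hn Hn_closed(1)
    by (subst homogeneous_decomposition_iff[OF ring.is_abelian_group[OF ring_Q] hn(2)])
      (auto simp: Q_ops Q_carrier)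
  then show ?thesis by blast
qed

text \<open>Zero components are lifted to zero, which keeps the support finite.\<close>

lemma Qn_lift:
  assumes "homogeneous_decomposition Q (\<lambda>n. q ` Hn n) C f"
  shows "\<exists>h. (\<forall>n. h n \<in> Hn n \<and> f n = q (h n) \<and> (f n = \<zero>\<^bsub>Q\<^esub> \<longrightarrow> h n = \<zero>))"
proof -
  have "\<exists>y. y \<in> Hn n \<and> f n = q y \<and> (f n = \<zero>\<^bsub>Q\<^esub> \<longrightarrow> y = \<zero>)" for n
  proof (cases "f n = \<zero>\<^bsub>Q\<^esub>")
    case True
    then show ?thesis
      using Hn_closed(2) Q_ops(4) by auto
  next
    case False
    then show ?thesis
      using assms by (auto simp: homogeneous_decomposition_def)
  qed
  then show ?thesis by metis
qed

text \<open>The difference of two lifted decompositions decomposes an element of \<open>J\<close>;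
  by homogeneity its components lie in \<open>J\<close>, so the lifts agree modulo
  \<open>J\<close>.\<close>

lemma Qn_decomposition_unique:
  assumes f: "homogeneous_decomposition Q (\<lambda>n. q ` Hn n) C f"
    and f': "homogeneous_decomposition Q (\<lambda>n. q ` Hn n) C f'"
  shows "f = f'"
proof
  fix n
  obtain h where "\<forall>n. h n \<in> Hn n \<and> f n = q (h n) \<and> (f n = \<zero>\<^bsub>Q\<^esub> \<longrightarrow> h n = \<zero>)"
    using Qn_lift[OF f] by (rule exE)
  then have h: "\<And>n. h n \<in> Hn n" "\<And>n. f n = q (h n)" "\<And>n. f n = \<zero>\<^bsub>Q\<^esub> \<Longrightarrow> h n = \<zero>"
    by blast+
  obtain h' where "\<forall>n. h' n \<in> Hn n \<and> f' n = q (h' n) \<and> (f' n = \<zero>\<^bsub>Q\<^esub> \<longrightarrow> h' n = \<zero>)"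
    using Qn_lift[OF f'] by (rule exE)
  then have h': "\<And>n. h' n \<in> Hn n" "\<And>n. f' n = q (h' n)" "\<And>n. f' n = \<zero>\<^bsub>Q\<^esub> \<Longrightarrow> h' n = \<zero>"
    by blast+
  define A where "A = {n. f n \<noteq> \<zero>\<^bsub>Q\<^esub>} \<union> {n. f' n \<noteq> \<zero>\<^bsub>Q\<^esub>}"
  have A: "finite A"
    using f f' by (simp add: A_def homogeneous_decomposition_def)
  have cl: "h n \<in> carrier H" "h' n \<in> carrier H" for n
    using h(1) h'(1) Hn_closed(1) by auto
  have Qsub: "q ` Hn n \<subseteq> carrier Q" for n
    using Hn_closed(1) by (auto simp: Q_carrier)
  have CA: "C = finsum Q f A" "C = finsum Q f' A"
    using f f' homogeneous_decomposition_iff[OF ring.is_abelian_group[OF ring_Q] A, of _ "\<lambda>n. q ` Hn n"]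
      Qsub h h' by (auto simp: A_def)
  have ff: "f = (\<lambda>n. q (h n))" "f' = (\<lambda>n. q (h' n))"
    using h(2) h'(2) by blast+
  have C: "C = q (finsum H h A)" "C = q (finsum H h' A)"
    using CA unfolding ff by (simp_all add: q_finsum[OF A] cl)
  define d where "d n = h n \<ominus> h' n" for n
  have d: "d n \<in> Hn n" for n
    unfolding d_def by (rule Hn_closed(5)[OF h(1) h'(1)])
  have dc: "d n \<in> carrier H" for n
    using d Hn_closed(1) by blast
  have "finsum H h A = finsum H (\<lambda>n. d n \<oplus> h' n) A"
    using minus_add[OF cl(2) cl(1)] by (simp add: d_def)
  also have "\<dots> = finsum H d A \<oplus> finsum H h' A"
    using dc cl by (intro finsum_addf) auto
  finally have "finsum H h A = finsum H d A \<oplus> finsum H h' A" .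
  moreover have fc: "finsum H d A \<in> carrier H" "finsum H h' A \<in> carrier H" "finsum H h A \<in> carrier H"
    using dc cl by (auto intro: finsum_closed)
  ultimately have "finsum H h A \<ominus> finsum H h' A = finsum H d A"
    by (simp add: a_minus_def a_assoc r_neg)
  then have "finsum H d A \<in> J"
    using C q_eq_iff fc by metis
  moreover have "homogeneous_decomposition H Hn (finsum H d A) d"
    using d Hn_closed(1) h(3) h'(3) A
    by (subst homogeneous_decomposition_iff[OF is_abelian_group A]) (auto simp: d_def A_def a_minus_def)
  ultimately have "d n \<in> J"
    using hom by (auto simp: homogeneous_ideal_def)
  then show "f n = f' n"
    unfolding h(2) h'(2) using q_eq_iff cl by (simp add: d_def)
qed

lemma graded_connected_Q: "graded_connected_hopf Q (\<lambda>n. q ` Hn n)"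
  unfolding graded_connected_hopf_def direct_sum_decomposition_def
proof (intro conjI allI ballI impI)
  interpret MQ: module "ring_of_type_algebra :: 'k ring" Q by (rule vecQ)
  show "submodule (q ` Hn n) (ring_of_type_algebra :: 'k ring) Q" for n
  proof (rule MQ.submoduleI)
    show "q ` Hn n \<subseteq> carrier Q"
      using Hn_closed(1) by (auto simp: Q_carrier)
    show "\<zero>\<^bsub>Q\<^esub> \<in> q ` Hn n"
      using Hn_closed(2) by (auto simp: Q_ops)
    have sm: "c \<odot>\<^bsub>Q\<^esub> a \<in> q ` Hn n" if "a \<in> q ` Hn n" for c a
      using that Hn_closed(1,3) by (auto simp: Q_smult subset_iff)
    then show "c \<odot>\<^bsub>Q\<^esub> a \<in> q ` Hn n" if "a \<in> q ` Hn n" for c a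
      using that by blast
    show "\<ominus>\<^bsub>Q\<^esub> a \<in> q ` Hn n" if a: "a \<in> q ` Hn n" for a
    proof -
      have "a \<in> carrier Q"
        using a Hn_closed(1) by (auto simp: Q_carrier)
      then show ?thesis
        using sm[OF a] by (simp add: vec_a_inv[OF vecQ])
    qed
    show "a \<oplus>\<^bsub>Q\<^esub> b \<in> q ` Hn n" if "a \<in> q ` Hn n" "b \<in> q ` Hn n" for a b
      using that Hn_closed(1,4) by (auto simp: Q_ops subset_iff)
  qed
  show "\<exists>!f. homogeneous_decomposition Q (\<lambda>n. q ` Hn n) C f" if "C \<in> carrier Q" for C
    using Qn_decomposition_exists[OF that] Qn_decomposition_unique by blast
  have 1: "\<one> \<in> Hn 0" and mul: "\<And>n m x y. x \<in> Hn n \<Longrightarrow> y \<in> Hn m \<Longrightarrow> x \<otimes> y \<in> Hn (n + m)"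
    and com: "\<And>n. comult H ` Hn n \<subseteq> tensors H (\<Union>i\<in>{..n}. Hn i \<times> Hn (n - i))"
    and cou: "\<And>n x. n \<ge> 1 \<Longrightarrow> x \<in> Hn n \<Longrightarrow> counit H x = 0"
    using graded by (auto simp: graded_connected_hopf_def)
  show "\<one>\<^bsub>Q\<^esub> \<in> q ` Hn 0"
    using 1 by (simp add: Q_ops)
  show "a \<otimes>\<^bsub>Q\<^esub> b \<in> q ` Hn (n + m)" if "a \<in> q ` Hn n" "b \<in> q ` Hn m" for n m a b
    using that mul Hn_closed(1) by (auto simp: Q_ops subset_iff)
  show "counit Q a = 0" if "1 \<le> n" "a \<in> q ` Hn n" for n a
    using that cou Hn_closed(1) by (auto simp: counit_Q subset_iff)
  show "comult Q ` (q ` Hn n) \<subseteq> tensors Q (\<Union>i\<in>{..n}. q ` Hn i \<times> q ` Hn (n - i))" for n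
  proof clarify
    fix x assume x: "x \<in> Hn n"
    then have "comult H x \<in> tensors H (\<Union>i\<in>{..n}. Hn i \<times> Hn (n - i))"
      using com by blast
    then obtain xs where xs: "set xs \<subseteq> (\<Union>i\<in>{..n}. Hn i \<times> Hn (n - i))" "comult H x = tensor_of H xs"
      by (auto simp: tensors_def)
    have "x \<in> carrier H"
      using x Hn_closed(1) by blast
    then have "comult Q (q x) = tensor_of Q (qq xs)"
      by (simp add: comult_Q xs(2) push_tensor_of)
    moreover have "set (qq xs) \<subseteq> (\<Union>i\<in>{..n}. q ` Hn i \<times> q ` Hn (n - i))"
    proof
      fix r assume "r \<in> set (qq xs)"
      then obtain p where p: "p \<in> set xs" "r = (q (fst p), q (snd p))"
        by auto
      then have "p \<in> (\<Union>i\<in>{..n}. Hn i \<times> Hn (n - i))"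
        using xs(1) by blast
      then obtain i where i: "i \<le> n" "p \<in> Hn i \<times> Hn (n - i)"
        by blast
      then show "r \<in> (\<Union>i\<in>{..n}. q ` Hn i \<times> q ` Hn (n - i))"
        unfolding p(2) by (intro UN_I[of i]) (auto simp: mem_Times_iff)
    qed
    ultimately show "comult Q (q x) \<in> tensors Q (\<Union>i\<in>{..n}. q ` Hn i \<times> q ` Hn (n - i))"
      unfolding tensors_def by blast
  qed
  obtain v where v: "v \<in> Hn 0" "Hn 0 = {c \<odot> v | c. True}"
    using graded unfolding graded_connected_hopf_def by blast
  have vc: "v \<in> carrier H"
    using v(1) Hn_closed(1) by blast
  \<comment> \<open>Otherwise \<open>J\<close> would contain the unit, on which the counit is
    1.\<close>
  have "v \<notin> J"
  proof
    assume "v \<in> J"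
    obtain c where "\<one> = c \<odot> v"
      using 1 v(2) by blast
    then have "\<one> \<in> J"
      using J_smult[OF \<open>v \<in> J\<close>] by simp
    then have "counit H \<one> = 0"
      using J unfolding hopf_ideal_def by blast
    then show False by simp
  qed
  then have "q v \<noteq> \<zero>\<^bsub>Q\<^esub>"
    using vc by (simp add: q_zero_iff)
  moreover have "q ` Hn 0 = {c \<odot>\<^bsub>Q\<^esub> q v | c. True}"
    using v(2) vc by (auto simp: Q_smult)
  ultimately show "\<exists>u\<in>q ` Hn 0. u \<noteq> \<zero>\<^bsub>Q\<^esub> \<and> q ` Hn 0 = {c \<odot>\<^bsub>Q\<^esub> u | c. True}"
    using v(1) by (intro bexI[of _ "q v"] conjI) auto
qed (rule hopf_algebra_Q)

end

end

section \<open>Character groups as topological groups\<close>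

text \<open>Collects the continuity statements that \<open>H\<close> and its quotient have in
  common.\<close>

locale lca_conv_alg = conv_alg H s
  for H :: "('k::real_or_complex, 'a) hopf" (structure)
    and s :: "'k \<Rightarrow> 'b \<Rightarrow> 'b::{comm_ring, comm_monoid_mult, t2_space}" +
  assumes lca: "locally_convex_algebra s"
begin

lemma sum_list_cont:
  "(\<And>p. p \<in> set xs \<Longrightarrow> continuous_on S (\<lambda>z. f z p)) \<Longrightarrow> continuous_on S (\<lambda>z. \<Sum>p\<leftarrow>xs. f z p :: 'b)"
  by (induction xs) (auto intro: continuous_on_binop[OF locally_convex_algebraD(3)[OF lca]])

lemma continuous_on_conv: "continuous_on (LH \<times> LH) (\<lambda>(\<phi>, \<psi>). \<phi> \<star> \<psi>)"
proof (rule continuous_on_coordinatewise_then_product)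
  fix x
  show "continuous_on (LH \<times> LH) (\<lambda>p. (case p of (\<phi>, \<psi>) \<Rightarrow> \<phi> \<star> \<psi>) x)"
  proof (cases "x \<in> carrier H")
    case True
    have "continuous_on (LH \<times> LH) (\<lambda>z. \<Sum>p\<leftarrow>cop x. fst z (fst p) * snd z (snd p))"
      by (intro sum_list_cont continuous_on_binop[OF locally_convex_algebraD(5)[OF lca]]
          continuous_on_product_then_coordinatewise[OF continuous_on_fst]
          continuous_on_product_then_coordinatewise[OF continuous_on_snd] continuous_on_id)
    then show ?thesis
      by (rule continuous_on_eq) (auto simp: conv_cop True)
  qed (simp add: conv_outside split_def)
qed

lemma continuous_on_inverse_char: "continuous_on S inverse_char"
proof (rule continuous_on_coordinatewise_then_product)
  show "continuous_on S (\<lambda>\<phi>. inverse_char \<phi> x)" for x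
    unfolding inverse_char_def
    by (cases "x \<in> carrier H") (auto intro: continuous_on_product_then_coordinatewise continuous_on_id)
qed

lemma topological_subgroup:
  assumes "\<And>\<phi>. \<phi> \<in> characters H s \<Longrightarrow> inverse_char \<phi> \<in> characters H s"
    and S: "subgroup S (char_group H s)"
  shows "topological_group (char_group H s\<lparr>carrier := S\<rparr>)"
proof -
  note G = char_group_groupI[OF assms(1)]
  have SC: "S \<subseteq> characters H s"
    using subgroup.subset[OF S] by (simp add: char_group_def)
  have SL: "S \<times> S \<subseteq> LH \<times> LH"
    using SC charactersD(1) by blast
  have "inverse_char \<phi> = inv\<^bsub>char_group H s\<lparr>carrier := S\<rparr>\<^esub> \<phi>" if "\<phi> \<in> S" for \<phi>
    using group.m_inv_consistent[OF G(1) S that] G(2) SC that by auto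
  then have "continuous_on S (\<lambda>\<phi>. inv\<^bsub>char_group H s\<lparr>carrier := S\<rparr>\<^esub> \<phi>)"
    by (intro continuous_on_eq[OF continuous_on_inverse_char]) auto
  moreover have "continuous_on (S \<times> S) (\<lambda>(\<phi>, \<psi>). \<phi> \<star> \<psi>)"
    by (rule continuous_on_subset[OF continuous_on_conv SL])
  ultimately show ?thesis
    using subgroup.subgroup_is_group[OF S G(1)]
    by (simp add: topological_group_def) (simp add: char_group_def)
qed

end

locale quot_lca = lca_hopf H s Hn + hopf_quot H J
  for H :: "('k::real_or_complex, 'a) hopf" (structure)
    and s :: "'k \<Rightarrow> 'b \<Rightarrow> 'b::{comm_ring, comm_monoid_mult, t2_space}" and Hn and J
begin

sublocale HL: lca_conv_alg H s
  by unfold_locales (rule lca)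

sublocale Qa: lca_conv_alg Q s
  by (intro lca_conv_alg.intro conv_alg.intro hopf_alg.intro conv_alg_axioms.intro
      lca_conv_alg_axioms.intro hopf_algebra_Q vs s_mult lca)

abbreviation "pull \<equiv> quot_pullback H J"
abbreviation "LQ \<equiv> lin_hom Q s"
abbreviation "AnnJ \<equiv> annihilator H J s"
abbreviation "SJ \<equiv> annihilator H J s \<inter> characters H s"

section \<open>Functionals on the quotient and functionals vanishing on \<open>J\<close>\<close>

definition rep :: "'a set \<Rightarrow> 'a" where
  "rep C = (SOME x. x \<in> carrier H \<and> C = q x)"

text \<open>The inverse of pullback on functionals vanishing on \<open>J\<close>. With
  representatives fixed in advance each value is a coordinate of \<open>\<psi>\<close> or zero, so
  continuity and analyticity are immediate.\<close>

definition descend :: "('a \<Rightarrow> 'b) \<Rightarrow> 'a set \<Rightarrow> 'b" where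
  "descend \<psi> = (\<lambda>C. if C \<in> carrier Q then \<psi> (rep C) else 0)"

lemma rep: "C \<in> carrier Q \<Longrightarrow> rep C \<in> carrier H \<and> q (rep C) = C"
  unfolding rep_def by (rule someI2_ex) (auto elim: Q_carrierE)

lemma pull_apply: "x \<in> carrier H \<Longrightarrow> pull \<phi> x = \<phi> (q x)"
  by (simp add: quot_pullback_def)

lemma pull_outside: "x \<notin> carrier H \<Longrightarrow> pull \<phi> x = 0"
  by (simp add: quot_pullback_def)

lemma pull_AnnJ:
  assumes "\<phi> \<in> LQ"
  shows "pull \<phi> \<in> AnnJ"
proof -
  have "pull \<phi> \<in> LH"
    using assms by (simp add: lin_hom_def pull_apply pull_outside Q_ops(2)[symmetric] Q_smult[symmetric])
  moreover have "pull \<phi> x = 0" if "x \<in> J" for x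
    using that lin_hom_zero[OF vecQ vs assms] by (simp add: pull_apply J_carrier q_J)
  ultimately show ?thesis
    by (simp add: annihilator_def)
qed

lemma pull_LH: "\<phi> \<in> LQ \<Longrightarrow> pull \<phi> \<in> LH"
  using pull_AnnJ annihilatorD(1) by blast

lemma LH_J_cong:
  assumes "\<psi> \<in> AnnJ" "x \<in> carrier H" "y \<in> carrier H" "q x = q y"
  shows "\<psi> x = \<psi> y"
proof -
  have "x \<ominus> y \<in> J"
    using assms q_eq_iff by blast
  then have "\<psi> ((x \<ominus> y) \<oplus> y) = \<psi> y"
    using assms annihilatorD[OF assms(1)] by (simp add: annihilatorD(2)[OF assms(1)] LH_add J_carrier)
  then show ?thesis
    using minus_add[OF assms(3,2)] by simp
qed

lemma descend_q: "\<psi> \<in> AnnJ \<Longrightarrow> x \<in> carrier H \<Longrightarrow> descend \<psi> (q x) = \<psi> x"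
  using LH_J_cong[of \<psi> "rep (q x)" x] rep[of "q x"] by (simp add: descend_def)

lemma descend_LQ:
  assumes "\<psi> \<in> AnnJ"
  shows "descend \<psi> \<in> LQ"
  unfolding lin_hom_def
  using annihilatorD(1)[OF assms] descend_q[OF assms]
  by (auto simp: Q_ops(2) Q_smult LH_add LH_smult elim!: Q_carrierE) (simp add: descend_def)

lemma pull_descend:
  assumes "\<psi> \<in> AnnJ"
  shows "pull (descend \<psi>) = \<psi>"
  by (rule LH_ext[OF pull_LH[OF descend_LQ[OF assms]] annihilatorD(1)[OF assms]])
    (simp add: pull_apply descend_q[OF assms])

lemma descend_pull:
  assumes "\<phi> \<in> LQ"
  shows "descend (pull \<phi>) = \<phi>"
  by (rule Qa.LH_ext[OF descend_LQ[OF pull_AnnJ[OF assms]] assms])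
    (auto simp: descend_q[OF pull_AnnJ[OF assms]] pull_apply elim!: Q_carrierE)

lemma pull_characters_iff:
  assumes "\<phi> \<in> LQ"
  shows "pull \<phi> \<in> characters H s \<longleftrightarrow> \<phi> \<in> characters Q s"
  using assms pull_LH[OF assms]
  by (auto simp: characters_def pull_apply Q_ops(1,3) Q_carrier)

lemma pull_infinitesimal_iff:
  assumes "\<phi> \<in> LQ"
  shows "pull \<phi> \<in> infs \<longleftrightarrow> \<phi> \<in> infinitesimal_characters Q s"
  using assms pull_LH[OF assms]
  by (auto simp: infinitesimal_characters_def pull_apply Q_ops(1) Q_carrier counit_Q)

lemma pull_unit_functionals: "\<phi> \<in> unit_functionals Q s \<Longrightarrow> pull \<phi> \<in> UF"
  by (simp add: unit_functionals_def pull_LH pull_apply Q_ops(3))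

text \<open>The image of \<open>cop x\<close> represents the coproduct of \<open>q x\<close>: the
  quotient map is a coalgebra map.\<close>

lemma pull_conv:
  assumes "\<phi> \<in> LQ" "\<psi> \<in> LQ"
  shows "pull (convolution Q \<phi> \<psi>) = convolution H (pull \<phi>) (pull \<psi>)"
proof (rule LH_ext)
  fix x assume x: "x \<in> carrier H"
  have "pull (convolution Q \<phi> \<psi>) x = (\<Sum>p\<leftarrow>qq (cop x). \<phi> (fst p) * \<psi> (snd p))"
    using Qa.conv_rep[OF assms q_closed[OF x] qq_carrier[OF cop(1)[OF x]] comult_Q_rep[OF x]]
    by (simp add: pull_apply x)
  also have "\<dots> = (\<Sum>p\<leftarrow>cop x. pull \<phi> (fst p) * pull \<psi> (snd p))"
    using cop_carrier[OF x] by (simp add: o_def pull_apply cong: map_cong)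
  also have "\<dots> = convolution H (pull \<phi>) (pull \<psi>) x"
    using assms x by (simp add: conv_cop pull_LH)
  finally show "pull (convolution Q \<phi> \<psi>) x = convolution H (pull \<phi>) (pull \<psi>) x" .
qed (auto intro: pull_LH conv_LH Qa.conv_LH assms)

lemma pull_eps: "pull Qa.eps = eps"
  by (auto simp: quot_pullback_def Qa.eps_def eps_def counit_Q)

lemma pull_inverse_char: "\<phi> \<in> LQ \<Longrightarrow> pull (Qa.inverse_char \<phi>) = inverse_char (pull \<phi>)"
  by (auto simp: quot_pullback_def Qa.inverse_char_def inverse_char_def antipode_Q)

lemma bij_pull: "bij_betw pull (characters Q s) SJ"
proof (rule bij_betwI[where g = descend])
  show "pull \<in> characters Q s \<rightarrow> SJ"
    using pull_AnnJ pull_characters_iff Qa.charactersD(1) by blast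
  show "descend \<in> SJ \<rightarrow> characters Q s"
    using descend_LQ pull_descend pull_characters_iff by (metis IntE Pi_I)
qed (auto simp: pull_descend descend_pull Qa.charactersD(1))

lemma Q_inverse_char:
  assumes "\<phi> \<in> characters Q s"
  shows "Qa.inverse_char \<phi> \<in> characters Q s"
proof -
  have L: "\<phi> \<in> LQ"
    by (rule Qa.charactersD(1)[OF assms])
  have "inverse_char (pull \<phi>) \<in> characters H s"
    using inverse_char_characters pull_characters_iff[OF L] assms by blast
  then show ?thesis
    using pull_characters_iff[OF Qa.inverse_char_LH[OF L]] by (simp add: pull_inverse_char[OF L])
qed

lemma pull_iso: "pull \<in> iso (char_group Q s) (char_group H s\<lparr>carrier := SJ\<rparr>)"
  using bij_pull bij_betw_imp_funcset[OF bij_pull]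
  by (auto simp: iso_def hom_def char_group_def pull_conv Qa.charactersD(1))

lemma continuous_on_pull: "continuous_on S pull"
proof (rule continuous_on_coordinatewise_then_product)
  show "continuous_on S (\<lambda>\<phi>. pull \<phi> x)" for x
    unfolding quot_pullback_def
    by (cases "x \<in> carrier H") (auto intro: continuous_on_product_then_coordinatewise continuous_on_id)
qed

lemma continuous_on_descend: "continuous_on S descend"
proof (rule continuous_on_coordinatewise_then_product)
  show "continuous_on S (\<lambda>\<psi>. descend \<psi> C)" for C
    unfolding descend_def
    by (cases "C \<in> carrier Q") (auto intro: continuous_on_product_then_coordinatewise continuous_on_id)
qed

lemma homeomorphic_pull: "homeomorphic_map (top_of_set (characters Q s)) (top_of_set SJ) pull"
proof -
  have "homeomorphic_maps (top_of_set (characters Q s)) (top_of_set SJ) pull descend"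
    using bij_betw_imp_funcset[OF bij_pull] descend_LQ pull_descend pull_characters_iff
    by (auto simp: homeomorphic_maps_def continuous_on_pull continuous_on_descend
        descend_pull Qa.charactersD(1)) metis
  then show ?thesis
    using homeomorphic_map_maps by blast
qed

lemma topological_group_iso_pull:
  "topological_group_iso (char_group Q s) (char_group H s\<lparr>carrier := SJ\<rparr>) pull"
proof -
  have "subgroup (carrier (char_group Q s)) (char_group Q s)"
    by (rule group.subgroup_self[OF Qa.char_group_groupI(1)[OF Q_inverse_char]])
  from Qa.topological_subgroup[OF Q_inverse_char this]
  have "topological_group (char_group Q s)" by simp
  moreover have "topological_group (char_group H s\<lparr>carrier := SJ\<rparr>)"
    by (rule HL.topological_subgroup[OF inverse_char_characters subgroup_annihilator[OF J]])
  ultimately show ?thesis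
    using pull_iso homeomorphic_pull
    by (simp add: topological_group_iso_def) (simp add: char_group_def)
qed

end

section \<open>The isomorphism of Lie groups\<close>

text \<open>Each coordinate of \<open>f\<close> is a single variable or zero, the form shared by
  \<open>pull\<close> and \<open>descend\<close>; complexification acts on real and imaginary parts
  separately.\<close>

lemma analytic_map_linear:
  fixes s :: "'k::real_or_complex \<Rightarrow> 'b \<Rightarrow> 'b::{comm_ring, comm_monoid_mult, t2_space}"
    and A :: "('x \<Rightarrow> 'b) set" and B :: "('i \<Rightarrow> 'b) set"
  assumes lca: "locally_convex_algebra s" and A: "lin_closed s A" and B: "lin_closed s B"
    and f: "\<And>\<phi>. f \<phi> = (\<lambda>i. if P i then \<phi> (r i) else 0)" "f ` A \<subseteq> B"
  shows "analytic_map (hom_scale s) (hom_scale s) A B A f"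
proof -
  let ?e = "\<lambda>i. if P i then PVar 0 (r i) else PZero"
  have dA: "dir A = A" and dB: "dir B = B"
    by (rule dir_lin_closed[OF lca A], rule dir_lin_closed[OF lca B])
  show ?thesis
  proof (rule analytic_map_polynomial[OF lca, where e = ?e])
    show "x + w \<in> A" if "x \<in> A" "w \<in> dir A" for x w
      using A that unfolding dA by (simp add: lin_closed_def[OF lca])
    show "f \<phi> = (\<lambda>i. revl (?e i) \<phi>)" for \<phi>
      by (auto simp: f(1))
    fix \<phi> \<psi> assume "\<phi> \<in> A" "\<psi> \<in> dir A"
    moreover have "(\<lambda>i. fst (cevl (?e i) (\<phi>, \<psi>))) = f \<phi>" "(\<lambda>i. snd (cevl (?e i) (\<phi>, \<psi>))) = f \<psi>"
      by (auto simp: f(1) cev_def)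
    ultimately show "(\<lambda>i. fst (cevl (?e i) (\<phi>, \<psi>))) \<in> B \<and> (\<lambda>i. snd (cevl (?e i) (\<phi>, \<psi>))) \<in> dir B"
      using f(2) unfolding dA dB by auto
  qed (use A B f(2) dA dB in auto)
qed

context quot_lca
begin

text \<open>Pullback respects convolution and so intertwines the two exponentials. In the logarithm
  charts it and its inverse become the linear maps \<open>pull\<close> and
  \<open>descend\<close>.\<close>

lemma lie_group_iso_pull:
  assumes graded: "graded_connected_hopf Q Qn"
  shows "lie_group_iso hs (unit_functionals Q s) (char_group Q s)
    hs UF (char_group H s\<lparr>carrier := SJ\<rparr>) pull"
proof -
  interpret G: lca_hopf Q s Qn
    by unfold_locales (rule graded, rule lca)
  have pull_inf: "pull v \<in> AnnJ \<inter> infs" if "v \<in> G.infs" for v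
    using that pull_AnnJ pull_infinitesimal_iff Qa.infinitesimalD(1) by blast
  have descend_inf: "descend w \<in> G.infs" "pull (descend w) = w" if "w \<in> AnnJ \<inter> infs" for w
    using that descend_LQ[of w] pull_descend[of w] pull_infinitesimal_iff[of "descend w"] by auto
  have pull_cpow: "pull (Qa.cpow v k) = cpow (pull v) k" if "v \<in> LQ" for v k
    using that by (induction k) (simp_all add: pull_eps pull_conv Qa.cpow_LH)
  have pull_Exp: "pull (G.Exp v) = Exp (pull v)" if v: "v \<in> G.infs" for v
  proof
    fix x
    note V = infinitesimal_van[OF IntD2[OF pull_inf[OF v]]]
    show "pull (G.Exp v) x = Exp (pull v) x"
    proof (cases "x \<in> carrier H")
      case True
      \<comment> \<open>The grading \<open>Qn\<close> is arbitrary, so the cutoffs at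
        \<open>x\<close> and at \<open>q x\<close> are unrelated and a common one is taken.\<close>
      let ?N = "dbound x + G.dbound (q x)"
      have "G.Exp v (q x) = (\<Sum>k\<le>?N. s (fps_nth (fps_exp 1) k) (Qa.cpow v k (q x)))"
        unfolding G.Exp_def by (rule G.fcalc_eq[OF G.infinitesimal_van[OF v]]) simp
      also have "\<dots> = (\<Sum>k\<le>?N. s (fps_nth (fps_exp 1) k) (cpow (pull v) k x))"
        using True by (simp add: pull_cpow[OF Qa.infinitesimalD(1)[OF v], symmetric] pull_apply)
      also have "\<dots> = Exp (pull v) x"
        unfolding Exp_def by (rule fcalc_eq[OF V, symmetric]) simp
      finally show ?thesis
        using True by (simp add: pull_apply)
    next
      case False
      then show ?thesis
        using LH_outside[OF fcalc_LH[OF V]] by (simp add: pull_outside Exp_def)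
    qed
  qed
  have charQ: "submanifold_chart hs (unit_functionals Q s) (characters Q s) (unit_functionals Q s) G.V1 G.Log G.infs"
    by (rule G.chart_characters)
  have charH: "submanifold_chart hs UF SJ UF V1 Log (AnnJ \<inter> infs)"
    by (rule chart_annihilator[OF J])
  have inv_pull: "inv_into (characters Q s) pull (pull \<phi>) = \<phi>" if "\<phi> \<in> characters Q s" for \<phi>
    using bij_pull that by (simp add: bij_betw_def inv_into_f_f)
  have "analytic_map hs hs G.infs (AnnJ \<inter> infs) G.infs pull"
    by (rule analytic_map_linear[OF lca G.lin_closed_infinitesimal lin_closed_annihilator,
          where P = "\<lambda>x. x \<in> carrier H" and r = q])
      (use pull_inf in \<open>auto simp: quot_pullback_def\<close>)
  then have an1: "analytic_map hs hs G.infs (AnnJ \<inter> infs) G.infs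
      (Log \<circ> pull \<circ> inv_into (unit_functionals Q s) G.Log)"
    by (rule analytic_map_cong)
      (use pull_inf infinitesimal_van in \<open>simp add: G.inv_into_Log G.infinitesimal_van pull_Exp Log_Exp\<close>)
  have "analytic_map hs hs (AnnJ \<inter> infs) G.infs (AnnJ \<inter> infs) descend"
    by (rule analytic_map_linear[OF lca lin_closed_annihilator G.lin_closed_infinitesimal,
          where P = "\<lambda>C. C \<in> carrier Q" and r = rep])
      (use descend_inf in \<open>auto simp: descend_def\<close>)
  then have an2: "analytic_map hs hs (AnnJ \<inter> infs) G.infs (AnnJ \<inter> infs)
      (G.Log \<circ> inv_into (characters Q s) pull \<circ> inv_into UF Log)"
  proof (rule analytic_map_cong)
    fix w assume w: "w \<in> AnnJ \<inter> infs"
    note D = descend_inf[OF w]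
    \<comment> \<open>Writing the point as a pullback of a character makes the inverse of
      \<open>pull\<close> computable there.\<close>
    have "inv_into UF Log w = pull (G.Exp (descend w))"
      using w by (simp add: inv_into_Log infinitesimal_van pull_Exp[OF D(1)] D(2))
    then show "descend w = (G.Log \<circ> inv_into (characters Q s) pull \<circ> inv_into UF Log) w"
      by (simp add: inv_pull G.Exp_characters D(1) G.Log_Exp G.infinitesimal_van)
  qed
  have 1: "analytic_map_submanifolds hs (unit_functionals Q s) (characters Q s) hs UF SJ pull"
    unfolding analytic_map_submanifolds_def
  proof (intro conjI ballI)
    show im: "pull ` characters Q s \<subseteq> SJ"
      using bij_pull by (simp add: bij_betw_def)
    fix \<phi> assume "\<phi> \<in> characters Q s"
    then show "\<exists>U1 W1 \<Phi>1 F1 U2 W2 \<Phi>2 F2.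
        \<phi> \<in> U1 \<and> submanifold_chart hs (unit_functionals Q s) (characters Q s) U1 W1 \<Phi>1 F1 \<and>
        pull \<phi> \<in> U2 \<and> submanifold_chart hs UF SJ U2 W2 \<Phi>2 F2 \<and>
        pull ` (U1 \<inter> characters Q s) \<subseteq> U2 \<and>
        analytic_map hs hs F1 F2 (W1 \<inter> F1) (\<Phi>2 \<circ> pull \<circ> inv_into U1 \<Phi>1)"
      using charQ charH an1 G.characters_UF pull_unit_functionals G.infs_V1
      by - (rule exI[of _ "unit_functionals Q s"], rule exI[of _ G.V1], rule exI[of _ G.Log],
          rule exI[of _ G.infs], rule exI[of _ UF], rule exI[of _ V1], rule exI[of _ Log],
          rule exI[of _ "AnnJ \<inter> infs"], auto simp: Int_absorb1)
  qed
  have 2: "analytic_map_submanifolds hs UF SJ hs (unit_functionals Q s) (characters Q s)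
      (inv_into (characters Q s) pull)"
    unfolding analytic_map_submanifolds_def
  proof (intro conjI ballI)
    have im: "inv_into (characters Q s) pull \<psi> \<in> characters Q s" if "\<psi> \<in> SJ" for \<psi>
      using that bij_pull by (metis bij_betw_def inv_into_into)
    then show "inv_into (characters Q s) pull ` SJ \<subseteq> characters Q s"
      by blast
    have V: "V1 \<inter> (AnnJ \<inter> infs) = AnnJ \<inter> infs"
      using infs_V1 by blast
    fix \<psi> assume "\<psi> \<in> SJ"
    then show "\<exists>U1 W1 \<Phi>1 F1 U2 W2 \<Phi>2 F2.
        \<psi> \<in> U1 \<and> submanifold_chart hs UF SJ U1 W1 \<Phi>1 F1 \<and>
        inv_into (characters Q s) pull \<psi> \<in> U2 \<and>
        submanifold_chart hs (unit_functionals Q s) (characters Q s) U2 W2 \<Phi>2 F2 \<and>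
        inv_into (characters Q s) pull ` (U1 \<inter> SJ) \<subseteq> U2 \<and>
        analytic_map hs hs F1 F2 (W1 \<inter> F1) (\<Phi>2 \<circ> inv_into (characters Q s) pull \<circ> inv_into U1 \<Phi>1)"
      using charQ charH an2 characters_UF G.characters_UF im V
      by - (rule exI[of _ UF], rule exI[of _ V1], rule exI[of _ Log], rule exI[of _ "AnnJ \<inter> infs"],
          rule exI[of _ "unit_functionals Q s"], rule exI[of _ G.V1], rule exI[of _ G.Log],
          rule exI[of _ G.infs], auto simp: V)
  qed
  have "carrier (char_group Q s) = characters Q s"
    by (simp add: char_group_def)
  then show ?thesis
    using pull_iso 1 2 by (simp add: lie_group_iso_def)
qed

end

theorem theoremC:
  fixes H :: "('k::real_or_complex, 'a) hopf"
    and Hn :: "nat \<Rightarrow> 'a set"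
    and J :: "'a set"
    and s :: "'k \<Rightarrow> 'b \<Rightarrow> 'b::{comm_ring, comm_monoid_mult, t2_space}"
  defines "GH \<equiv> char_group H s"
    and "S \<equiv> annihilator H J s \<inter> characters H s"
    and "Q \<equiv> quot_hopf H J"
  assumes "graded_connected_hopf H Hn"
    and "hopf_ideal H J"
    and "locally_convex_algebra s"
  shows
    "(closed_lie_subgroup (hom_scale s) (unit_functionals H s) GH S \<and>
      has_lie_algebra (hom_scale s) (unit_functionals H s) (GH\<lparr>carrier := S\<rparr>)
        (annihilator H J s \<inter> infinitesimal_characters H s) (conv_bracket H)) \<and>
     (topological_group_iso (char_group Q s) (GH\<lparr>carrier := S\<rparr>) (quot_pullback H J) \<and>
      ((\<exists>Qn. graded_connected_hopf Q Qn) \<longrightarrow>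
         lie_group_iso (hom_scale s) (unit_functionals Q s) (char_group Q s)
           (hom_scale s) (unit_functionals H s) (GH\<lparr>carrier := S\<rparr>) (quot_pullback H J)) \<and>
      (homogeneous_ideal H Hn J \<longrightarrow>
         graded_connected_hopf Q (\<lambda>n. (\<lambda>x. J +>\<^bsub>H\<^esub> x) ` Hn n)))"
proof -
  have "hopf_algebra H"
    using assms(4) by (simp add: graded_connected_hopf_def)
  then interpret quot_lca H s Hn J
    by (intro quot_lca.intro lca_hopf.intro graded_conv_alg.intro conv_alg.intro hopf_alg.intro
        conv_alg_axioms.intro graded_conv_alg_axioms.intro lca_hopf_axioms.intro hopf_quot.intro
        hopf_quot_axioms.intro locally_convex_algebraD(1,2) assms(4-6))
  show ?thesis
    unfolding GH_def S_def Q_def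
    using closed_lie_subgroup_annihilator[OF assms(5)] has_lie_algebra_annihilator[OF assms(5)]
      topological_group_iso_pull lie_group_iso_pull graded_connected_Q[OF assms(4)]
    by blast
qed

end
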